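(* Let $\mathcal{P}$ be a singular maximal abelian sub-algebra of $\mathcal{R}_\infty$, the hyperfinite factor of type $\mathrm{II}_\infty$. Then every project $\mathfrak{a}=(p,a,\alpha,\mathcal{A},A)$ which is promising w.r.t. the outlook $\mathcal{P}$ is trivial, i.e. $A=0$.
   Context: Notation: $\mathcal{R}$ is the hyperfinite type $\mathrm{II}_1$ factor, $\mathcal{R}_\infty\cong B(H)\otimes\mathcal{R}$ the hyperfinite type $\mathrm{II}_\infty$ factor, with a fixed faithful normal semi-finite trace $\mathrm{tr}$. All tensor products are von Neumann algebra tensor products. A MASA in a von Neumann algebra $\mathcal{M}$ is a maximal abelian von Neumann sub-algebra. For a von Neumann sub-algebra $\mathcal{P}\subset\mathcal{M}$, the von Neumann algebra $\mathcal{N}_{\mathcal{M}}(\mathcal{P})$ is the one generated by the normaliser $\{u\in\mathcal{M} : u \text{ unitary},\ u\mathcal{P}u^*=\mathcal{P}\}$; the normalising groupoid is $G_{\mathcal{M}}(\mathcal{P})=\{u\in\mathcal{M} : uu^*u=u,\ uu^*\in\mathcal{P},\ u^*u\in\mathcal{P},\ u\mathcal{P}u^*\subset\mathcal{P}\}$. A MASA $\mathcal{P}$ of a factor $\mathcal{M}$ is singular if $\mathcal{N}_{\mathcal{M}}(\mathcal{P})=\mathcal{P}$. A pseudo-trace on a von Neumann algebra is a hermitian ($\alpha(u)=\overline{\alpha(u^* )}$), tracial ($\alpha(uv)=\alpha(vu)$), faithful, normal linear form. A (hyperfinite) project is a tuple $\mathfrak{a}=(p,a,\alpha,\mathcal{A},A)$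 where $p$ is a finite projection of $\mathcal{R}_\infty$ (the carrier), $a\in\mathbb{R}\cup\{\infty\}$ (the wager), $\mathcal{A}$ is a finite von Neumann algebra of type $\mathrm{I}$ (the dialect), $\alpha$ is a pseudo-trace on $\mathcal{A}$, and $A\in p\mathcal{R}_\infty p\otimes\mathcal{A}$ is hermitian of norm at most $1$. An outlook is a MASA $\mathcal{P}$ of $\mathcal{R}_\infty$. A project $\mathfrak{a}=(p,a,\alpha,\mathcal{A},A)$ is promising w.r.t. $\mathcal{P}$ if: (1) $\mathcal{A}$ is a finite factor, i.e. a matrix algebra; (2) $\alpha$ is the normalised trace on $\mathcal{A}$; (3) $a=0$; (4) there is a MASA $\mathcal{Q}$ of $\mathcal{A}$ such that $A$ is a partial symmetry (a hermitian partial isometry) lying in the normalising groupoid $G_{\mathcal{R}_\infty\otimes\mathcal{A}}(\mathcal{P}\otimes\mathcal{Q})$, and (5) for every projection $\pi\in\mathcal{P}\otimes\mathcal{N}_{\mathcal{A}}(\mathcal{Q})$, $(\mathrm{tr}\otimes\alpha)(\pi A)=0$. *)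

theory Defs
  imports "HOL-Analysis.Analysis"
begin

section \<open>The complex Hilbert spaces \<open>\<ell>\<^sup>2(I)\<close>\<close>

text \<open>
  Every complex Hilbert space is unitarily isomorphic to some \<open>\<ell>\<^sup>2(I)\<close>, and the Hilbert space
  tensor product of \<open>\<ell>\<^sup>2(I)\<close> and \<open>\<ell>\<^sup>2(J)\<close> is \<open>\<ell>\<^sup>2(I \<times> J)\<close>.  The index set is a type variable.
\<close>

typedef 'i ell2 = "{f :: 'i \<Rightarrow> complex. (\<lambda>i. (cmod (f i))\<^sup>2) summable_on UNIV}"
  by (rule exI[of _ "\<lambda>_. 0"]) simp

setup_lifting type_definition_ell2

lemma ell2_add_summable:
  assumes "(\<lambda>i. (cmod (f i))\<^sup>2) summable_on A" "(\<lambda>i. (cmod (g i))\<^sup>2) summable_on A"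
  shows "(\<lambda>i. (cmod (f i + g i))\<^sup>2) summable_on A"
proof (rule summable_on_comparison_test)
  show "(\<lambda>i. 2 * (cmod (f i))\<^sup>2 + 2 * (cmod (g i))\<^sup>2) summable_on A"
    by (intro summable_on_add summable_on_cmult_right assms)
next
  fix i
  have "(cmod (f i + g i))\<^sup>2 \<le> (cmod (f i) + cmod (g i))\<^sup>2"
    by (intro power_mono norm_triangle_ineq) simp
  also have "\<dots> \<le> 2 * (cmod (f i))\<^sup>2 + 2 * (cmod (g i))\<^sup>2"
    using sum_squares_bound[of "cmod (f i)" "cmod (g i)"]
    by (simp add: power2_sum)
  finally show "(cmod (f i + g i))\<^sup>2 \<le> 2 * (cmod (f i))\<^sup>2 + 2 * (cmod (g i))\<^sup>2" .
qed simp

lemma ell2_scale_summable: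
  assumes "(\<lambda>i. (cmod (f i))\<^sup>2) summable_on A"
  shows "(\<lambda>i. (cmod (c * f i))\<^sup>2) summable_on A"
  by (simp add: norm_mult power_mult_distrib summable_on_cmult_right assms)

lemma ell2_mult_summable:
  assumes "(\<lambda>i. (cmod (f i))\<^sup>2) summable_on A" "(\<lambda>i. (cmod (g i))\<^sup>2) summable_on A"
  shows "(\<lambda>i. cnj (f i) * g i) summable_on A"
proof (rule abs_summable_summable, rule abs_summable_product)
  show "(\<lambda>i. norm (cnj (f i) * cnj (f i))) summable_on A" "(\<lambda>i. norm (g i * g i)) summable_on A"
    using assms by (simp_all add: norm_mult power2_eq_square)
qed

instantiation ell2 :: (type) real_vector
begin
lift_definition zero_ell2 :: "'a ell2" is "\<lambda>_. 0" by simp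
lift_definition plus_ell2 :: "'a ell2 \<Rightarrow> 'a ell2 \<Rightarrow> 'a ell2" is "\<lambda>f g i. f i + g i"
  by (rule ell2_add_summable)
lift_definition uminus_ell2 :: "'a ell2 \<Rightarrow> 'a ell2" is "\<lambda>f i. - f i" by simp
lift_definition minus_ell2 :: "'a ell2 \<Rightarrow> 'a ell2 \<Rightarrow> 'a ell2" is "\<lambda>f g i. f i - g i"
  using ell2_add_summable[where g="\<lambda>i. - g i" for g] by simp
lift_definition scaleR_ell2 :: "real \<Rightarrow> 'a ell2 \<Rightarrow> 'a ell2" is "\<lambda>r f i. of_real r * f i"
  by (rule ell2_scale_summable)
instance
  by standard (transfer; simp add: algebra_simps fun_eq_iff)+
end

lift_definition scaleC :: "complex \<Rightarrow> 'i ell2 \<Rightarrow> 'i ell2"  (infixr \<open>*\<^sub>C\<close> 75)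
  is "\<lambda>c f i. c * f i"
  by (rule ell2_scale_summable)

text \<open>The inner product is conjugate-linear in the first argument.\<close>

lift_definition cinner :: "'i ell2 \<Rightarrow> 'i ell2 \<Rightarrow> complex"
  is "\<lambda>f g. \<Sum>\<^sub>\<infinity>i. cnj (f i) * g i" .

lemma cinner_add_left: "cinner (x + y) z = cinner x z + cinner y z"
  by transfer (simp add: ring_distribs infsum_add ell2_mult_summable)

lemma cinner_commute: "cinner x y = cnj (cinner y x)"
  by transfer (simp flip: infsum_cnj add: mult.commute)

lemma cinner_add_right: "cinner z (x + y) = cinner z x + cinner z y"
  by (metis cinner_add_left cinner_commute complex_cnj_add)

lemma cinner_scaleC_right: "cinner x (c *\<^sub>C y) = c * cinner x y"
  by transfer (simp add: mult.left_commute infsum_cmult_right')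

lemma cinner_scaleC_left: "cinner (c *\<^sub>C x) y = cnj c * cinner x y"
  by (metis cinner_commute cinner_scaleC_right complex_cnj_mult)

lemma scaleR_scaleC: "r *\<^sub>R x = complex_of_real r *\<^sub>C x"
  by transfer simp

lemma scaleC_add_right: "c *\<^sub>C (x + y) = c *\<^sub>C x + c *\<^sub>C y"
  by transfer (simp add: algebra_simps)

lemma scaleC_scaleR: "c *\<^sub>C (r *\<^sub>R x) = r *\<^sub>R (c *\<^sub>C x)"
  by transfer (simp add: algebra_simps)

lemma cinner_same: "cinner x x = of_real (\<Sum>\<^sub>\<infinity>i. (cmod (Rep_ell2 x i))\<^sup>2)"
proof -
  have "cinner x x = (\<Sum>\<^sub>\<infinity>i. of_real ((cmod (Rep_ell2 x i))\<^sup>2))"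
    unfolding cinner.rep_eq
    by (rule infsum_cong) (simp add: complex_norm_square mult.commute del: of_real_power)
  also have "\<dots> = of_real (\<Sum>\<^sub>\<infinity>i. (cmod (Rep_ell2 x i))\<^sup>2)"
    by (rule infsumI, rule has_sum_of_real, rule has_sum_infsum) (use Rep_ell2[of x] in simp)
  finally show ?thesis .
qed

instantiation ell2 :: (type) real_inner
begin
definition inner_ell2 :: "'a ell2 \<Rightarrow> 'a ell2 \<Rightarrow> real" where "inner_ell2 x y = Re (cinner x y)"
definition norm_ell2 :: "'a ell2 \<Rightarrow> real" where "norm_ell2 x = sqrt (inner x x)"
definition dist_ell2 :: "'a ell2 \<Rightarrow> 'a ell2 \<Rightarrow> real" where "dist_ell2 x y = norm (x - y)"
definition sgn_ell2 :: "'a ell2 \<Rightarrow> 'a ell2" where "sgn_ell2 x = x /\<^sub>R norm x"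
definition uniformity_ell2 :: "('a ell2 \<times> 'a ell2) filter" where
  "uniformity_ell2 = (INF e\<in>{0<..}. principal {(x, y). dist x y < e})"
definition open_ell2 :: "'a ell2 set \<Rightarrow> bool" where
  "open_ell2 U = (\<forall>x\<in>U. \<forall>\<^sub>F (x', y) in uniformity. x' = x \<longrightarrow> y \<in> U)"
instance
proof
  fix x y z :: "'a ell2" and r :: real
  show "inner x y = inner y x"
    unfolding inner_ell2_def by (subst cinner_commute) simp
  show "inner (x + y) z = inner x z + inner y z"
    by (simp add: inner_ell2_def cinner_add_left)
  show "inner (r *\<^sub>R x) y = r * inner x y"
    by (simp add: inner_ell2_def scaleR_scaleC cinner_scaleC_left)
  have eq: "inner x x = (\<Sum>\<^sub>\<infinity>i. (cmod (Rep_ell2 x i))\<^sup>2)"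
    by (simp add: inner_ell2_def cinner_same)
  show "0 \<le> inner x x"
    unfolding eq by (rule infsum_nonneg) simp
  show "inner x x = 0 \<longleftrightarrow> x = 0"
  proof
    assume 0: "inner x x = 0"
    have "(cmod (Rep_ell2 x i))\<^sup>2 = 0" for i
      by (rule nonneg_infsum_le_0D[of "\<lambda>i. (cmod (Rep_ell2 x i))\<^sup>2" UNIV])
        (use 0 eq Rep_ell2[of x] in auto)
    then show "x = 0"
      by transfer auto
  next
    assume "x = 0"
    then show "inner x x = 0"
      unfolding eq by (simp add: zero_ell2.rep_eq)
  qed
qed (simp_all add: norm_ell2_def dist_ell2_def sgn_ell2_def uniformity_ell2_def open_ell2_def)
end

lemma norm_ell2_square: "(norm x)\<^sup>2 = (\<Sum>\<^sub>\<infinity>i. (cmod (Rep_ell2 x i))\<^sup>2)"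
  by (simp add: power2_norm_eq_inner inner_ell2_def cinner_same)

lemma sum_le_norm_ell2:
  assumes "finite F"
  shows "(\<Sum>i\<in>F. (cmod (Rep_ell2 x i))\<^sup>2) \<le> (norm x)\<^sup>2"
  unfolding norm_ell2_square
  by (rule finite_sum_le_infsum) (use Rep_ell2[of x] assms in auto)

lemma norm_scaleC: "norm (c *\<^sub>C x) = cmod c * norm x"
proof -
  have "(norm (c *\<^sub>C x))\<^sup>2 = (cmod c * norm x)\<^sup>2"
    by (simp add: norm_ell2_square scaleC.rep_eq norm_mult power_mult_distrib infsum_cmult_right')
  then show ?thesis by (simp add: power2_eq_iff_nonneg)
qed

instance ell2 :: (type) banach
proof
  fix X :: "nat \<Rightarrow> 'a ell2"
  assume X: "Cauchy X"
  have coord: "cmod (Rep_ell2 x i - Rep_ell2 y i) \<le> norm (x - y)" for x y :: "'a ell2" and i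
    using sum_le_norm_ell2[of "{i}" "x - y"]
    by (simp add: minus_ell2.rep_eq power2_le_iff_abs_le)
  have "Cauchy (\<lambda>n. Rep_ell2 (X n) i)" for i
  proof (rule metric_CauchyI)
    fix e :: real assume "0 < e"
    then obtain M where "\<forall>m\<ge>M. \<forall>n\<ge>M. dist (X m) (X n) < e"
      using metric_CauchyD[OF X] by blast
    then show "\<exists>M. \<forall>m\<ge>M. \<forall>n\<ge>M. dist (Rep_ell2 (X m) i) (Rep_ell2 (X n) i) < e"
      unfolding dist_norm by (meson coord le_less_trans)
  qed
  then have "\<exists>l. (\<lambda>n. Rep_ell2 (X n) i) \<longlonglongrightarrow> l" for i
    using Cauchy_convergent convergent_def by blast
  then obtain f where f: "\<And>i. (\<lambda>n. Rep_ell2 (X n) i) \<longlonglongrightarrow> f i" by metis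
  have bound: "(\<Sum>i\<in>F. (cmod (Rep_ell2 (X n) i - f i))\<^sup>2) \<le> e\<^sup>2"
    if M: "\<And>m. m \<ge> M \<Longrightarrow> norm (X n - X m) \<le> e" and F: "finite F" for M n e F
  proof (rule tendsto_upperbound)
    show "(\<lambda>m. \<Sum>i\<in>F. (cmod (Rep_ell2 (X n) i - Rep_ell2 (X m) i))\<^sup>2)
      \<longlonglongrightarrow> (\<Sum>i\<in>F. (cmod (Rep_ell2 (X n) i - f i))\<^sup>2)"
      by (intro tendsto_intros f)
    show "\<forall>\<^sub>F m in sequentially.
      (\<Sum>i\<in>F. (cmod (Rep_ell2 (X n) i - Rep_ell2 (X m) i))\<^sup>2) \<le> e\<^sup>2"
    proof (rule eventually_sequentiallyI[of M])
      fix m assume "M \<le> m"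
      have "(\<Sum>i\<in>F. (cmod (Rep_ell2 (X n) i - Rep_ell2 (X m) i))\<^sup>2) \<le> (norm (X n - X m))\<^sup>2"
        using sum_le_norm_ell2[OF F, of "X n - X m"] by (simp add: minus_ell2.rep_eq)
      also have "\<dots> \<le> e\<^sup>2"
        using M[OF \<open>M \<le> m\<close>] by (intro power_mono) auto
      finally show "(\<Sum>i\<in>F. (cmod (Rep_ell2 (X n) i - Rep_ell2 (X m) i))\<^sup>2) \<le> e\<^sup>2" .
    qed
  qed simp
  have cau: "\<exists>M. \<forall>n\<ge>M. \<forall>m\<ge>M. norm (X n - X m) \<le> e" if "0 < e" for e
    using metric_CauchyD[OF X that] unfolding dist_norm by (meson less_imp_le)
  have summ: "(\<lambda>i. (cmod (Rep_ell2 (X n) i - f i))\<^sup>2) summable_on UNIV"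
    if M: "\<And>m. m \<ge> M \<Longrightarrow> norm (X n - X m) \<le> e" for M n e
    by (rule nonneg_bdd_above_summable_on) (auto intro!: bdd_aboveI2 bound[OF M])
  obtain N where N: "\<And>n m. n \<ge> N \<Longrightarrow> m \<ge> N \<Longrightarrow> norm (X n - X m) \<le> 1"
    using cau[of 1] by auto
  have "(\<lambda>i. (cmod (- (Rep_ell2 (X N) i - f i) + Rep_ell2 (X N) i))\<^sup>2) summable_on UNIV"
    by (rule ell2_add_summable) (use summ[of N N 1] N Rep_ell2[of "X N"] in \<open>auto simp: norm_minus_commute\<close>)
  then have "(\<lambda>i. (cmod (f i))\<^sup>2) summable_on UNIV" by simp
  then obtain L where L: "Rep_ell2 L = f"
    by (metis (mono_tags, lifting) Abs_ell2_inverse mem_Collect_eq)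
  have "X \<longlonglongrightarrow> L"
  proof (rule metric_LIMSEQ_I)
    fix r :: real assume "0 < r"
    then obtain M where M: "\<And>n m. n \<ge> M \<Longrightarrow> m \<ge> M \<Longrightarrow> norm (X n - X m) \<le> r / 2"
      using cau[of "r / 2"] by auto
    have "dist (X n) L < r" if "n \<ge> M" for n
    proof -
      have "(norm (X n - L))\<^sup>2 \<le> (r / 2)\<^sup>2"
        unfolding norm_ell2_square minus_ell2.rep_eq L
        by (rule infsum_le_finite_sums) (use summ[OF M] bound[OF M] that in auto)
      then have "norm (X n - L) \<le> r / 2"
        using \<open>0 < r\<close> power2_le_imp_le by fastforce
      then show ?thesis using \<open>0 < r\<close> by (simp add: dist_norm)
    qed
    then show "\<exists>no. \<forall>n\<ge>no. dist (X n) L < r" by blast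
  qed
  then show "convergent X" by (rule convergentI)
qed

lift_definition ell2_tensor :: "'i ell2 \<Rightarrow> 'j ell2 \<Rightarrow> ('i \<times> 'j) ell2"  (infixr \<open>\<otimes>\<^sub>v\<close> 70)
  is "\<lambda>f g (i, j). f i * g j"
proof -
  fix f :: "'i \<Rightarrow> complex" and g :: "'j \<Rightarrow> complex"
  assume f: "(\<lambda>i. (cmod (f i))\<^sup>2) summable_on UNIV" and g: "(\<lambda>j. (cmod (g j))\<^sup>2) summable_on UNIV"
  let ?h = "\<lambda>p. norm (case p of (i, j) \<Rightarrow> (cmod (f i))\<^sup>2 * (cmod (g j))\<^sup>2)"
  have h: "?h (i, j) = (cmod (f i))\<^sup>2 * (cmod (g j))\<^sup>2" for i j by simp
  have 0: "0 \<le> (\<Sum>\<^sub>\<infinity>j. (cmod (g j))\<^sup>2)"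
    by (rule infsum_nonneg) simp
  have *: "infsum (\<lambda>j. ?h (i, j)) UNIV = (cmod (f i))\<^sup>2 * (\<Sum>\<^sub>\<infinity>j. (cmod (g j))\<^sup>2)" for i
    unfolding h by (rule infsum_cmult_right')
  have **: "norm (infsum (\<lambda>j. ?h (i, j)) UNIV) = (cmod (f i))\<^sup>2 * (\<Sum>\<^sub>\<infinity>j. (cmod (g j))\<^sup>2)" for i
    unfolding * using 0 by (simp add: abs_mult)
  have "?h summable_on UNIV \<times> UNIV"
  proof (rule iffD2[OF Infinite_Sum.abs_summable_on_Sigma_iff], intro conjI ballI)
    show "(\<lambda>j. ?h (i, j)) summable_on UNIV" for i
      unfolding h by (intro summable_on_cmult_right g)
    show "(\<lambda>i. norm (infsum (\<lambda>j. ?h (i, j)) UNIV)) summable_on UNIV"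
      unfolding ** by (intro summable_on_cmult_left f)
  qed
  then have "(\<lambda>p. case p of (i, j) \<Rightarrow> (cmod (f i))\<^sup>2 * (cmod (g j))\<^sup>2) summable_on UNIV"
    by - (rule abs_summable_summable, simp only: UNIV_Times_UNIV)
  then show "(\<lambda>p. (cmod (case p of (i, j) \<Rightarrow> f i * g j))\<^sup>2) summable_on UNIV"
    by (simp add: norm_mult power_mult_distrib split_def)
qed


section \<open>Bounded operators\<close>

text \<open>
  The elements of \<open>'i op\<close> are the bounded real-linear maps; those belonging to \<open>B(\<ell>\<^sup>2(I))\<close> are
  singled out by \<open>bounded_ops\<close>.  The norm of \<open>'i op\<close> is the operator norm.
\<close>

type_synonym 'i op = "'i ell2 \<Rightarrow>\<^sub>L 'i ell2"

definition bounded_ops :: "'i op set" where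
  "bounded_ops = {T. \<forall>c x. blinfun_apply T (c *\<^sub>C x) = c *\<^sub>C blinfun_apply T x}"

lemma bounded_linear_scaleC: "bounded_linear (\<lambda>x :: 'i ell2. c *\<^sub>C x)"
  by (rule bounded_linear_intro[where K="cmod c"])
    (simp_all add: scaleC_add_right scaleC_scaleR norm_scaleC mult.commute)

definition op_scale :: "complex \<Rightarrow> 'i op \<Rightarrow> 'i op"  (infixr \<open>*\<^sub>O\<close> 75) where
  "c *\<^sub>O T = Blinfun (\<lambda>x. c *\<^sub>C blinfun_apply T x)"

lemma op_scale_apply [simp]: "blinfun_apply (c *\<^sub>O T) x = c *\<^sub>C blinfun_apply T x"
  unfolding op_scale_def
  by (subst bounded_linear_Blinfun_apply[OF bounded_linear_compose
        [OF bounded_linear_scaleC blinfun.bounded_linear_right]]) (rule refl)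

definition op_adj :: "'i op \<Rightarrow> 'i op"  (\<open>_\<^sup>\<dagger>\<close> [1000] 1000) where
  "T\<^sup>\<dagger> = (THE S :: 'i op. \<forall>x y. cinner (S x) y = cinner x (T y))"

definition op_tensor :: "'i op \<Rightarrow> 'j op \<Rightarrow> ('i \<times> 'j) op"  (infixr \<open>\<otimes>\<^sub>o\<close> 70) where
  "S \<otimes>\<^sub>o T = (THE U :: ('i \<times> 'j) op. U \<in> bounded_ops \<and> (\<forall>x y. U (x \<otimes>\<^sub>v y) = S x \<otimes>\<^sub>v T y))"

definition positive_op :: "'i op \<Rightarrow> bool" where
  "positive_op T \<longleftrightarrow> T \<in> bounded_ops \<and> (\<forall>x. cinner x (T x) \<in> \<real>\<^sub>\<ge>\<^sub>0)"

definition op_le :: "'i op \<Rightarrow> 'i op \<Rightarrow> bool" where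
  "op_le S T \<longleftrightarrow> positive_op (T - S)"

definition hermitian :: "'i op \<Rightarrow> bool" where
  "hermitian T \<longleftrightarrow> T\<^sup>\<dagger> = T"

definition unitary :: "'i op \<Rightarrow> bool" where
  "unitary u \<longleftrightarrow> u o\<^sub>L u\<^sup>\<dagger> = id_blinfun \<and> u\<^sup>\<dagger> o\<^sub>L u = id_blinfun"

definition partial_isometry :: "'i op \<Rightarrow> bool" where
  "partial_isometry u \<longleftrightarrow> u o\<^sub>L u\<^sup>\<dagger> o\<^sub>L u = u"

definition partial_symmetry :: "'i op \<Rightarrow> bool" where
  "partial_symmetry u \<longleftrightarrow> hermitian u \<and> partial_isometry u"


section \<open>Von Neumann algebras\<close>

definition commutant :: "'i op set \<Rightarrow> 'i op set" where
  "commutant S = {T \<in> bounded_ops. \<forall>s\<in>S. T o\<^sub>L s = s o\<^sub>L T}"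

definition von_neumann_algebra :: "'i op set \<Rightarrow> bool" where
  "von_neumann_algebra M \<longleftrightarrow>
     M \<subseteq> bounded_ops \<and> (\<forall>x\<in>M. x\<^sup>\<dagger> \<in> M) \<and> commutant (commutant M) = M"

definition vN_generated :: "'i op set \<Rightarrow> 'i op set" where
  "vN_generated S = \<Inter> {N. von_neumann_algebra N \<and> S \<subseteq> N}"

definition vN_tensor :: "'i op set \<Rightarrow> 'j op set \<Rightarrow> ('i \<times> 'j) op set"  (infixr \<open>\<otimes>\<^sub>A\<close> 70) where
  "M \<otimes>\<^sub>A N = vN_generated {x \<otimes>\<^sub>o y | x y. x \<in> M \<and> y \<in> N}"

definition corner :: "'i op \<Rightarrow> 'i op set \<Rightarrow> 'i op set" where
  "corner p M = {p o\<^sub>L x o\<^sub>L p | x. x \<in> M}"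

definition commutative_ops :: "'i op set \<Rightarrow> bool" where
  "commutative_ops S \<longleftrightarrow> (\<forall>x\<in>S. \<forall>y\<in>S. x o\<^sub>L y = y o\<^sub>L x)"

definition factor :: "'i op set \<Rightarrow> bool" where
  "factor M \<longleftrightarrow> von_neumann_algebra M \<and> M \<inter> commutant M = range (\<lambda>c. c *\<^sub>O id_blinfun)"

definition star_isomorphism :: "('i op \<Rightarrow> 'j op) \<Rightarrow> 'i op set \<Rightarrow> 'j op set \<Rightarrow> bool" where
  "star_isomorphism \<phi> M N \<longleftrightarrow> bij_betw \<phi> M N \<and>
     (\<forall>x\<in>M. \<forall>y\<in>M. \<phi> (x + y) = \<phi> x + \<phi> y \<and> \<phi> (x o\<^sub>L y) = \<phi> x o\<^sub>L \<phi> y) \<and>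
     (\<forall>x\<in>M. \<phi> (x\<^sup>\<dagger>) = (\<phi> x)\<^sup>\<dagger> \<and> (\<forall>c. \<phi> (c *\<^sub>O x) = c *\<^sub>O \<phi> x))"

text \<open>\<open>N\<close> is isomorphic to \<open>M\<^sub>n(\<complex>)\<close> for some \<open>n\<close>, via a system of matrix units.\<close>

definition matrix_algebra :: "'i op set \<Rightarrow> bool" where
  "matrix_algebra N \<longleftrightarrow> von_neumann_algebra N \<and>
     (\<exists>n (e :: nat \<Rightarrow> nat \<Rightarrow> 'i op).
        (\<forall>i<n. \<forall>j<n. e i j \<in> N \<and> (e i j)\<^sup>\<dagger> = e j i) \<and>
        (\<forall>i<n. \<forall>j<n. \<forall>k<n. \<forall>l<n. e i j o\<^sub>L e k l = (if j = k then e i l else 0)) \<and>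
        (\<Sum>i<n. e i i) = id_blinfun \<and>
        (\<forall>x\<in>N. \<exists>c. x = (\<Sum>i<n. \<Sum>j<n. c i j *\<^sub>O e i j)))"


subsection \<open>Projections and types\<close>

definition projections :: "'i op set \<Rightarrow> 'i op set" where
  "projections M = {p \<in> M. p\<^sup>\<dagger> = p \<and> p o\<^sub>L p = p}"

text \<open>Murray-von Neumann finiteness; for projections, \<open>q \<le> p\<close> is expressed by \<open>p q = q\<close>.\<close>

definition finite_projection :: "'i op set \<Rightarrow> 'i op \<Rightarrow> bool" where
  "finite_projection M p \<longleftrightarrow> p \<in> projections M \<and>
     (\<forall>v\<in>M. v\<^sup>\<dagger> o\<^sub>L v = p \<and> p o\<^sub>L (v o\<^sub>L v\<^sup>\<dagger>) = v o\<^sub>L v\<^sup>\<dagger> \<longrightarrow> v o\<^sub>L v\<^sup>\<dagger> = p)"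

definition abelian_projection :: "'i op set \<Rightarrow> 'i op \<Rightarrow> bool" where
  "abelian_projection M e \<longleftrightarrow> e \<in> projections M \<and> commutative_ops (corner e M)"

definition finite_vN :: "'i op set \<Rightarrow> bool" where
  "finite_vN M \<longleftrightarrow> von_neumann_algebra M \<and> finite_projection M id_blinfun"

definition type_I :: "'i op set \<Rightarrow> bool" where
  "type_I M \<longleftrightarrow> von_neumann_algebra M \<and>
     (\<forall>z\<in>projections (M \<inter> commutant M). z \<noteq> 0 \<longrightarrow>
        (\<exists>e. abelian_projection M e \<and> e \<noteq> 0 \<and> z o\<^sub>L e = e))"

definition II_1_factor :: "'i op set \<Rightarrow> bool" where
  "II_1_factor M \<longleftrightarrow> factor M \<and> finite_projection M id_blinfun \<and>
     (\<forall>e. abelian_projection M e \<longrightarrow> e = 0)"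

definition findim_star_subalgebra :: "'i op set \<Rightarrow> bool" where
  "findim_star_subalgebra F \<longleftrightarrow> F \<subseteq> bounded_ops \<and> id_blinfun \<in> F \<and>
     (\<forall>x\<in>F. \<forall>y\<in>F. x + y \<in> F \<and> x o\<^sub>L y \<in> F) \<and>
     (\<forall>x\<in>F. x\<^sup>\<dagger> \<in> F \<and> (\<forall>c. c *\<^sub>O x \<in> F)) \<and>
     (\<exists>B. finite B \<and> F \<subseteq> span B)"

definition hyperfinite :: "'i op set \<Rightarrow> bool" where
  "hyperfinite M \<longleftrightarrow>
     (\<exists>F :: nat \<Rightarrow> 'i op set. (\<forall>n. findim_star_subalgebra (F n) \<and> F n \<subseteq> F (Suc n)) \<and>
        M = vN_generated (\<Union>n. F n))"

text \<open>
  \<open>M\<close> is (a faithful normal representation of) \<open>\<R>\<^sub>\<infinity> \<cong> B(H) \<otimes> \<R>\<close> with \<open>H\<close> separable and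
  infinite-dimensional.  A *-isomorphism between von Neumann algebras is automatically normal.
\<close>

definition hyperfinite_II_infinity :: "'i op set \<Rightarrow> bool" where
  "hyperfinite_II_infinity M \<longleftrightarrow> von_neumann_algebra M \<and>
     (\<exists>(R :: nat op set) \<phi>. II_1_factor R \<and> hyperfinite R \<and>
        star_isomorphism \<phi> M ((bounded_ops :: nat op set) \<otimes>\<^sub>A R))"


subsection \<open>Maximal abelian subalgebras and normalisers\<close>

definition masa :: "'i op set \<Rightarrow> 'i op set \<Rightarrow> bool" where
  "masa M P \<longleftrightarrow> von_neumann_algebra P \<and> P \<subseteq> M \<and> commutative_ops P \<and>
     (\<forall>P'. von_neumann_algebra P' \<and> P' \<subseteq> M \<and> commutative_ops P' \<and> P \<subseteq> P' \<longrightarrow> P' = P)"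

definition normaliser :: "'i op set \<Rightarrow> 'i op set \<Rightarrow> 'i op set" where
  "normaliser M P = {u \<in> M. unitary u \<and> (\<lambda>x. u o\<^sub>L x o\<^sub>L u\<^sup>\<dagger>) ` P = P}"

definition normaliser_algebra :: "'i op set \<Rightarrow> 'i op set \<Rightarrow> 'i op set" where
  "normaliser_algebra M P = vN_generated (normaliser M P)"

definition normalising_groupoid :: "'i op set \<Rightarrow> 'i op set \<Rightarrow> 'i op set" where
  "normalising_groupoid M P =
     {u \<in> M. u o\<^sub>L u\<^sup>\<dagger> o\<^sub>L u = u \<and> u o\<^sub>L u\<^sup>\<dagger> \<in> P \<and> u\<^sup>\<dagger> o\<^sub>L u \<in> P \<and>
       (\<lambda>x. u o\<^sub>L x o\<^sub>L u\<^sup>\<dagger>) ` P \<subseteq> P}"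

definition singular_masa :: "'i op set \<Rightarrow> 'i op set \<Rightarrow> bool" where
  "singular_masa M P \<longleftrightarrow> masa M P \<and> normaliser_algebra M P = P"


subsection \<open>Traces\<close>

definition pos_cone :: "'i op set \<Rightarrow> 'i op set" where
  "pos_cone M = {x \<in> M. positive_op x}"

text \<open>Only the values of \<open>\<tau>\<close> on \<open>pos_cone M\<close> are relevant.\<close>

definition trace_on :: "'i op set \<Rightarrow> ('i op \<Rightarrow> ennreal) \<Rightarrow> bool" where
  "trace_on M \<tau> \<longleftrightarrow>
     (\<forall>x\<in>pos_cone M. \<forall>y\<in>pos_cone M. \<tau> (x + y) = \<tau> x + \<tau> y) \<and>
     (\<forall>x\<in>pos_cone M. \<forall>r\<ge>0. \<tau> (r *\<^sub>R x) = ennreal r * \<tau> x) \<and>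
     (\<forall>x\<in>M. \<tau> (x\<^sup>\<dagger> o\<^sub>L x) = \<tau> (x o\<^sub>L x\<^sup>\<dagger>))"

definition faithful_trace :: "'i op set \<Rightarrow> ('i op \<Rightarrow> ennreal) \<Rightarrow> bool" where
  "faithful_trace M \<tau> \<longleftrightarrow> (\<forall>x\<in>pos_cone M. \<tau> x = 0 \<longrightarrow> x = 0)"

definition op_directed :: "'i op set \<Rightarrow> bool" where
  "op_directed D \<longleftrightarrow> D \<noteq> {} \<and> (\<forall>x\<in>D. \<forall>y\<in>D. \<exists>z\<in>D. op_le x z \<and> op_le y z)"

definition op_lub :: "'i op set \<Rightarrow> 'i op set \<Rightarrow> 'i op \<Rightarrow> bool" where
  "op_lub M D s \<longleftrightarrow> s \<in> M \<and> (\<forall>x\<in>D. op_le x s) \<and> (\<forall>t\<in>M. (\<forall>x\<in>D. op_le x t) \<longrightarrow> op_le s t)"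

definition normal_trace :: "'i op set \<Rightarrow> ('i op \<Rightarrow> ennreal) \<Rightarrow> bool" where
  "normal_trace M \<tau> \<longleftrightarrow>
     (\<forall>D s. D \<subseteq> pos_cone M \<and> op_directed D \<and> op_lub M D s \<longrightarrow> \<tau> s = (SUP x\<in>D. \<tau> x))"

definition semifinite_trace :: "'i op set \<Rightarrow> ('i op \<Rightarrow> ennreal) \<Rightarrow> bool" where
  "semifinite_trace M \<tau> \<longleftrightarrow>
     (\<forall>x\<in>pos_cone M. x \<noteq> 0 \<longrightarrow> (\<exists>y\<in>pos_cone M. y \<noteq> 0 \<and> op_le y x \<and> \<tau> y < \<infinity>))"

definition fns_trace :: "'i op set \<Rightarrow> ('i op \<Rightarrow> ennreal) \<Rightarrow> bool" where
  "fns_trace M \<tau> \<longleftrightarrow>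
     trace_on M \<tau> \<and> faithful_trace M \<tau> \<and> normal_trace M \<tau> \<and> semifinite_trace M \<tau>"

text \<open>
  \<open>x\<close> lies in the definition ideal of \<open>\<tau>\<close> (the linear span of the positive elements of finite
  trace), and the linear extension of \<open>\<tau>\<close> to this ideal takes the value \<open>c\<close> at \<open>x\<close>.
\<close>

definition has_trace :: "'i op set \<Rightarrow> ('i op \<Rightarrow> ennreal) \<Rightarrow> 'i op \<Rightarrow> complex \<Rightarrow> bool" where
  "has_trace M \<tau> x c \<longleftrightarrow>
     (\<exists>x1\<in>pos_cone M. \<exists>x2\<in>pos_cone M. \<exists>x3\<in>pos_cone M. \<exists>x4\<in>pos_cone M.
        \<tau> x1 < \<infinity> \<and> \<tau> x2 < \<infinity> \<and> \<tau> x3 < \<infinity> \<and> \<tau> x4 < \<infinity> \<and>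
        x = (x1 - x2) + \<i> *\<^sub>O (x3 - x4) \<and>
        c = complex_of_real (enn2real (\<tau> x1) - enn2real (\<tau> x2)) +
            \<i> * complex_of_real (enn2real (\<tau> x3) - enn2real (\<tau> x4)))"

definition linear_form :: "'i op set \<Rightarrow> ('i op \<Rightarrow> complex) \<Rightarrow> bool" where
  "linear_form N \<alpha> \<longleftrightarrow>
     (\<forall>x\<in>N. \<forall>y\<in>N. \<alpha> (x + y) = \<alpha> x + \<alpha> y) \<and> (\<forall>x\<in>N. \<forall>c. \<alpha> (c *\<^sub>O x) = c * \<alpha> x)"

definition tracial_form :: "'i op set \<Rightarrow> ('i op \<Rightarrow> complex) \<Rightarrow> bool" where
  "tracial_form N \<alpha> \<longleftrightarrow> (\<forall>u\<in>N. \<forall>v\<in>N. \<alpha> (u o\<^sub>L v) = \<alpha> (v o\<^sub>L u))"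

text \<open>A linear form is normal iff it is \<open>\<sigma>\<close>-weakly continuous, i.e. of the following form.\<close>

definition normal_form :: "'i op set \<Rightarrow> ('i op \<Rightarrow> complex) \<Rightarrow> bool" where
  "normal_form N \<alpha> \<longleftrightarrow>
     (\<exists>\<xi> \<eta> :: nat \<Rightarrow> 'i ell2. summable (\<lambda>n. (norm (\<xi> n))\<^sup>2) \<and> summable (\<lambda>n. (norm (\<eta> n))\<^sup>2) \<and>
        (\<forall>x\<in>N. (\<lambda>n. cinner (\<xi> n) (blinfun_apply x (\<eta> n))) sums \<alpha> x))"

text \<open>
  A pseudo-trace need not be positive, so faithfulness means non-degeneracy of the bilinear form
  \<open>(u, v) \<mapsto> \<alpha>(u v)\<close>; for a positive tracial form this is the usual notion.
\<close>

definition pseudo_trace :: "'i op set \<Rightarrow> ('i op \<Rightarrow> complex) \<Rightarrow> bool" where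
  "pseudo_trace N \<alpha> \<longleftrightarrow> linear_form N \<alpha> \<and> (\<forall>u\<in>N. \<alpha> u = cnj (\<alpha> (u\<^sup>\<dagger>))) \<and> tracial_form N \<alpha> \<and>
     (\<forall>u\<in>N. (\<forall>v\<in>N. \<alpha> (u o\<^sub>L v) = 0) \<longrightarrow> u = 0) \<and> normal_form N \<alpha>"

definition normalised_trace :: "'i op set \<Rightarrow> ('i op \<Rightarrow> complex) \<Rightarrow> bool" where
  "normalised_trace N \<alpha> \<longleftrightarrow> linear_form N \<alpha> \<and> tracial_form N \<alpha> \<and>
     (\<forall>x\<in>pos_cone N. \<alpha> x \<in> \<real>\<^sub>\<ge>\<^sub>0) \<and> \<alpha> id_blinfun = 1"

text \<open>
  \<open>\<tau>\<close> is the tensor product trace \<open>tr \<otimes> \<alpha>\<close> on \<open>M \<otimes> N\<close>, for a faithful, normal, positive tracial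
  form \<open>\<alpha>\<close>: the faithful normal semi-finite trace determined by its values on simple tensors.
\<close>

definition tensor_trace ::
  "'i op set \<Rightarrow> ('i op \<Rightarrow> ennreal) \<Rightarrow> 'j op set \<Rightarrow> ('j op \<Rightarrow> complex) \<Rightarrow> (('i \<times> 'j) op \<Rightarrow> ennreal) \<Rightarrow> bool"
  where
  "tensor_trace M tr N \<alpha> \<tau> \<longleftrightarrow> fns_trace (M \<otimes>\<^sub>A N) \<tau> \<and>
     (\<forall>x\<in>pos_cone M. \<forall>y\<in>pos_cone N. \<tau> (x \<otimes>\<^sub>o y) = tr x * ennreal (Re (\<alpha> y)))"


section \<open>Projects\<close>

record ('i, 'j) project =
  support :: "'i op"
  wager :: ereal
  form :: "'j op \<Rightarrow> complex"
  dialect :: "'j op set"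
  oper :: "('i \<times> 'j) op"

text \<open>The algebra \<open>pRp \<otimes> \<A>\<close> is identified with the corner \<open>(p \<otimes> 1)(R \<otimes> \<A>)(p \<otimes> 1)\<close>.\<close>

definition is_project :: "'i op set \<Rightarrow> ('i, 'j) project \<Rightarrow> bool" where
  "is_project R a \<longleftrightarrow>
     finite_projection R (support a) \<and>
     wager a \<noteq> -\<infinity> \<and>
     finite_vN (dialect a) \<and> type_I (dialect a) \<and>
     pseudo_trace (dialect a) (form a) \<and>
     oper a \<in> corner (support a \<otimes>\<^sub>o id_blinfun) (R \<otimes>\<^sub>A dialect a) \<and>
     hermitian (oper a) \<and> norm (oper a) \<le> 1"

definition promising :: "'i op set \<Rightarrow> ('i op \<Rightarrow> ennreal) \<Rightarrow> 'i op set \<Rightarrow> ('i, 'j) project \<Rightarrow> bool" where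
  "promising R tr P a \<longleftrightarrow>
     matrix_algebra (dialect a) \<and>
     normalised_trace (dialect a) (form a) \<and>
     wager a = 0 \<and>
     (\<exists>Q. masa (dialect a) Q \<and>
        partial_symmetry (oper a) \<and>
        oper a \<in> normalising_groupoid (R \<otimes>\<^sub>A dialect a) (P \<otimes>\<^sub>A Q) \<and>
        (\<exists>\<tau>. tensor_trace R tr (dialect a) (form a) \<tau> \<and>
           (\<forall>\<pi>\<in>projections (P \<otimes>\<^sub>A normaliser_algebra (dialect a) Q).
              has_trace (R \<otimes>\<^sub>A dialect a) \<tau> (\<pi> o\<^sub>L oper a) 0)))"

end

theory Submission
  imports Defs
begin

text \<open>
  Let \<open>A\<close> be the operator of a project that is promising with respect to \<open>P\<close>, let \<open>N\<close> be its dialect and \<open>Q\<close> the MASA of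
  \<open>N\<close> in question.  Minimal projections \<open>f, g\<close> of \<open>Q\<close> with sum \<open>1\<close>, and partial isometries \<open>w\<close> of \<open>N\<close> between them,
  decompose \<open>A\<close> as a sum of terms \<open>a \<otimes> w\<close> with \<open>a \<in> R\<close>.  Since \<open>A\<close> normalises \<open>P \<otimes> Q\<close>, every coefficient \<open>a\<close> is a
  partial isometry with \<open>a P a\<^sup>* \<subseteq> P\<close> and \<open>a\<^sup>* P a \<subseteq> P\<close> (\<open>matrix_entry_in_singular_masa\<close>).

  A singular MASA contains every such \<open>a\<close> (\<open>singular_masa_contains_partial_normaliser\<close>).  If the partial automorphism
  \<open>x \<mapsto> a x a\<^sup>*\<close> of \<open>P\<close> moved some projection of \<open>P\<close>, it would carry some nonzero projection \<open>e \<in> P\<close> to an orthogonal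
  projection \<open>e'\<close>, and \<open>a e + e a\<^sup>* + (1 - e - e')\<close> would be a unitary that normalises \<open>P\<close> without commuting with
  \<open>e\<close>.  So \<open>a\<close> commutes with the projections of \<open>P\<close>, hence with \<open>P\<close>, and belongs to \<open>P\<close> by maximality.

  The partial isometries \<open>w\<close> lie in the algebra generated by the normaliser of \<open>Q\<close> in \<open>N\<close>, so \<open>A\<close> lies in the tensor product of
  \<open>P\<close> with that algebra (\<open>partial_symmetry_in_masa_tensor_normaliser\<close>).  Then so do the projections
  \<open>(A\<^sup>2 + A)/2\<close> and \<open>(A\<^sup>2 - A)/2\<close> onto the eigenspaces of \<open>A\<close> for \<open>1\<close> and \<open>-1\<close>.  Testing the vanishing trace condition on
  them shows that both have trace zero.  As the trace is faithful they vanish, and \<open>A\<close> is their difference.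

  Two analytic facts support this.  An operator in \<open>R \<otimes> N\<close> has its slices in \<open>R\<close> and in \<open>N\<close>, because these slices
  commute with the respective commutants.  And an operator that commutes with the projections of a von Neumann algebra
  commutes with the whole algebra (\<open>commutant_projections\<close>); here the modulus of a hermitian operator comes from an
  iteration for the square root, and repeated bisection of an interval containing the spectrum makes the commutator vanish.
\<close>

section \<open>Complex inner products\<close>

lemma scaleC_left_distrib: "(a + b) *\<^sub>C x = a *\<^sub>C x + b *\<^sub>C x"
  by transfer (simp add: algebra_simps)

lemma scaleC_scaleC: "a *\<^sub>C (b *\<^sub>C x) = (a * b) *\<^sub>C x"
  by transfer (simp add: algebra_simps)

lemma scaleC_one [simp]: "1 *\<^sub>C x = x"
  by transfer simp

lemma scaleC_zero_left [simp]: "0 *\<^sub>C x = 0"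
  by transfer simp

lemma scaleC_zero_right [simp]: "c *\<^sub>C 0 = 0"
  by transfer simp

lemma scaleC_minus_left [simp]: "(- c) *\<^sub>C x = - (c *\<^sub>C x)"
  by transfer simp

lemma scaleC_diff_right: "c *\<^sub>C (x - y) = c *\<^sub>C x - c *\<^sub>C y"
  by transfer (simp add: algebra_simps)

lemma cinner_zero_left [simp]: "cinner 0 x = 0"
  using cinner_scaleC_left[of 0 0 x] by simp

lemma cinner_zero_right [simp]: "cinner x 0 = 0"
  using cinner_scaleC_right[of x 0 0] by simp

lemma cinner_minus_left [simp]: "cinner (- x) y = - cinner x y"
  using cinner_scaleC_left[of "-1" x y] by simp

lemma cinner_minus_right [simp]: "cinner x (- y) = - cinner x y"
  using cinner_scaleC_right[of x "-1" y] by simp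

lemma cinner_diff_left: "cinner (x - y) z = cinner x z - cinner y z"
  using cinner_add_left[of x "- y" z] by simp

lemma cinner_diff_right: "cinner z (x - y) = cinner z x - cinner z y"
  using cinner_add_right[of z x "- y"] by simp

lemmas cinner_simps = cinner_add_left cinner_add_right cinner_diff_left cinner_diff_right
  cinner_scaleC_left cinner_scaleC_right

lemma cinner_norm: "cinner x x = complex_of_real ((norm x)\<^sup>2)"
  by (simp add: cinner_same norm_ell2_square)

lemma cinner_self_eq_0 [simp]: "cinner x x = 0 \<longleftrightarrow> x = 0"
  by (simp add: cinner_norm)

lemma cinner_ext: "(\<And>z. cinner z x = cinner z y) \<Longrightarrow> x = y"
  using cinner_self_eq_0[of "x - y"] by (simp add: cinner_diff_right)

lemma inner_eq_Re_cinner: "inner x y = Re (cinner x y)"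
  by (rule inner_ell2_def)

lemma Im_cinner: "Im (cinner x y) = inner (\<i> *\<^sub>C x) y"
  by (simp add: inner_ell2_def cinner_scaleC_left)

lemma cinner_eq_0_iff_inner: "(\<forall>x\<in>S. cinner x y = 0) \<longleftrightarrow> (\<forall>x\<in>S. inner x y = 0)"
  if "\<And>c x. x \<in> S \<Longrightarrow> c *\<^sub>C x \<in> S"
  using that by (auto simp: complex_eq_iff Im_cinner inner_eq_Re_cinner)

text \<open>Rotating one argument by a phase makes the inner product real, which reduces the complex
  Cauchy-Schwarz inequality to the real one.\<close>

lemma cinner_Cauchy_Schwarz: "cmod (cinner x y) \<le> norm x * norm y"
proof (cases "cinner x y = 0")
  case False
  define c where "c = cinner x y / cmod (cinner x y)"
  have c: "cmod c = 1" using False by (simp add: c_def norm_divide)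
  have "cnj c * cinner x y = cmod (cinner x y)"
    using False by (simp add: c_def complex_norm_square power2_eq_square field_simps
        flip: of_real_power) (metis complex_norm_square mult.commute power2_eq_square of_real_mult)
  then have "cmod (cinner x y) = inner (c *\<^sub>C x) y"
    by (simp add: inner_ell2_def cinner_scaleC_left)
  also have "\<dots> \<le> norm (c *\<^sub>C x) * norm y"
    by (rule norm_cauchy_schwarz)
  finally show ?thesis by (simp add: norm_scaleC c)
qed simp

section \<open>Orthogonal projections and the Riesz representation\<close>

text \<open>A minimising sequence is Cauchy by the parallelogram law, because the midpoint of two of its members
  lies in \<open>S\<close> and so is no closer to \<open>x\<close> than the infimum allows.\<close>

lemma exists_nearest_point:
  fixes S :: "'i ell2 set"
  assumes S: "subspace S" "closed S"
  shows "\<exists>s\<in>S. \<forall>t\<in>S. norm (x - s) \<le> norm (x - t)"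
proof -
  define D where "D = (INF s\<in>S. (norm (x - s))\<^sup>2)"
  have bdd: "bdd_below ((\<lambda>s. (norm (x - s))\<^sup>2) ` S)"
    by (rule bdd_belowI[of _ 0]) auto
  have ne: "S \<noteq> {}" using S subspace_0 by auto
  have D: "D \<le> (norm (x - s))\<^sup>2" if "s \<in> S" for s
    unfolding D_def by (rule cINF_lower[OF bdd that])
  have "\<exists>s\<in>S. (norm (x - s))\<^sup>2 < D + 1 / real (Suc n)" for n
    using cINF_less_iff[OF ne bdd, of "D + 1 / real (Suc n)"] by (simp add: D_def)
  then obtain s where sS: "\<And>n. s n \<in> S"
    and s: "\<And>n. (norm (x - s n))\<^sup>2 < D + 1 / real (Suc n)" by metis
  have par: "(norm (s m - s n))\<^sup>2 \<le> 2 / real (Suc m) + 2 / real (Suc n)" for m n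
  proof -
    have "(1/2) *\<^sub>R (s m + s n) \<in> S" using S sS by (intro subspace_scale subspace_add)
    then have "4 * D \<le> 4 * (norm (x - (1/2) *\<^sub>R (s m + s n)))\<^sup>2" using D by simp
    moreover have "(norm (s m - s n))\<^sup>2 + 4 * (norm (x - (1/2) *\<^sub>R (s m + s n)))\<^sup>2
        = 2 * (norm (x - s m))\<^sup>2 + 2 * (norm (x - s n))\<^sup>2"
      by (simp add: power2_norm_eq_inner inner_simps algebra_simps inner_commute)
    moreover have "2 / real (Suc m) = 2 * (1 / real (Suc m))" "2 / real (Suc n) = 2 * (1 / real (Suc n))"
      by simp_all
    ultimately show ?thesis using s[of m] s[of n] by linarith
  qed
  have "Cauchy s"
  proof (rule metric_CauchyI)
    fix e :: real assume e: "0 < e"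
    obtain N where N: "4 / real (Suc N) < e\<^sup>2"
    proof -
      obtain N where "inverse (real (Suc N)) < e\<^sup>2 / 4"
        using reals_Archimedean[of "e\<^sup>2 / 4"] e by auto
      then show ?thesis by (intro that[of N]) (simp add: field_simps)
    qed
    have "dist (s m) (s n) < e" if "m \<ge> N" "n \<ge> N" for m n
    proof -
      have "2 / real (Suc m) \<le> 2 / real (Suc N)" "2 / real (Suc n) \<le> 2 / real (Suc N)"
        using that by (auto intro!: divide_left_mono)
      then have "(norm (s m - s n))\<^sup>2 < e\<^sup>2" using par[of m n] N by linarith
      then show ?thesis using e by (simp add: dist_norm power2_less_imp_less)
    qed
    then show "\<exists>M. \<forall>m\<ge>M. \<forall>n\<ge>M. dist (s m) (s n) < e" by blast
  qed
  then obtain l where l: "s \<longlonglongrightarrow> l" using Cauchy_convergent convergent_def by blast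
  have lS: "l \<in> S" using closed_sequentially[OF S(2)] sS l by blast
  have "(norm (x - l))\<^sup>2 \<le> D"
  proof (rule LIMSEQ_le)
    show "(\<lambda>n. (norm (x - s n))\<^sup>2) \<longlonglongrightarrow> (norm (x - l))\<^sup>2" by (intro tendsto_intros l)
    show "(\<lambda>n. D + 1 / real (Suc n)) \<longlonglongrightarrow> D"
      using tendsto_add[OF tendsto_const LIMSEQ_inverse_real_of_nat, of D]
      by (simp add: inverse_eq_divide)
  qed (use s less_imp_le in blast)
  then have "norm (x - l) \<le> norm (x - t)" if "t \<in> S" for t
    using D[OF that] by (auto intro: order_trans power2_le_imp_le[of "norm (x - l)"])
  then show ?thesis using lS by blast
qed

text \<open>If \<open>s\<close> is nearest to \<open>x\<close>, then moving from \<open>s\<close> to the best point on the line through \<open>s\<close> in direction \<open>t\<close>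
  lowers the squared distance by \<open>\<langle>t, x - s\<rangle>\<^sup>2 / \<parallel>t\<parallel>\<^sup>2\<close>, so this quantity is zero.\<close>

lemma exists_orthogonal_decomposition:
  fixes S :: "'i ell2 set"
  assumes S: "subspace S" "closed S"
  shows "\<exists>s\<in>S. \<forall>t\<in>S. inner t (x - s) = 0"
proof -
  obtain s where s: "s \<in> S" and min: "\<And>t. t \<in> S \<Longrightarrow> norm (x - s) \<le> norm (x - t)"
    using exists_nearest_point[OF S] by blast
  have "inner t (x - s) = 0" if t: "t \<in> S" for t
  proof (cases "t = 0")
    case False
    define r where "r = inner t (x - s) / (norm t)\<^sup>2"
    have n: "(norm t)\<^sup>2 > 0" using False by simp
    have "(norm (x - s))\<^sup>2 \<le> (norm (x - (s + r *\<^sub>R t)))\<^sup>2"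
      by (intro power_mono min) (use S s t in \<open>auto intro: subspace_add subspace_scale\<close>)
    also have "(norm (x - (s + r *\<^sub>R t)))\<^sup>2
        = inner ((x - s) - r *\<^sub>R t) ((x - s) - r *\<^sub>R t)"
      by (simp add: power2_norm_eq_inner algebra_simps)
    also have "\<dots> = (norm (x - s))\<^sup>2 - 2 * r * inner t (x - s) + r\<^sup>2 * (norm t)\<^sup>2"
      unfolding inner_diff_left[of "x - s"] inner_diff_right[of _ "x - s"] power2_norm_eq_inner
      by (simp add: inner_commute[of "x - s" t] power2_eq_square del: inner_diff_right)
    also have "\<dots> = (norm (x - s))\<^sup>2 - (inner t (x - s))\<^sup>2 / (norm t)\<^sup>2"
      using n by (simp add: r_def field_simps power2_eq_square)
    finally have "(inner t (x - s))\<^sup>2 / (norm t)\<^sup>2 \<le> 0" by simp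
    then show ?thesis using n by (simp add: divide_le_0_iff)
  qed simp
  then show ?thesis using s by blast
qed

text \<open>The predicate \<open>subspace\<close> refers to real scalars only.\<close>

definition csubspace :: "'i ell2 set \<Rightarrow> bool" where
  "csubspace S \<longleftrightarrow> subspace S \<and> (\<forall>c. \<forall>x\<in>S. c *\<^sub>C x \<in> S)"

lemma csubspaceI:
  assumes "0 \<in> S" "\<And>x y. x \<in> S \<Longrightarrow> y \<in> S \<Longrightarrow> x + y \<in> S" "\<And>c x. x \<in> S \<Longrightarrow> c *\<^sub>C x \<in> S"
  shows "csubspace S"
  using assms unfolding csubspace_def subspace_def by (simp add: scaleR_scaleC)

lemma bounded_opsD: "T \<in> bounded_ops \<Longrightarrow> blinfun_apply T (c *\<^sub>C x) = c *\<^sub>C blinfun_apply T x"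
  by (simp add: bounded_ops_def)

lemma bounded_opsI:
  assumes add: "\<And>x y. f (x + y) = f x + f y" and scale: "\<And>c x. f (c *\<^sub>C x) = c *\<^sub>C f x"
    and bound: "\<And>x. norm (f x) \<le> K * norm x"
  shows "bounded_linear f" "Blinfun f \<in> bounded_ops"
proof -
  show "bounded_linear f"
    by (rule bounded_linear_intro[where K=K])
      (use add scale bound in \<open>simp_all add: scaleR_scaleC mult.commute\<close>)
  then show "Blinfun f \<in> bounded_ops"
    by (simp add: bounded_ops_def bounded_linear_Blinfun_apply scale)
qed

lemma exists_orthogonal_projection:
  fixes S :: "'i ell2 set"
  assumes S: "csubspace S" "closed S"
  obtains E :: "'i op" where "E \<in> bounded_ops" "\<And>x. E x \<in> S" "\<And>x t. t \<in> S \<Longrightarrow> cinner t (x - E x) = 0"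
    "\<And>x. x \<in> S \<Longrightarrow> E x = x"
proof -
  have sub: "subspace S" and sc: "\<And>c x. x \<in> S \<Longrightarrow> c *\<^sub>C x \<in> S"
    using S by (auto simp: csubspace_def)
  have "\<exists>s. s \<in> S \<and> (\<forall>t\<in>S. cinner t (x - s) = 0)" for x
    using exists_orthogonal_decomposition[OF sub S(2), of x] cinner_eq_0_iff_inner[of S] sc by blast
  then obtain f where fS: "\<And>x. f x \<in> S" and f: "\<And>x t. t \<in> S \<Longrightarrow> cinner t (x - f x) = 0"
    by metis
  have uniq: "f x = s" if "s \<in> S" "\<And>t. t \<in> S \<Longrightarrow> cinner t (x - s) = 0" for x s
  proof -
    have "f x - s \<in> S" using sub fS that by (simp add: subspace_diff)
    then have "cinner (f x - s) (x - s) - cinner (f x - s) (x - f x) = 0"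
      using f that(2) by simp
    then have "cinner (f x - s) (f x - s) = 0"
      by (simp add: cinner_diff_right)
    then show ?thesis by (simp del: cinner_diff_left)
  qed
  have add: "f (x + y) = f x + f y" for x y
  proof (rule uniq)
    fix t assume "t \<in> S"
    then have "cinner t (x - f x) + cinner t (y - f y) = 0" using f by simp
    then show "cinner t (x + y - (f x + f y)) = 0" by (simp add: cinner_simps algebra_simps)
  qed (use sub fS in \<open>simp add: subspace_add\<close>)
  have scale: "f (c *\<^sub>C x) = c *\<^sub>C f x" for c x
  proof (rule uniq)
    fix t assume "t \<in> S"
    then have "c * cinner t (x - f x) = 0" using f by simp
    then show "cinner t (c *\<^sub>C x - c *\<^sub>C f x) = 0" by (simp add: cinner_simps algebra_simps)
  qed (use sc fS in simp)
  have bound: "norm (f x) \<le> 1 * norm x" for x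
  proof -
    have "inner (f x) (x - f x) = 0" using f[OF fS] by (simp add: inner_eq_Re_cinner)
    then have "(norm x)\<^sup>2 = (norm (f x))\<^sup>2 + (norm (x - f x))\<^sup>2"
      by (simp add: power2_norm_eq_inner inner_simps algebra_simps inner_commute)
    then have "(norm (f x))\<^sup>2 \<le> (norm x)\<^sup>2" by simp
    then show ?thesis by (auto intro: power2_le_imp_le)
  qed
  have fid: "f x = x" if "x \<in> S" for x
    by (rule uniq) (use that in simp_all)
  note bl = bounded_opsI[of f 1, OF add scale bound]
  show ?thesis
    by (rule that[of "Blinfun f"]) (use bl fS f fid in \<open>auto simp: bounded_linear_Blinfun_apply\<close>)
qed

text \<open>A vector \<open>z\<close> that is orthogonal to the kernel of \<open>\<phi>\<close> and satisfies \<open>\<phi> z \<noteq> 0\<close> represents \<open>\<phi>\<close> up to a scalar,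
  because \<open>x - (\<phi> x / \<phi> z) z\<close> always lies in the kernel.\<close>

lemma Riesz_representation:
  fixes \<phi> :: "'i ell2 \<Rightarrow> complex"
  assumes add: "\<And>x y. \<phi> (x + y) = \<phi> x + \<phi> y" and scale: "\<And>c x. \<phi> (c *\<^sub>C x) = c * \<phi> x"
    and bound: "\<And>x. cmod (\<phi> x) \<le> K * norm x"
  obtains z where "\<And>x. \<phi> x = cinner z x"
proof (cases "\<forall>x. \<phi> x = 0")
  case True
  then show ?thesis by (intro that[of 0]) simp
next
  case False
  then obtain y where y: "\<phi> y \<noteq> 0" by blast
  have bl: "bounded_linear \<phi>"
    by (rule bounded_linear_intro[where K=K])
      (use bound in \<open>simp_all add: add scaleR_scaleC scale mult.commute scaleR_conv_of_real\<close>)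
  define S where "S = {x. \<phi> x = 0}"
  have "csubspace S"
    by (rule csubspaceI) (use scale[of 0 0] in \<open>auto simp: S_def add scale\<close>)
  moreover have "closed S" unfolding S_def
    by (intro closed_Collect_eq continuous_intros
        linear_continuous_on[OF bl, THEN continuous_on_subset]) auto
  ultimately obtain E :: "'i op" where E: "\<And>x. E x \<in> S" "\<And>x t. t \<in> S \<Longrightarrow> cinner t (x - E x) = 0"
    using exists_orthogonal_projection by metis
  define z where "z = y - E y"
  have phi_diff: "\<phi> (a - b) = \<phi> a - \<phi> b" for a b
    using linear_diff[OF bounded_linear.linear[OF bl]] .
  have z: "\<phi> z = \<phi> y" using E(1)[of y] by (simp add: z_def phi_diff S_def)
  then have z0: "z \<noteq> 0" using y scale[of 0 0] by auto
  have orth: "cinner z t = 0" if "t \<in> S" for t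
    using E(2)[OF that, of y] cinner_commute[of z t] by (simp add: z_def)
  have "\<phi> x = cinner ((cnj (\<phi> z) / complex_of_real ((norm z)\<^sup>2)) *\<^sub>C z) x" for x
  proof -
    have "x - (\<phi> x / \<phi> z) *\<^sub>C z \<in> S" using y z by (simp add: S_def phi_diff scale)
    from orth[OF this] have "cinner z x = \<phi> x / \<phi> z * complex_of_real ((norm z)\<^sup>2)"
      by (simp add: cinner_simps cinner_norm)
    then show ?thesis using y z z0 by (simp add: cinner_simps)
  qed
  then show ?thesis by (rule that)
qed

text \<open>Riesz representation in the first variable, for each fixed value of the second.  Adjoints and
  the slices of an operator on a tensor product are obtained from this lemma.\<close>

lemma bounded_sesquilinear_representation:
  fixes B :: "'i ell2 \<Rightarrow> 'i ell2 \<Rightarrow> complex"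
  assumes addl: "\<And>x y z. B (x + y) z = B x z + B y z" and addr: "\<And>x y z. B x (y + z) = B x y + B x z"
    and scl: "\<And>c x y. B (c *\<^sub>C x) y = cnj c * B x y" and scr: "\<And>c x y. B x (c *\<^sub>C y) = c * B x y"
    and bound: "\<And>x y. cmod (B x y) \<le> K * norm x * norm y"
  obtains T where "T \<in> bounded_ops" "\<And>x y. cinner x (blinfun_apply T y) = B x y"
proof -
  have "\<exists>z. \<forall>x. B x y = cinner x z" for y
  proof -
    obtain z where z: "\<And>x. cnj (B x y) = cinner z x"
    proof (rule Riesz_representation[of "\<lambda>x. cnj (B x y)" "K * norm y"])
      show "cmod (cnj (B x y)) \<le> K * norm y * norm x" for x
        using bound[of x y] by (simp add: algebra_simps)
    qed (auto simp: addl scl)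
    have "B x y = cinner x z" for x
      using z[of x] cinner_commute[of x z] by (metis complex_cnj_cnj)
    then show ?thesis by blast
  qed
  then obtain f where f: "\<And>x y. B x y = cinner x (f y)" by metis
  have add: "f (x + y) = f x + f y" for x y
    by (rule cinner_ext) (simp add: cinner_add_right addr flip: f)
  have scale: "f (c *\<^sub>C x) = c *\<^sub>C f x" for c x
    by (rule cinner_ext) (simp add: cinner_scaleC_right scr flip: f)
  have "norm (f x) \<le> K * norm x" for x
  proof (cases "f x = 0")
    case True
    have "K \<ge> 0 \<or> norm x = 0"
    proof (rule disjCI)
      assume "norm x \<noteq> 0"
      then have "0 \<le> K * (norm x * norm x)" "norm x * norm x > 0"
        using bound[of x x] norm_ge_zero[of "B x x"] by (auto simp del: norm_ge_zero simp: mult.assoc)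
      then show "K \<ge> 0" by (metis linorder_not_le mult_less_0_iff order_less_asym)
    qed
    then show ?thesis using True by auto
  next
    case False
    have "norm (f x) * norm (f x) = cmod (B (f x) x)"
      by (simp add: f cinner_norm norm_mult power2_eq_square)
    also have "\<dots> \<le> (K * norm x) * norm (f x)" using bound[of "f x" x] by (simp add: algebra_simps)
    finally show ?thesis using False by simp
  qed
  note bl = bounded_opsI[of f K, OF add scale this]
  show ?thesis
    by (rule that[of "Blinfun f"]) (use bl f in \<open>auto simp: bounded_linear_Blinfun_apply\<close>)
qed

section \<open>Bounded operators and adjoints\<close>

lemma id_bounded_ops [simp]: "id_blinfun \<in> bounded_ops"
  by (simp add: bounded_ops_def)

lemma zero_bounded_ops [simp]: "0 \<in> bounded_ops"
  by (simp add: bounded_ops_def)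

lemma add_bounded_ops [simp]: "S \<in> bounded_ops \<Longrightarrow> T \<in> bounded_ops \<Longrightarrow> S + T \<in> bounded_ops"
  by (simp add: bounded_ops_def blinfun.add_left scaleC_add_right)

lemma diff_bounded_ops [simp]: "S \<in> bounded_ops \<Longrightarrow> T \<in> bounded_ops \<Longrightarrow> S - T \<in> bounded_ops"
  by (simp add: bounded_ops_def blinfun.diff_left scaleC_diff_right)

lemma compose_bounded_ops [simp]: "S \<in> bounded_ops \<Longrightarrow> T \<in> bounded_ops \<Longrightarrow> S o\<^sub>L T \<in> bounded_ops"
  by (simp add: bounded_ops_def)

lemma scale_bounded_ops [simp]: "T \<in> bounded_ops \<Longrightarrow> c *\<^sub>O T \<in> bounded_ops"
  by (simp add: bounded_ops_def scaleC_scaleC mult.commute)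

lemma scaleR_op_scale: "r *\<^sub>R T = complex_of_real r *\<^sub>O T"
  by (rule blinfun_eqI) (simp add: blinfun.scaleR_left scaleR_scaleC)

lemma scaleR_bounded_ops [simp]: "T \<in> bounded_ops \<Longrightarrow> r *\<^sub>R T \<in> bounded_ops"
  by (simp add: scaleR_op_scale)

lemma sum_bounded_ops [simp]: "(\<And>i. i \<in> I \<Longrightarrow> T i \<in> bounded_ops) \<Longrightarrow> sum T I \<in> bounded_ops"
  by (induction I rule: infinite_finite_induct) auto

lemmas blinfun_lin = blinfun.add_left blinfun.add_right blinfun.diff_left blinfun.diff_right
  blinfun.minus_left blinfun.minus_right blinfun.scaleR_left blinfun.scaleR_right

lemma op_compose_assoc: "(S o\<^sub>L T) o\<^sub>L U = S o\<^sub>L (T o\<^sub>L U)"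
  by (rule blinfun_eqI) simp

lemma op_compose_id: "T o\<^sub>L id_blinfun = T" "id_blinfun o\<^sub>L T = T"
  by (rule blinfun_eqI; simp)+

lemmas op_compose_add_left = bounded_bilinear.add_left[OF bounded_bilinear_blinfun_compose]
  and op_compose_add_right = bounded_bilinear.add_right[OF bounded_bilinear_blinfun_compose]
  and op_compose_diff_left = bounded_bilinear.diff_left[OF bounded_bilinear_blinfun_compose]
  and op_compose_diff_right = bounded_bilinear.diff_right[OF bounded_bilinear_blinfun_compose]
  and op_compose_sum_left = bounded_bilinear.sum_left[OF bounded_bilinear_blinfun_compose]
  and op_compose_sum_right = bounded_bilinear.sum_right[OF bounded_bilinear_blinfun_compose]

text \<open>The adjoint is a definite description; as the defining equation has at most one solution, exhibiting one
  evaluates it.\<close>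

lemma op_adj_eqI:
  fixes S T :: "'i op"
  assumes "\<And>x y. cinner (S x) y = cinner x (T y)"
  shows "T\<^sup>\<dagger> = S"
  unfolding op_adj_def
proof (rule the_equality)
  fix S' :: "'i op"
  assume "\<forall>x y. cinner (S' x) y = cinner x (T y)"
  then have "cinner y (S' x) = cinner y (S x)" for x y
    using assms cinner_commute by metis
  then show "S' = S" by (intro blinfun_eqI cinner_ext)
qed (use assms in blast)

lemma exists_adjoint:
  fixes T :: "'i op"
  assumes "T \<in> bounded_ops"
  shows "\<exists>S\<in>bounded_ops. \<forall>x y. cinner (blinfun_apply S x) y = cinner x (T y)"
proof -
  obtain S :: "'i op" where S: "S \<in> bounded_ops" "\<And>x y. cinner x (blinfun_apply S y) = cinner (T x) y"
  proof (rule bounded_sesquilinear_representation[of "\<lambda>x y. cinner (T x) y" "norm T"])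
    show "cmod (cinner (T x) y) \<le> norm T * norm x * norm y" for x y
      using cinner_Cauchy_Schwarz[of "T x" y] norm_blinfun[of T x]
      by (meson mult_right_mono norm_ge_zero order_trans)
  qed (auto simp: cinner_simps blinfun_lin bounded_opsD[OF assms])
  have "cinner (S x) y = cinner x (T y)" for x y
    using S(2)[of y x] cinner_commute[of "S x" y] cinner_commute[of x "T y"] by simp
  then show ?thesis using S(1) by blast
qed

lemma
  assumes "T \<in> bounded_ops"
  shows adj_bounded_ops [simp]: "T\<^sup>\<dagger> \<in> bounded_ops"
    and cinner_adj_left: "cinner (T\<^sup>\<dagger> x) y = cinner x (T y)"
    and cinner_adj_right: "cinner x (T\<^sup>\<dagger> y) = cinner (T x) y"
proof -
  obtain S where S: "S \<in> bounded_ops" "\<And>x y. cinner (blinfun_apply S x) y = cinner x (T y)"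
    using exists_adjoint[OF assms] by blast
  then have "T\<^sup>\<dagger> = S" by (intro op_adj_eqI)
  then show "T\<^sup>\<dagger> \<in> bounded_ops" and 1: "cinner (T\<^sup>\<dagger> x) y = cinner x (T y)" for x y
    using S by auto
  show "cinner x (T\<^sup>\<dagger> y) = cinner (T x) y"
    using 1[of y x] cinner_commute by metis
qed

lemma adj_adj [simp]: "T \<in> bounded_ops \<Longrightarrow> T\<^sup>\<dagger>\<^sup>\<dagger> = T"
  by (rule op_adj_eqI) (simp add: cinner_adj_right)

lemma adj_compose [simp]:
  assumes "S \<in> bounded_ops" "T \<in> bounded_ops"
  shows "(S o\<^sub>L T)\<^sup>\<dagger> = T\<^sup>\<dagger> o\<^sub>L S\<^sup>\<dagger>"
  by (rule op_adj_eqI) (simp add: cinner_adj_left assms)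

lemma adj_add [simp]:
  "S \<in> bounded_ops \<Longrightarrow> T \<in> bounded_ops \<Longrightarrow> (S + T)\<^sup>\<dagger> = S\<^sup>\<dagger> + T\<^sup>\<dagger>"
  by (rule op_adj_eqI) (simp add: cinner_adj_left blinfun_lin cinner_simps)

lemma adj_diff [simp]:
  "S \<in> bounded_ops \<Longrightarrow> T \<in> bounded_ops \<Longrightarrow> (S - T)\<^sup>\<dagger> = S\<^sup>\<dagger> - T\<^sup>\<dagger>"
  by (rule op_adj_eqI) (simp add: cinner_adj_left blinfun_lin cinner_simps)

lemma adj_scale [simp]: "T \<in> bounded_ops \<Longrightarrow> (c *\<^sub>O T)\<^sup>\<dagger> = cnj c *\<^sub>O T\<^sup>\<dagger>"
  by (rule op_adj_eqI) (simp add: cinner_adj_left cinner_simps)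

lemma adj_scaleR [simp]: "T \<in> bounded_ops \<Longrightarrow> (r *\<^sub>R T)\<^sup>\<dagger> = r *\<^sub>R T\<^sup>\<dagger>"
  by (simp add: scaleR_op_scale)

lemma adj_id [simp]: "id_blinfun\<^sup>\<dagger> = id_blinfun"
  by (rule op_adj_eqI) simp

lemma adj_zero [simp]: "0\<^sup>\<dagger> = (0 :: 'i op)"
  by (rule op_adj_eqI) simp

lemma inner_adj_left: "T \<in> bounded_ops \<Longrightarrow> inner (T\<^sup>\<dagger> x) y = inner x (T y)"
  by (simp add: inner_eq_Re_cinner cinner_adj_left)

lemma adj_compose_self_eq_0:
  assumes "T \<in> bounded_ops" "T\<^sup>\<dagger> o\<^sub>L T = 0"
  shows "T = 0"
proof (rule blinfun_eqI)
  fix x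
  have "inner (T x) (T x) = inner ((T\<^sup>\<dagger> o\<^sub>L T) x) x"
    using inner_adj_left[OF assms(1), of "T x" x] by simp
  then show "T x = blinfun_apply 0 x" using assms(2) by simp
qed

section \<open>Commutants and von Neumann algebras\<close>

lemma commutantD: "T \<in> commutant S \<Longrightarrow> s \<in> S \<Longrightarrow> T o\<^sub>L s = s o\<^sub>L T"
  by (simp add: commutant_def)

lemma commutant_bounded: "commutant S \<subseteq> bounded_ops"
  by (auto simp: commutant_def)

lemma commutant_antimono: "S \<subseteq> T \<Longrightarrow> commutant T \<subseteq> commutant S"
  by (auto simp: commutant_def)

lemma subset_bicommutant: "S \<subseteq> bounded_ops \<Longrightarrow> S \<subseteq> commutant (commutant S)"
  by (auto simp: commutant_def)

lemma commutant_tricommutant: "S \<subseteq> bounded_ops \<Longrightarrow> commutant (commutant (commutant S)) = commutant S"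
  by (meson commutant_antimono commutant_bounded subset_antisym subset_bicommutant)

lemma commutant_adj:
  assumes S: "S \<subseteq> bounded_ops" "\<And>s. s \<in> S \<Longrightarrow> s\<^sup>\<dagger> \<in> S" and T: "T \<in> commutant S"
  shows "T\<^sup>\<dagger> \<in> commutant S"
proof -
  have "T\<^sup>\<dagger> o\<^sub>L s = s o\<^sub>L T\<^sup>\<dagger>" if s: "s \<in> S" for s
  proof -
    have Tb: "T \<in> bounded_ops" and sb: "s \<in> bounded_ops"
      using s S T commutant_bounded by blast+
    have "(T o\<^sub>L s\<^sup>\<dagger>)\<^sup>\<dagger> = (s\<^sup>\<dagger> o\<^sub>L T)\<^sup>\<dagger>"
      using commutantD[OF T S(2)[OF s]] by simp
    then show ?thesis using Tb sb by simp
  qed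
  then show ?thesis using T by (auto simp: commutant_def)
qed

lemma commutant_von_neumann:
  assumes "S \<subseteq> bounded_ops" "\<And>s. s \<in> S \<Longrightarrow> s\<^sup>\<dagger> \<in> S"
  shows "von_neumann_algebra (commutant S)"
  unfolding von_neumann_algebra_def
  using commutant_tricommutant[OF assms(1)] commutant_adj[OF assms] commutant_bounded by blast

lemma vN_bounded: "von_neumann_algebra M \<Longrightarrow> x \<in> M \<Longrightarrow> x \<in> bounded_ops"
  by (auto simp: von_neumann_algebra_def)

lemma vN_adj: "von_neumann_algebra M \<Longrightarrow> x \<in> M \<Longrightarrow> x\<^sup>\<dagger> \<in> M"
  by (auto simp: von_neumann_algebra_def)

lemma vN_bicommutant: "von_neumann_algebra M \<Longrightarrow> commutant (commutant M) = M"
  by (auto simp: von_neumann_algebra_def)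

text \<open>Closure under sums, products and scalar multiples all comes from this form of the bicommutant property.\<close>

lemma vN_memI:
  assumes "von_neumann_algebra M" "x \<in> bounded_ops" "\<And>T. T \<in> commutant M \<Longrightarrow> x o\<^sub>L T = T o\<^sub>L x"
  shows "x \<in> M"
proof -
  have "x \<in> commutant (commutant M)" using assms by (auto simp: commutant_def)
  then show ?thesis using vN_bicommutant[OF assms(1)] by simp
qed

lemma vN_id: "von_neumann_algebra M \<Longrightarrow> id_blinfun \<in> M"
  by (rule vN_memI) (auto intro: blinfun_eqI)

lemma vN_compose:
  assumes "von_neumann_algebra M" "x \<in> M" "y \<in> M"
  shows "x o\<^sub>L y \<in> M"
proof (rule vN_memI[OF assms(1)])
  fix T assume T: "T \<in> commutant M"
  show "(x o\<^sub>L y) o\<^sub>L T = T o\<^sub>L (x o\<^sub>L y)"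
    using commutantD[OF T assms(2)] commutantD[OF T assms(3)]
    by (metis op_compose_assoc)
qed (use vN_bounded[OF assms(1)] assms(2,3) in auto)

lemma vN_add:
  assumes "von_neumann_algebra M" "x \<in> M" "y \<in> M"
  shows "x + y \<in> M"
proof (rule vN_memI[OF assms(1)])
  fix T assume T: "T \<in> commutant M"
  show "(x + y) o\<^sub>L T = T o\<^sub>L (x + y)"
    using commutantD[OF T assms(2)] commutantD[OF T assms(3)]
    by (simp add: op_compose_add_left op_compose_add_right)
qed (use vN_bounded[OF assms(1)] assms(2,3) in auto)

lemma vN_scale:
  assumes "von_neumann_algebra M" "x \<in> M"
  shows "c *\<^sub>O x \<in> M"
proof (rule vN_memI[OF assms(1)])
  fix T assume T: "T \<in> commutant M"
  then have "T (x \<xi>) = x (T \<xi>)" for \<xi>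
    using commutantD[OF T assms(2)] by (metis blinfun_apply_blinfun_compose)
  moreover have "T (c *\<^sub>C \<xi>) = c *\<^sub>C T \<xi>" for \<xi>
    using T by (auto simp: commutant_def bounded_opsD)
  ultimately show "(c *\<^sub>O x) o\<^sub>L T = T o\<^sub>L (c *\<^sub>O x)"
    by (auto intro!: blinfun_eqI)
qed (rule scale_bounded_ops[OF vN_bounded[OF assms]])

lemma vN_scaleR: "von_neumann_algebra M \<Longrightarrow> x \<in> M \<Longrightarrow> r *\<^sub>R x \<in> M"
  by (simp add: scaleR_op_scale vN_scale)

lemma vN_diff:
  assumes "von_neumann_algebra M" "x \<in> M" "y \<in> M"
  shows "x - y \<in> M"
  using vN_add[OF assms(1,2) vN_scaleR[OF assms(1,3), of "-1"]] by simp

lemma vN_zero: "von_neumann_algebra M \<Longrightarrow> 0 \<in> M"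
  using vN_diff[OF _ vN_id vN_id] by force

lemma vN_sum:
  "von_neumann_algebra M \<Longrightarrow> (\<And>i. i \<in> I \<Longrightarrow> f i \<in> M) \<Longrightarrow> sum f I \<in> M"
  by (induction I rule: infinite_finite_induct) (auto intro: vN_zero vN_add)

lemma vN_bounded_ops: "von_neumann_algebra (bounded_ops :: 'i op set)"
  unfolding von_neumann_algebra_def
  using subset_bicommutant[of "bounded_ops :: 'i op set"] commutant_bounded by fastforce

lemma vN_generated_subset: "S \<subseteq> vN_generated S"
  by (auto simp: vN_generated_def)

lemma vN_generated_least: "von_neumann_algebra N \<Longrightarrow> S \<subseteq> N \<Longrightarrow> vN_generated S \<subseteq> N"
  by (auto simp: vN_generated_def)

lemma vN_generated_von_neumann:
  assumes "S \<subseteq> bounded_ops"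
  shows "von_neumann_algebra (vN_generated S)"
proof -
  have b: "vN_generated S \<subseteq> bounded_ops"
    by (rule vN_generated_least[OF vN_bounded_ops assms])
  have "commutant (commutant (vN_generated S)) \<subseteq> N" if N: "von_neumann_algebra N" "S \<subseteq> N" for N
  proof -
    have "commutant (commutant (vN_generated S)) \<subseteq> commutant (commutant N)"
      by (intro commutant_antimono vN_generated_least N)
    then show ?thesis using vN_bicommutant[OF N(1)] by simp
  qed
  then have "commutant (commutant (vN_generated S)) \<subseteq> vN_generated S"
    by (auto simp: vN_generated_def)
  moreover have "x\<^sup>\<dagger> \<in> vN_generated S" if "x \<in> vN_generated S" for x
    using that vN_adj by (auto simp: vN_generated_def)
  ultimately show ?thesis
    using b subset_bicommutant[OF b] by (auto simp: von_neumann_algebra_def)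
qed

text \<open>The operators commuting with both \<open>T\<close> and \<open>T\<^sup>*\<close> form a von Neumann algebra.  The condition on \<open>T\<^sup>*\<close>
  cannot be left out: the commutant of a single non-normal operator need not be closed under adjoints.\<close>

lemma commute_vN_generated:
  assumes S: "S \<subseteq> bounded_ops" and T: "T \<in> bounded_ops"
    and comm: "\<And>s. s \<in> S \<Longrightarrow> T o\<^sub>L s = s o\<^sub>L T" "\<And>s. s \<in> S \<Longrightarrow> T\<^sup>\<dagger> o\<^sub>L s = s o\<^sub>L T\<^sup>\<dagger>"
    and X: "X \<in> vN_generated S"
  shows "T o\<^sub>L X = X o\<^sub>L T"
proof -
  have "von_neumann_algebra (commutant {T, T\<^sup>\<dagger>})"
    by (rule commutant_von_neumann) (use T in auto)
  moreover have "S \<subseteq> commutant {T, T\<^sup>\<dagger>}"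
    using S comm by (auto simp: commutant_def)
  ultimately have "X \<in> commutant {T, T\<^sup>\<dagger>}" using X vN_generated_least by blast
  then show ?thesis by (auto simp: commutant_def)
qed

text \<open>The bicommutant of a commutative self-adjoint set is commutative, so \<open>P\<close> already contains every
  hermitian element of \<open>M\<close> that commutes with it, in particular the real and imaginary parts of \<open>T\<close>.\<close>

lemma masa_contains_commuting:
  assumes M: "von_neumann_algebra M" and P: "masa M P" and T: "T \<in> M" "\<And>x. x \<in> P \<Longrightarrow> T o\<^sub>L x = x o\<^sub>L T"
  shows "T \<in> P"
proof -
  have vP: "von_neumann_algebra P" and PM: "P \<subseteq> M" and cP: "commutative_ops P"
    using P by (auto simp: masa_def)
  have herm: "h \<in> P" if h: "h \<in> M" "h\<^sup>\<dagger> = h" "\<And>x. x \<in> P \<Longrightarrow> h o\<^sub>L x = x o\<^sub>L h" for h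
  proof -
    define S where "S = insert h P"
    have SM: "S \<subseteq> M" using h PM by (auto simp: S_def)
    then have Sb: "S \<subseteq> bounded_ops" using M vN_bounded by blast
    have Sadj: "s\<^sup>\<dagger> \<in> S" if "s \<in> S" for s
      using that h(2) vN_adj[OF vP, of s] by (auto simp: S_def)
    define P' where "P' = commutant (commutant S)"
    have "von_neumann_algebra P'" unfolding P'_def
      by (rule commutant_von_neumann) (use commutant_bounded commutant_adj[OF Sb Sadj] in auto)
    moreover have "P' \<subseteq> M"
      using commutant_antimono[OF commutant_antimono[OF SM]] vN_bicommutant[OF M] by (simp add: P'_def)
    moreover have "commutative_ops P'"
    proof -
      have "S \<subseteq> commutant S"
        using Sb cP h(3) by (auto simp: commutant_def S_def commutative_ops_def)
      then have "P' \<subseteq> commutant S" unfolding P'_def by (rule commutant_antimono)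
      then show ?thesis unfolding commutative_ops_def P'_def
        using commutantD by blast
    qed
    moreover have "S \<subseteq> P'" unfolding P'_def by (rule subset_bicommutant[OF Sb])
    ultimately have "P' = P" using P by (auto simp: masa_def S_def)
    then show ?thesis using \<open>S \<subseteq> P'\<close> by (auto simp: S_def)
  qed
  have Tb: "T \<in> bounded_ops" using M T vN_bounded by blast
  have Tadj: "T\<^sup>\<dagger> o\<^sub>L x = x o\<^sub>L T\<^sup>\<dagger>" if "x \<in> P" for x
  proof -
    have "T \<in> commutant P" using Tb T(2) by (auto simp: commutant_def)
    then have "T\<^sup>\<dagger> \<in> commutant P"
      by (intro commutant_adj) (use vP vN_bounded vN_adj in auto)
    then show ?thesis using that by (auto simp: commutant_def)
  qed
  have re: "(T + T\<^sup>\<dagger>) \<in> P"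
    by (rule herm) (use T Tadj Tb vN_add[OF M T(1) vN_adj[OF M T(1)]] in
        \<open>auto simp: add.commute op_compose_add_left op_compose_add_right\<close>)
  have im: "(\<i> *\<^sub>O (T - T\<^sup>\<dagger>)) \<in> P"
  proof (rule herm)
    show "(\<i> *\<^sub>O (T - T\<^sup>\<dagger>))\<^sup>\<dagger> = \<i> *\<^sub>O (T - T\<^sup>\<dagger>)"
      using Tb by (auto intro!: blinfun_eqI simp: blinfun_lin scaleC_diff_right)
    fix x assume x: "x \<in> P"
    then have "T (x \<xi>) = x (T \<xi>)" "T\<^sup>\<dagger> (x \<xi>) = x (T\<^sup>\<dagger> \<xi>)" for \<xi>
      using T(2)[OF x] Tadj[OF x] by (metis blinfun_apply_blinfun_compose)+
    then show "(\<i> *\<^sub>O (T - T\<^sup>\<dagger>)) o\<^sub>L x = x o\<^sub>L (\<i> *\<^sub>O (T - T\<^sup>\<dagger>))"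
      using bounded_opsD[OF vN_bounded[OF vP x]]
      by (auto intro!: blinfun_eqI simp: blinfun_lin)
  qed (intro vN_scale vN_diff vN_adj M T(1))
  have "T = (1/2) *\<^sub>R (T + T\<^sup>\<dagger>) - (\<i>/2) *\<^sub>O (\<i> *\<^sub>O (T - T\<^sup>\<dagger>))"
    by (rule blinfun_eqI)
      (simp add: blinfun_lin scaleC_scaleC scaleR_scaleC scaleC_diff_right scaleC_add_right flip: scaleC_left_distrib)
  then show ?thesis
    using vN_diff[OF vP vN_scaleR[OF vP re] vN_scale[OF vP im]] by metis
qed

section \<open>Simple tensors of vectors\<close>

lift_definition ket :: "'i \<Rightarrow> 'i ell2" is "\<lambda>i j. if j = i then 1 else 0"
proof -
  fix i :: 'i
  show "(\<lambda>j. (cmod (if j = i then 1 else 0))\<^sup>2) summable_on UNIV"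
    by (subst summable_on_cong_neutral[where T="{i}" and g="\<lambda>_. 1"]) auto
qed

lemma cinner_ket_left: "cinner (ket i) x = Rep_ell2 x i"
proof -
  have "cinner (ket i) x = (\<Sum>\<^sub>\<infinity>j\<in>{i}. Rep_ell2 x j)"
    unfolding cinner.rep_eq ket.rep_eq by (rule infsum_cong_neutral) auto
  then show ?thesis by simp
qed

lemma ket_tensor_ket: "ket i \<otimes>\<^sub>v ket j = ket (i, j)"
  by transfer (auto simp: fun_eq_iff)

lemma tensor_add_left: "(x + y) \<otimes>\<^sub>v z = x \<otimes>\<^sub>v z + y \<otimes>\<^sub>v z"
  by transfer (auto simp: fun_eq_iff algebra_simps)

lemma tensor_add_right: "z \<otimes>\<^sub>v (x + y) = z \<otimes>\<^sub>v x + z \<otimes>\<^sub>v y"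
  by transfer (auto simp: fun_eq_iff algebra_simps)

lemma tensor_scale_left: "(c *\<^sub>C x) \<otimes>\<^sub>v z = c *\<^sub>C (x \<otimes>\<^sub>v z)"
  by transfer (auto simp: fun_eq_iff algebra_simps)

lemma tensor_scale_right: "z \<otimes>\<^sub>v (c *\<^sub>C x) = c *\<^sub>C (z \<otimes>\<^sub>v x)"
  by transfer (auto simp: fun_eq_iff algebra_simps)

lemma tensor_zero_right [simp]: "x \<otimes>\<^sub>v 0 = 0"
  by transfer (auto simp: fun_eq_iff)

lemma cinner_tensor: "cinner (x \<otimes>\<^sub>v y) (x' \<otimes>\<^sub>v y') = cinner x x' * cinner y y'"
proof -
  let ?f = "\<lambda>p. cnj (Rep_ell2 (x \<otimes>\<^sub>v y) p) * Rep_ell2 (x' \<otimes>\<^sub>v y') p"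
  have s: "?f summable_on UNIV \<times> UNIV"
    using ell2_mult_summable Rep_ell2[of "x \<otimes>\<^sub>v y"] Rep_ell2[of "x' \<otimes>\<^sub>v y'"] by auto
  have "cinner (x \<otimes>\<^sub>v y) (x' \<otimes>\<^sub>v y') = infsum ?f (UNIV \<times> UNIV)"
    by (simp add: cinner.rep_eq)
  also have "\<dots> = (\<Sum>\<^sub>\<infinity>i. \<Sum>\<^sub>\<infinity>j. ?f (i, j))"
    by (rule infsum_Sigma_banach[OF s, symmetric])
  also have "\<dots> = (\<Sum>\<^sub>\<infinity>i. \<Sum>\<^sub>\<infinity>j. (cnj (Rep_ell2 x i) * Rep_ell2 x' i) * (cnj (Rep_ell2 y j) * Rep_ell2 y' j))"
    by (simp add: ell2_tensor.rep_eq mult_ac)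
  also have "\<dots> = cinner x x' * cinner y y'"
    by (simp add: cinner.rep_eq infsum_cmult_right' infsum_cmult_left')
  finally show ?thesis .
qed

lemma norm_tensor: "norm (x \<otimes>\<^sub>v y) = norm x * norm y"
proof -
  have "complex_of_real ((norm (x \<otimes>\<^sub>v y))\<^sup>2) = complex_of_real ((norm x * norm y)\<^sup>2)"
    by (simp only: cinner_norm[symmetric] cinner_tensor) (simp add: cinner_norm power_mult_distrib)
  then have "(norm (x \<otimes>\<^sub>v y))\<^sup>2 = (norm x * norm y)\<^sup>2"
    using of_real_eq_iff by blast
  then show ?thesis by (simp add: power2_eq_iff_nonneg)
qed

lemma ell2_tensor_ext: "(\<And>x y. cinner (x \<otimes>\<^sub>v y) z = cinner (x \<otimes>\<^sub>v y) w) \<Longrightarrow> z = w"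
proof -
  assume *: "\<And>x y. cinner (x \<otimes>\<^sub>v y) z = cinner (x \<otimes>\<^sub>v y) w"
  have "Rep_ell2 z p = Rep_ell2 w p" for p
    using *[of "ket (fst p)" "ket (snd p)"] by (simp add: ket_tensor_ket cinner_ket_left)
  then show "z = w" using Rep_ell2_inject by blast
qed

text \<open>The hypothesis determines \<open>U\<close> and \<open>V\<close> on simple tensors, and with them the adjoints, since
  \<open>\<langle>v \<otimes> \<xi>, U\<^sup>* z\<rangle> = \<langle>U (v \<otimes> \<xi>), z\<rangle>\<close>.\<close>

lemma op_tensor_ext:
  fixes U V :: "('i \<times> 'j) op"
  assumes "U \<in> bounded_ops" "V \<in> bounded_ops"
    and eq: "\<And>u \<zeta> v \<xi>. cinner (u \<otimes>\<^sub>v \<zeta>) (U (v \<otimes>\<^sub>v \<xi>)) = cinner (u \<otimes>\<^sub>v \<zeta>) (V (v \<otimes>\<^sub>v \<xi>))"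
  shows "U = V"
proof (rule blinfun_eqI, rule cinner_ext)
  fix x z
  have simple: "U (v \<otimes>\<^sub>v \<xi>) = V (v \<otimes>\<^sub>v \<xi>)" for v \<xi>
    by (rule ell2_tensor_ext) (rule eq)
  have "U\<^sup>\<dagger> z = V\<^sup>\<dagger> z"
  proof (rule ell2_tensor_ext)
    fix v \<xi>
    show "cinner (v \<otimes>\<^sub>v \<xi>) (U\<^sup>\<dagger> z) = cinner (v \<otimes>\<^sub>v \<xi>) (V\<^sup>\<dagger> z)"
      by (simp add: cinner_adj_right assms simple)
  qed
  then show "cinner z (U x) = cinner z (V x)"
    by (metis assms(1,2) cinner_adj_left)
qed

section \<open>The tensor product of two operators\<close>

lift_definition column :: "'j \<Rightarrow> ('i \<times> 'j) ell2 \<Rightarrow> 'i ell2" is "\<lambda>j f i. f (i, j)"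
proof -
  fix j :: 'j and f :: "'i \<times> 'j \<Rightarrow> complex"
  assume "(\<lambda>p. (cmod (f p))\<^sup>2) summable_on UNIV"
  then have "(\<lambda>p. (cmod (f p))\<^sup>2) summable_on range (\<lambda>i. (i, j))"
    by (rule summable_on_subset_banach) simp
  then show "(\<lambda>i. (cmod (f (i, j)))\<^sup>2) summable_on UNIV"
    by (simp add: summable_on_reindex inj_on_def o_def)
qed

lift_definition ell2_swap :: "('i \<times> 'j) ell2 \<Rightarrow> ('j \<times> 'i) ell2" is "\<lambda>f p. f (prod.swap p)"
proof -
  fix f :: "'i \<times> 'j \<Rightarrow> complex"
  assume "(\<lambda>p. (cmod (f p))\<^sup>2) summable_on UNIV"
  then show "(\<lambda>p. (cmod (f (prod.swap p)))\<^sup>2) summable_on UNIV"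
    using summable_on_reindex_bij_betw[of prod.swap UNIV UNIV "\<lambda>p. (cmod (f p))\<^sup>2"] by simp
qed

lemma norm_ell2_swap: "norm (ell2_swap f) = norm f"
proof -
  have "(norm (ell2_swap f))\<^sup>2 = (norm f)\<^sup>2"
    unfolding norm_ell2_square ell2_swap.rep_eq
    by (rule infsum_reindex_bij_betw[of prod.swap UNIV UNIV "\<lambda>p. (cmod (Rep_ell2 f p))\<^sup>2"]) simp
  then show ?thesis by (simp add: power2_eq_iff_nonneg)
qed

lemma sum_norm_column_le:
  assumes J: "finite J"
  shows "(\<Sum>j\<in>J. (norm (column j f))\<^sup>2) \<le> (norm f)\<^sup>2"
proof -
  let ?g = "\<lambda>p. (cmod (Rep_ell2 (ell2_swap f) p))\<^sup>2"
  have s: "?g summable_on UNIV" using Rep_ell2[of "ell2_swap f"] by simp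
  then have sJ: "?g summable_on J \<times> UNIV" by (rule summable_on_subset_banach) simp
  have "(\<Sum>j\<in>J. (norm (column j f))\<^sup>2) = (\<Sum>\<^sub>\<infinity>j\<in>J. \<Sum>\<^sub>\<infinity>i. ?g (j, i))"
    using J by (simp add: norm_ell2_square column.rep_eq ell2_swap.rep_eq)
  also have "\<dots> = infsum ?g (J \<times> UNIV)"
    by (rule infsum_Sigma_banach[OF sJ])
  also have "\<dots> \<le> infsum ?g UNIV"
    by (rule infsum_mono2[OF sJ s]) auto
  also have "\<dots> = (norm f)\<^sup>2"
    by (simp add: norm_ell2_square[symmetric] norm_ell2_swap)
  finally show ?thesis .
qed

text \<open>This is \<open>S \<otimes> 1\<close> in coordinates.\<close>

definition amplify :: "'i op \<Rightarrow> ('i \<times> 'j) ell2 \<Rightarrow> ('i \<times> 'j) ell2" where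
  "amplify S f = Abs_ell2 (\<lambda>(i, j). Rep_ell2 (S (column j f)) i)"

lemma amplify_finite_sum_le:
  assumes F: "finite F"
  shows "(\<Sum>(i, j)\<in>F. (cmod (Rep_ell2 (blinfun_apply S (column j f)) i))\<^sup>2) \<le> (norm S * norm f)\<^sup>2"
proof -
  let ?h = "\<lambda>i j. (cmod (Rep_ell2 (blinfun_apply S (column j f)) i))\<^sup>2"
  have fin: "finite (fst ` F)" "finite (snd ` F)" using F by auto
  have "(\<Sum>(i, j)\<in>F. ?h i j) \<le> (\<Sum>(i, j)\<in>fst ` F \<times> snd ` F. ?h i j)"
    by (rule sum_mono2) (use fin in \<open>auto simp: rev_image_eqI\<close>)
  also have "\<dots> = (\<Sum>j\<in>snd ` F. \<Sum>i\<in>fst ` F. ?h i j)"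
    by (simp add: sum.cartesian_product[symmetric] sum.swap[of _ "snd ` F"])
  also have "\<dots> \<le> (\<Sum>j\<in>snd ` F. (norm (S (column j f)))\<^sup>2)"
    by (intro sum_mono sum_le_norm_ell2 fin)
  also have "\<dots> \<le> (\<Sum>j\<in>snd ` F. (norm S)\<^sup>2 * (norm (column j f))\<^sup>2)"
    by (intro sum_mono) (metis norm_blinfun norm_ge_zero power_mono power_mult_distrib)
  also have "\<dots> \<le> (norm S)\<^sup>2 * (norm f)\<^sup>2"
    unfolding sum_distrib_left[symmetric]
    by (intro mult_left_mono sum_norm_column_le fin) simp
  finally show ?thesis by (simp add: power_mult_distrib)
qed

lemma Rep_amplify: "Rep_ell2 (amplify S f) (i, j) = Rep_ell2 (blinfun_apply S (column j f)) i"
proof -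
  have "(\<lambda>p. (cmod (case p of (i, j) \<Rightarrow> Rep_ell2 (blinfun_apply S (column j f)) i))\<^sup>2) summable_on UNIV"
    using amplify_finite_sum_le[of _ S f]
    by (intro nonneg_bdd_above_summable_on bdd_aboveI2[where M="(norm S * norm f)\<^sup>2"])
      (auto simp: split_def)
  then show ?thesis
    unfolding amplify_def by (subst Abs_ell2_inverse) auto
qed

lemma norm_amplify: "norm (amplify S f) \<le> norm S * norm f"
proof -
  have "(norm (amplify S f))\<^sup>2 \<le> (norm S * norm f)\<^sup>2"
    unfolding norm_ell2_square
  proof (rule infsum_le_finite_sums)
    fix F :: "('a \<times> 'b) set" assume "finite F"
    have "(\<Sum>p\<in>F. (cmod (Rep_ell2 (amplify S f) p))\<^sup>2)
        = (\<Sum>(i, j)\<in>F. (cmod (Rep_ell2 (blinfun_apply S (column j f)) i))\<^sup>2)"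
      by (rule sum.cong) (auto simp: Rep_amplify)
    then show "(\<Sum>p\<in>F. (cmod (Rep_ell2 (amplify S f) p))\<^sup>2) \<le> (norm S * norm f)\<^sup>2"
      using amplify_finite_sum_le[OF \<open>finite F\<close>, of S f] by simp
  qed (use Rep_ell2[of "amplify S f"] in simp)
  then show ?thesis by (rule power2_le_imp_le) simp
qed

lemma column_add: "column j (f + g) = column j f + column j g"
  by transfer simp

lemma column_scale: "column j (c *\<^sub>C f) = c *\<^sub>C column j f"
  by transfer simp

lemma column_tensor: "column j (x \<otimes>\<^sub>v y) = Rep_ell2 y j *\<^sub>C x"
  by transfer (simp add: mult.commute)

lemma ell2_pair_ext: "(\<And>i j. Rep_ell2 f (i, j) = Rep_ell2 g (i, j)) \<Longrightarrow> f = g"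
  by (metis Rep_ell2_inject ext surj_pair)

lemma exists_op_tensor_id:
  assumes "S \<in> bounded_ops"
  obtains U :: "('i \<times> 'j) op" where "U \<in> bounded_ops"
    "\<And>x y. blinfun_apply U (x \<otimes>\<^sub>v y) = blinfun_apply S x \<otimes>\<^sub>v y"
proof
  have add: "amplify S (f + g) = amplify S f + (amplify S g :: ('i \<times> 'j) ell2)" for f g
    by (rule ell2_pair_ext) (simp add: Rep_amplify plus_ell2.rep_eq column_add blinfun_lin)
  have scale: "amplify S (c *\<^sub>C f) = c *\<^sub>C (amplify S f :: ('i \<times> 'j) ell2)" for c f
    by (rule ell2_pair_ext) (simp add: Rep_amplify scaleC.rep_eq column_scale bounded_opsD[OF assms])
  note bl = bounded_opsI[of "amplify S", OF add scale norm_amplify]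
  show "Blinfun (amplify S) \<in> (bounded_ops :: ('i \<times> 'j) op set)" by (rule bl)
  show "blinfun_apply (Blinfun (amplify S)) (x \<otimes>\<^sub>v y :: ('i \<times> 'j) ell2) = S x \<otimes>\<^sub>v y" for x y
    unfolding bounded_linear_Blinfun_apply[OF bl(1)]
    by (rule ell2_pair_ext)
      (simp add: Rep_amplify column_tensor bounded_opsD[OF assms] scaleC.rep_eq ell2_tensor.rep_eq)
qed

text \<open>The operator \<open>1 \<otimes> T\<close> is conjugate to \<open>T \<otimes> 1\<close> under the exchange of the two factors.\<close>

lemma exists_op_id_tensor:
  assumes "T \<in> bounded_ops"
  obtains U :: "('i \<times> 'j) op" where "U \<in> bounded_ops"
    "\<And>x y. blinfun_apply U (x \<otimes>\<^sub>v y) = x \<otimes>\<^sub>v blinfun_apply T y"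
proof -
  obtain V :: "('j \<times> 'i) op" where V: "V \<in> bounded_ops" "\<And>y x. V (y \<otimes>\<^sub>v x) = T y \<otimes>\<^sub>v x"
    using exists_op_tensor_id[OF assms] by blast
  define U :: "('i \<times> 'j) ell2 \<Rightarrow> ('i \<times> 'j) ell2" where "U f = ell2_swap (V (ell2_swap f))" for f
  have swap: "ell2_swap (f + g) = ell2_swap f + ell2_swap g" "ell2_swap (c *\<^sub>C f) = c *\<^sub>C ell2_swap f"
    for f g :: "('a \<times> 'b) ell2" and c by (transfer, simp)+
  have swap_tensor: "ell2_swap (x \<otimes>\<^sub>v y) = y \<otimes>\<^sub>v x" for x :: "'a ell2" and y :: "'b ell2"
    by transfer (auto simp: fun_eq_iff)
  have bl: "bounded_linear U" "Blinfun U \<in> bounded_ops"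
    by (rule bounded_opsI[of U "norm V"];
        use norm_blinfun[of V] in \<open>auto simp: U_def swap blinfun_lin bounded_opsD[OF V(1)] norm_ell2_swap
          intro: order_trans\<close>; metis norm_blinfun norm_ell2_swap)+
  show ?thesis
    by (rule that[of "Blinfun U"])
      (simp_all add: bl bounded_linear_Blinfun_apply U_def swap_tensor V)
qed

lemma
  fixes S :: "'i op" and T :: "'j op"
  assumes "S \<in> bounded_ops" "T \<in> bounded_ops"
  shows op_tensor_bounded [simp]: "S \<otimes>\<^sub>o T \<in> bounded_ops"
    and op_tensor_apply: "(S \<otimes>\<^sub>o T) (x \<otimes>\<^sub>v y) = S x \<otimes>\<^sub>v T y"
proof -
  obtain U V :: "('i \<times> 'j) op" where U: "U \<in> bounded_ops" "\<And>x y. U (x \<otimes>\<^sub>v y) = S x \<otimes>\<^sub>v y"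
    and V: "V \<in> bounded_ops" "\<And>x y. V (x \<otimes>\<^sub>v y) = x \<otimes>\<^sub>v T y"
    using exists_op_tensor_id[OF assms(1)] exists_op_id_tensor[OF assms(2)] by metis
  have "S \<otimes>\<^sub>o T = U o\<^sub>L V"
    unfolding op_tensor_def
    by (rule the_equality) (use U V in \<open>auto intro!: op_tensor_ext\<close>)
  then show "S \<otimes>\<^sub>o T \<in> bounded_ops" "(S \<otimes>\<^sub>o T) (x \<otimes>\<^sub>v y) = S x \<otimes>\<^sub>v T y"
    using U V by auto
qed

lemma op_tensor_compose:
  assumes "S \<in> bounded_ops" "T \<in> bounded_ops" "S' \<in> bounded_ops" "T' \<in> bounded_ops"
  shows "(S \<otimes>\<^sub>o T) o\<^sub>L (S' \<otimes>\<^sub>o T') = (S o\<^sub>L S') \<otimes>\<^sub>o (T o\<^sub>L T')"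
  by (rule op_tensor_ext) (simp_all add: assms op_tensor_apply)

lemma op_tensor_adj:
  assumes "S \<in> bounded_ops" "T \<in> bounded_ops"
  shows "(S \<otimes>\<^sub>o T)\<^sup>\<dagger> = S\<^sup>\<dagger> \<otimes>\<^sub>o T\<^sup>\<dagger>"
  by (rule op_tensor_ext) (simp_all add: assms op_tensor_apply cinner_adj_right cinner_tensor)

lemma op_tensor_id: "id_blinfun \<otimes>\<^sub>o id_blinfun = id_blinfun"
  by (rule op_tensor_ext) (simp_all add: op_tensor_apply)

lemma op_tensor_add_right:
  assumes "S \<in> bounded_ops" "T \<in> bounded_ops" "T' \<in> bounded_ops"
  shows "S \<otimes>\<^sub>o (T + T') = S \<otimes>\<^sub>o T + S \<otimes>\<^sub>o T'"
  by (rule op_tensor_ext) (simp_all add: assms op_tensor_apply blinfun_lin tensor_add_right)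

lemma op_tensor_zero_right:
  assumes "S \<in> bounded_ops"
  shows "S \<otimes>\<^sub>o 0 = 0"
  by (rule op_tensor_ext) (simp_all add: assms op_tensor_apply)

lemma op_tensor_sum_right:
  assumes "S \<in> bounded_ops" "\<And>i. i \<in> I \<Longrightarrow> T i \<in> bounded_ops"
  shows "S \<otimes>\<^sub>o (\<Sum>i\<in>I. T i) = (\<Sum>i\<in>I. S \<otimes>\<^sub>o T i)"
  using assms(2)
  by (induction I rule: infinite_finite_induct)
    (simp_all add: op_tensor_zero_right op_tensor_add_right assms(1))

section \<open>Slices in a tensor product of von Neumann algebras\<close>

lemma vN_commutant_adj: "von_neumann_algebra M \<Longrightarrow> T \<in> commutant M \<Longrightarrow> T\<^sup>\<dagger> \<in> commutant M"
  by (rule commutant_adj) (auto simp: von_neumann_algebra_def)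

lemma id_commutant: "id_blinfun \<in> commutant S"
  by (auto simp: commutant_def intro: blinfun_eqI)

lemma simple_tensors_bounded:
  assumes "von_neumann_algebra M" "von_neumann_algebra N"
  shows "{x \<otimes>\<^sub>o y | x y. x \<in> M \<and> y \<in> N} \<subseteq> bounded_ops"
  using vN_bounded[OF assms(1)] vN_bounded[OF assms(2)] by auto

lemma vN_tensor_von_neumann:
  "von_neumann_algebra M \<Longrightarrow> von_neumann_algebra N \<Longrightarrow> von_neumann_algebra (M \<otimes>\<^sub>A N)"
  unfolding vN_tensor_def by (intro vN_generated_von_neumann simple_tensors_bounded)

lemma op_tensor_in_vN_tensor: "x \<in> M \<Longrightarrow> y \<in> N \<Longrightarrow> x \<otimes>\<^sub>o y \<in> M \<otimes>\<^sub>A N"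
  unfolding vN_tensor_def by (rule subsetD[OF vN_generated_subset]) auto

lemma vN_tensor_mono:
  assumes "M \<subseteq> M'" "N \<subseteq> N'" "von_neumann_algebra M'" "von_neumann_algebra N'"
  shows "M \<otimes>\<^sub>A N \<subseteq> M' \<otimes>\<^sub>A N'"
proof -
  have "{x \<otimes>\<^sub>o y |x y. x \<in> M \<and> y \<in> N} \<subseteq> M' \<otimes>\<^sub>A N'"
    using op_tensor_in_vN_tensor assms by blast
  then show ?thesis
    unfolding vN_tensor_def[of M N]
    by (intro vN_generated_least vN_tensor_von_neumann assms)
qed

lemma vN_tensor_commute:
  assumes M: "von_neumann_algebra M" "von_neumann_algebra N"
    and S: "S \<in> commutant M" and T: "T \<in> commutant N" and X: "X \<in> M \<otimes>\<^sub>A N"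
  shows "(S \<otimes>\<^sub>o T) o\<^sub>L X = X o\<^sub>L (S \<otimes>\<^sub>o T)"
proof (rule commute_vN_generated[OF simple_tensors_bounded[OF M]])
  have b: "S \<in> bounded_ops" "T \<in> bounded_ops" using S T commutant_bounded by blast+
  then show "S \<otimes>\<^sub>o T \<in> bounded_ops" by simp
  show "X \<in> vN_generated {x \<otimes>\<^sub>o y |x y. x \<in> M \<and> y \<in> N}" using X by (simp add: vN_tensor_def)
  have gen: "(S' \<otimes>\<^sub>o T') o\<^sub>L s = s o\<^sub>L (S' \<otimes>\<^sub>o T')"
    if ST: "S' \<in> commutant M" "T' \<in> commutant N" and sG: "s \<in> {x \<otimes>\<^sub>o y |x y. x \<in> M \<and> y \<in> N}" for S' T' s
  proof -
    obtain x y where s: "s = x \<otimes>\<^sub>o y" "x \<in> M" "y \<in> N" using sG by blast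
    have "S' \<in> bounded_ops" "T' \<in> bounded_ops" "x \<in> bounded_ops" "y \<in> bounded_ops"
      using ST s M vN_bounded commutant_bounded by blast+
    then show ?thesis
      using commutantD[OF ST(1) s(2)] commutantD[OF ST(2) s(3)] by (simp add: s op_tensor_compose)
  qed
  have "S\<^sup>\<dagger> \<in> commutant M" "T\<^sup>\<dagger> \<in> commutant N"
    using vN_commutant_adj M S T by blast+
  then show "(S \<otimes>\<^sub>o T)\<^sup>\<dagger> o\<^sub>L s = s o\<^sub>L (S \<otimes>\<^sub>o T)\<^sup>\<dagger>" if "s \<in> {x \<otimes>\<^sub>o y |x y. x \<in> M \<and> y \<in> N}" for s
    using gen that b by (simp add: op_tensor_adj)
  show "(S \<otimes>\<^sub>o T) o\<^sub>L s = s o\<^sub>L (S \<otimes>\<^sub>o T)" if "s \<in> {x \<otimes>\<^sub>o y |x y. x \<in> M \<and> y \<in> N}" for s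
    using gen S T that .
qed

text \<open>Fixing two vectors in one factor turns \<open>X\<close> into an operator on the other factor.  It inherits
  commutation with the commutant of that factor, and therefore lies in it by the bicommutant
  property.\<close>

lemma vN_tensor_slice_left_factor:
  fixes M :: "'i op set" and N :: "'j op set"
  assumes M: "von_neumann_algebra M" "von_neumann_algebra N" and X: "X \<in> M \<otimes>\<^sub>A N"
  obtains a where "a \<in> M"
    "\<And>u v. cinner u (blinfun_apply a v) = cinner (u \<otimes>\<^sub>v \<zeta>) (X (v \<otimes>\<^sub>v \<eta>))"
proof -
  have Xb: "X \<in> bounded_ops" using vN_bounded[OF vN_tensor_von_neumann[OF M] X] .
  obtain a :: "'i op" where a: "a \<in> bounded_ops"
    "\<And>u v. cinner u (blinfun_apply a v) = cinner (u \<otimes>\<^sub>v \<zeta>) (X (v \<otimes>\<^sub>v \<eta>))"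
  proof (rule bounded_sesquilinear_representation
      [of "\<lambda>u v. cinner (u \<otimes>\<^sub>v \<zeta>) (X (v \<otimes>\<^sub>v \<eta>))" "norm \<zeta> * norm X * norm \<eta>"])
    fix u v
    have "cmod (cinner (u \<otimes>\<^sub>v \<zeta>) (X (v \<otimes>\<^sub>v \<eta>))) \<le> norm (u \<otimes>\<^sub>v \<zeta>) * norm (X (v \<otimes>\<^sub>v \<eta>))"
      by (rule cinner_Cauchy_Schwarz)
    also have "\<dots> \<le> norm (u \<otimes>\<^sub>v \<zeta>) * (norm X * norm (v \<otimes>\<^sub>v \<eta>))"
      by (intro mult_left_mono norm_blinfun) simp
    finally show "cmod (cinner (u \<otimes>\<^sub>v \<zeta>) (X (v \<otimes>\<^sub>v \<eta>))) \<le> norm \<zeta> * norm X * norm \<eta> * norm u * norm v"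
      by (simp add: norm_tensor mult_ac)
  qed (auto simp: tensor_add_left tensor_scale_left cinner_simps blinfun_lin bounded_opsD[OF Xb])
  have "a \<in> M"
  proof (rule vN_memI[OF M(1) a(1)])
    fix T assume T: "T \<in> commutant M"
    then have Tb: "T \<in> bounded_ops" using commutant_bounded by blast
    have comm: "(T \<otimes>\<^sub>o id_blinfun) (X w) = X ((T \<otimes>\<^sub>o id_blinfun) w)" for w
      using vN_tensor_commute[OF M T id_commutant X] by (metis blinfun_apply_blinfun_compose)
    show "a o\<^sub>L T = T o\<^sub>L a"
    proof (rule blinfun_eqI, rule cinner_ext)
      fix v u
      have "cinner u (a (T v)) = cinner (u \<otimes>\<^sub>v \<zeta>) (X ((T \<otimes>\<^sub>o id_blinfun) (v \<otimes>\<^sub>v \<eta>)))"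
        by (simp add: a(2) op_tensor_apply Tb)
      also have "\<dots> = cinner ((T \<otimes>\<^sub>o id_blinfun)\<^sup>\<dagger> (u \<otimes>\<^sub>v \<zeta>)) (X (v \<otimes>\<^sub>v \<eta>))"
        by (simp add: comm[symmetric] cinner_adj_left Tb)
      also have "\<dots> = cinner (T\<^sup>\<dagger> u) (a v)"
        by (simp add: a(2) op_tensor_adj op_tensor_apply Tb)
      finally show "cinner u ((a o\<^sub>L T) v) = cinner u ((T o\<^sub>L a) v)"
        by (simp add: cinner_adj_left Tb)
    qed
  qed
  then show ?thesis using a(2) that by blast
qed

lemma vN_tensor_slice_right_factor:
  fixes M :: "'i op set" and N :: "'j op set"
  assumes M: "von_neumann_algebra M" "von_neumann_algebra N" and X: "X \<in> M \<otimes>\<^sub>A N"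
  obtains b where "b \<in> N"
    "\<And>\<zeta> \<eta>. cinner \<zeta> (blinfun_apply b \<eta>) = cinner (u \<otimes>\<^sub>v \<zeta>) (X (v \<otimes>\<^sub>v \<eta>))"
proof -
  have Xb: "X \<in> bounded_ops" using vN_bounded[OF vN_tensor_von_neumann[OF M] X] .
  obtain b :: "'j op" where b: "b \<in> bounded_ops"
    "\<And>\<zeta> \<eta>. cinner \<zeta> (blinfun_apply b \<eta>) = cinner (u \<otimes>\<^sub>v \<zeta>) (X (v \<otimes>\<^sub>v \<eta>))"
  proof (rule bounded_sesquilinear_representation
      [of "\<lambda>\<zeta> \<eta>. cinner (u \<otimes>\<^sub>v \<zeta>) (X (v \<otimes>\<^sub>v \<eta>))" "norm u * norm X * norm v"])
    fix \<zeta> \<eta>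
    have "cmod (cinner (u \<otimes>\<^sub>v \<zeta>) (X (v \<otimes>\<^sub>v \<eta>))) \<le> norm (u \<otimes>\<^sub>v \<zeta>) * norm (X (v \<otimes>\<^sub>v \<eta>))"
      by (rule cinner_Cauchy_Schwarz)
    also have "\<dots> \<le> norm (u \<otimes>\<^sub>v \<zeta>) * (norm X * norm (v \<otimes>\<^sub>v \<eta>))"
      by (intro mult_left_mono norm_blinfun) simp
    finally show "cmod (cinner (u \<otimes>\<^sub>v \<zeta>) (X (v \<otimes>\<^sub>v \<eta>))) \<le> norm u * norm X * norm v * norm \<zeta> * norm \<eta>"
      by (simp add: norm_tensor mult_ac)
  qed (auto simp: tensor_add_right tensor_scale_right cinner_simps blinfun_lin bounded_opsD[OF Xb])
  have "b \<in> N"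
  proof (rule vN_memI[OF M(2) b(1)])
    fix T assume T: "T \<in> commutant N"
    then have Tb: "T \<in> bounded_ops" using commutant_bounded by blast
    have comm: "(id_blinfun \<otimes>\<^sub>o T) (X w) = X ((id_blinfun \<otimes>\<^sub>o T) w)" for w
      using vN_tensor_commute[OF M id_commutant T X] by (metis blinfun_apply_blinfun_compose)
    show "b o\<^sub>L T = T o\<^sub>L b"
    proof (rule blinfun_eqI, rule cinner_ext)
      fix \<eta> \<zeta>
      have "cinner \<zeta> (b (T \<eta>)) = cinner (u \<otimes>\<^sub>v \<zeta>) (X ((id_blinfun \<otimes>\<^sub>o T) (v \<otimes>\<^sub>v \<eta>)))"
        by (simp add: b(2) op_tensor_apply Tb)
      also have "\<dots> = cinner ((id_blinfun \<otimes>\<^sub>o T)\<^sup>\<dagger> (u \<otimes>\<^sub>v \<zeta>)) (X (v \<otimes>\<^sub>v \<eta>))"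
        by (simp add: comm[symmetric] cinner_adj_left Tb)
      also have "\<dots> = cinner (T\<^sup>\<dagger> \<zeta>) (b \<eta>)"
        by (simp add: b(2) op_tensor_adj op_tensor_apply Tb)
      finally show "cinner \<zeta> ((b o\<^sub>L T) \<eta>) = cinner \<zeta> ((T o\<^sub>L b) \<eta>)"
        by (simp add: cinner_adj_left Tb)
    qed
  qed
  then show ?thesis using b(2) that by blast
qed

section \<open>The modulus of a hermitian contraction\<close>

text \<open>Iteration of the fixed point equation \<open>2 Y = z + Y\<^sup>2\<close>, which is solved by \<open>1\<close> minus a square root of \<open>1 - z\<close>.\<close>

fun sqrt_iter :: "'i op \<Rightarrow> nat \<Rightarrow> 'i op" where
  "sqrt_iter z 0 = 0"
| "sqrt_iter z (Suc n) = (1/2) *\<^sub>R (z + (sqrt_iter z n o\<^sub>L sqrt_iter z n))"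

text \<open>The same iteration for the scalar \<open>z = 1\<close>.\<close>

fun real_sqrt_iter :: "nat \<Rightarrow> real" where
  "real_sqrt_iter 0 = 0"
| "real_sqrt_iter (Suc n) = (1 + (real_sqrt_iter n)\<^sup>2) / 2"

lemma real_sqrt_iter_bounds: "0 \<le> real_sqrt_iter n" "real_sqrt_iter n \<le> 1"
proof (induction n)
  case (Suc n)
  { case 1 show ?case using Suc by simp }
  { case 2 show ?case using Suc power_le_one[of "real_sqrt_iter n" 2] by simp }
qed auto

lemma real_sqrt_iter_mono: "real_sqrt_iter n \<le> real_sqrt_iter (Suc n)"
proof -
  have "0 \<le> (real_sqrt_iter n - 1)\<^sup>2" by simp
  then show ?thesis by (simp add: power2_eq_square algebra_simps)
qed

lemma real_sqrt_iter_convergent: "convergent real_sqrt_iter"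
  by (rule Bseq_mono_convergent[OF BseqI'[of _ 1]])
    (use real_sqrt_iter_bounds in \<open>auto intro: incseq_SucI[THEN incseqD] real_sqrt_iter_mono\<close>)

lemma sqrt_iter_commute:
  assumes "T o\<^sub>L z = z o\<^sub>L T"
  shows "T o\<^sub>L sqrt_iter z n = sqrt_iter z n o\<^sub>L T"
proof (induction n)
  case (Suc n)
  have z: "T (z x) = z (T x)" for x using assms by (metis blinfun_apply_blinfun_compose)
  have "T (sqrt_iter z n x) = sqrt_iter z n (T x)" for x
    using Suc by (metis blinfun_apply_blinfun_compose)
  then show ?case
    by (auto intro!: blinfun_eqI simp: blinfun_lin z)
qed simp

lemma sqrt_iter_adj:
  assumes "z \<in> bounded_ops" "z\<^sup>\<dagger> = z"
  shows "sqrt_iter z n \<in> bounded_ops \<and> (sqrt_iter z n)\<^sup>\<dagger> = sqrt_iter z n"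
  by (induction n) (use assms in simp_all)

lemma norm_sqrt_iter:
  assumes "norm z \<le> 1"
  shows "norm (sqrt_iter z n) \<le> real_sqrt_iter n"
proof (induction n)
  case (Suc n)
  have "norm (sqrt_iter z n o\<^sub>L sqrt_iter z n) \<le> norm (sqrt_iter z n) * norm (sqrt_iter z n)"
    by (rule norm_blinfun_compose)
  also have "\<dots> \<le> (real_sqrt_iter n)\<^sup>2"
    unfolding power2_eq_square by (intro mult_mono Suc real_sqrt_iter_bounds) simp
  finally have "norm (z + (sqrt_iter z n o\<^sub>L sqrt_iter z n)) \<le> 1 + (real_sqrt_iter n)\<^sup>2"
    using assms by (intro order_trans[OF norm_triangle_ineq] add_mono) auto
  then show ?case by simp
qed simp

text \<open>The iterates \<open>Y\<^sub>n\<close> commute, so \<open>Y\<^sub>n\<^sub>+\<^sub>2 - Y\<^sub>n\<^sub>+\<^sub>1 = (Y\<^sub>n\<^sub>+\<^sub>1 + Y\<^sub>n) (Y\<^sub>n\<^sub>+\<^sub>1 - Y\<^sub>n) / 2\<close>, and the scalar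
  iteration satisfies the same recursion.\<close>

lemma norm_sqrt_iter_diff:
  assumes z: "norm z \<le> 1"
  shows "norm (sqrt_iter z (Suc n) - sqrt_iter z n) \<le> real_sqrt_iter (Suc n) - real_sqrt_iter n"
proof (induction n)
  case 0
  then show ?case using z by simp
next
  case (Suc n)
  let ?Y = "sqrt_iter z" and ?y = real_sqrt_iter
  have comm: "?Y (Suc n) o\<^sub>L ?Y n = ?Y n o\<^sub>L ?Y (Suc n)"
    by (intro sqrt_iter_commute sqrt_iter_commute[symmetric]) simp
  have "?Y (Suc (Suc n)) - ?Y (Suc n)
      = (1/2) *\<^sub>R ((?Y (Suc n) o\<^sub>L ?Y (Suc n)) - (?Y n o\<^sub>L ?Y n))"
    by (simp only: sqrt_iter.simps(2)[of z "Suc n"]) (simp add: algebra_simps)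
  also have "\<dots> = (1/2) *\<^sub>R ((?Y (Suc n) + ?Y n) o\<^sub>L (?Y (Suc n) - ?Y n))"
    by (simp add: op_compose_add_left op_compose_diff_right comm del: sqrt_iter.simps)
  finally have "norm (?Y (Suc (Suc n)) - ?Y (Suc n))
      \<le> (1/2) * (norm (?Y (Suc n) + ?Y n) * norm (?Y (Suc n) - ?Y n))"
    using norm_blinfun_compose[of "?Y (Suc n) + ?Y n" "?Y (Suc n) - ?Y n"]
    by (simp del: sqrt_iter.simps)
  also have "\<dots> \<le> (1/2) * ((?y (Suc n) + ?y n) * (?y (Suc n) - ?y n))"
    by (intro mult_left_mono mult_mono Suc norm_triangle_le add_mono norm_sqrt_iter z
        add_nonneg_nonneg real_sqrt_iter_bounds) (simp_all del: sqrt_iter.simps)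
  also have "\<dots> = ?y (Suc (Suc n)) - ?y (Suc n)"
    by (simp only: real_sqrt_iter.simps(2)[of "Suc n"])
      (simp add: power2_eq_square field_simps)
  finally show ?case .
qed

text \<open>The increments of the iteration are dominated in norm by those of the convergent scalar iteration.
  Hence it converges in norm to some \<open>Y\<close> with \<open>2 Y = z + Y\<^sup>2\<close>, that is \<open>(1 - Y)\<^sup>2 = 1 - z\<close>, and
  \<open>1 - Y\<close> is positive because \<open>\<parallel>Y\<parallel> \<le> 1\<close>.\<close>

lemma exists_sqrt_one_minus:
  fixes z :: "'i op"
  assumes z: "z \<in> bounded_ops" "z\<^sup>\<dagger> = z" "norm z \<le> 1"
  obtains s where "s \<in> bounded_ops" "s\<^sup>\<dagger> = s" "s o\<^sub>L s = id_blinfun - z" "\<And>x. 0 \<le> inner x (blinfun_apply s x)"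
    "\<And>T. T o\<^sub>L z = z o\<^sub>L T \<Longrightarrow> T o\<^sub>L s = s o\<^sub>L T"
proof -
  let ?Y = "sqrt_iter z"
  have diff: "norm (?Y n - ?Y m) \<le> real_sqrt_iter n - real_sqrt_iter m" if "m \<le> n" for m n
    using that
  proof (induction n rule: dec_induct)
    case (step n)
    have "norm (?Y (Suc n) - ?Y m) \<le> norm (?Y (Suc n) - ?Y n) + norm (?Y n - ?Y m)"
      using norm_triangle_ineq[of "?Y (Suc n) - ?Y n" "?Y n - ?Y m"] by (simp del: sqrt_iter.simps)
    then show ?case using norm_sqrt_iter_diff[OF z(3), of n] step by linarith
  qed simp
  have "Cauchy ?Y"
  proof (rule metric_CauchyI)
    fix e :: real assume "0 < e"
    then obtain M where M: "\<And>m n. m \<ge> M \<Longrightarrow> n \<ge> M \<Longrightarrow> norm (real_sqrt_iter m - real_sqrt_iter n) < e"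
      using CauchyD[OF convergent_Cauchy[OF real_sqrt_iter_convergent] \<open>0 < e\<close>] by blast
    have "dist (?Y m) (?Y n) < e" if "m \<ge> M" "n > m" for m n
      using diff[of m n] M[of n m] that by (simp add: dist_norm norm_minus_commute)
    then show "\<exists>M. \<forall>m\<ge>M. \<forall>n\<ge>M. dist (?Y m) (?Y n) < e"
      by (metis dist_commute dist_self linorder_neqE_nat \<open>0 < e\<close>)
  qed
  then obtain Y where Y: "?Y \<longlonglongrightarrow> Y" using Cauchy_convergent convergent_def by blast
  have Yap: "(\<lambda>n. ?Y n x) \<longlonglongrightarrow> Y x" for x
    by (intro tendsto_intros Y)
  have eq: "Y = (1/2) *\<^sub>R (z + (Y o\<^sub>L Y))"
  proof (rule LIMSEQ_unique)
    show "(\<lambda>n. ?Y (Suc n)) \<longlonglongrightarrow> Y" using Y by (rule LIMSEQ_Suc)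
    show "(\<lambda>n. ?Y (Suc n)) \<longlonglongrightarrow> (1/2) *\<^sub>R (z + (Y o\<^sub>L Y))"
      unfolding sqrt_iter.simps by (intro tendsto_intros Y)
  qed
  have Yb: "Y \<in> bounded_ops"
  proof -
    have "Y (c *\<^sub>C x) = c *\<^sub>C Y x" for c x
    proof (rule LIMSEQ_unique)
      show "(\<lambda>n. ?Y n (c *\<^sub>C x)) \<longlonglongrightarrow> Y (c *\<^sub>C x)" by (rule Yap)
      have "(\<lambda>n. c *\<^sub>C ?Y n x) \<longlonglongrightarrow> c *\<^sub>C Y x"
        by (rule bounded_linear.tendsto[OF bounded_linear_scaleC Yap])
      then show "(\<lambda>n. ?Y n (c *\<^sub>C x)) \<longlonglongrightarrow> c *\<^sub>C Y x"
        using sqrt_iter_adj[OF z(1,2)] by (simp add: bounded_opsD)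
    qed
    then show ?thesis by (simp add: bounded_ops_def)
  qed
  have Yinner: "inner (Y x) y = inner x (Y y)" for x y
  proof (rule LIMSEQ_unique)
    show "(\<lambda>n. inner (?Y n x) y) \<longlonglongrightarrow> inner (Y x) y" by (intro tendsto_intros Yap)
    have "(\<lambda>n. inner x (?Y n y)) \<longlonglongrightarrow> inner x (Y y)" by (intro tendsto_intros Yap)
    then show "(\<lambda>n. inner (?Y n x) y) \<longlonglongrightarrow> inner x (Y y)"
      using sqrt_iter_adj[OF z(1,2)] inner_adj_left[of "?Y n" x y for n] by simp
  qed
  have Yadj: "Y\<^sup>\<dagger> = Y"
  proof (rule op_adj_eqI)
    fix x y
    have "Im (cinner (Y x) y) = Im (cinner x (Y y))"
      using Yinner[of "\<i> *\<^sub>C x" y] by (simp add: Im_cinner bounded_opsD[OF Yb])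
    then show "cinner (Y x) y = cinner x (Y y)"
      using Yinner[of x y] by (simp add: complex_eq_iff inner_eq_Re_cinner)
  qed
  have normY: "norm Y \<le> 1"
    by (rule LIMSEQ_le_const2[OF tendsto_norm[OF Y]])
      (use norm_sqrt_iter[OF z(3)] real_sqrt_iter_bounds(2) order_trans in blast)
  define s where "s = id_blinfun - Y"
  have "s o\<^sub>L s = id_blinfun - z"
  proof (rule blinfun_eqI)
    fix x
    have "Y x = (1/2) *\<^sub>R (z x + Y (Y x))"
      by (subst eq) (simp add: blinfun_lin)
    then have "2 *\<^sub>R Y x = z x + Y (Y x)"
      by (metis (no_types, lifting) mult_numeral_1_right numeral_One nonzero_mult_div_cancel_left
          scaleR_one scaleR_scaleR times_divide_eq_right zero_neq_numeral)
    then show "(s o\<^sub>L s) x = (id_blinfun - z) x"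
      by (simp add: s_def blinfun_lin algebra_simps scaleR_2)
  qed
  moreover have "0 \<le> inner x (s x)" for x
  proof -
    have "inner x (Y x) \<le> norm x * norm (Y x)" by (rule norm_cauchy_schwarz)
    also have "\<dots> \<le> norm x * (1 * norm x)"
      by (intro mult_left_mono order_trans[OF norm_blinfun] mult_right_mono normY) auto
    finally show ?thesis by (simp add: s_def blinfun_lin inner_simps dot_square_norm power2_eq_square)
  qed
  moreover have "T o\<^sub>L s = s o\<^sub>L T" if T: "T o\<^sub>L z = z o\<^sub>L T" for T
  proof -
    have "T o\<^sub>L Y = Y o\<^sub>L T"
    proof (rule LIMSEQ_unique)
      show "(\<lambda>n. T o\<^sub>L ?Y n) \<longlonglongrightarrow> (T o\<^sub>L Y)" by (intro tendsto_intros Y)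
      show "(\<lambda>n. T o\<^sub>L ?Y n) \<longlonglongrightarrow> (Y o\<^sub>L T)"
        unfolding sqrt_iter_commute[OF T] by (intro tendsto_intros Y)
    qed
    then have "T (Y x) = Y (T x)" for x by (metis blinfun_apply_blinfun_compose)
    then show ?thesis by (auto intro!: blinfun_eqI simp: s_def blinfun_lin)
  qed
  moreover have "s \<in> bounded_ops" "s\<^sup>\<dagger> = s" using Yb Yadj by (simp_all add: s_def)
  ultimately show ?thesis using that by blast
qed

text \<open>For a hermitian contraction \<open>y\<close>, the operator \<open>T = 1 - y\<^sup>2\<close> satisfies \<open>T - T\<^sup>2 = y T y \<ge> 0\<close>, so it is a
  contraction too and the square root of \<open>y\<^sup>2 = 1 - T\<close> is available.\<close>

lemma exists_modulus:
  fixes y :: "'i op"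
  assumes y: "y \<in> bounded_ops" "y\<^sup>\<dagger> = y" "norm y \<le> 1"
  obtains s where "s \<in> bounded_ops" "s\<^sup>\<dagger> = s" "s o\<^sub>L s = y o\<^sub>L y" "\<And>x. 0 \<le> inner x (blinfun_apply s x)"
    "\<And>T. T o\<^sub>L y = y o\<^sub>L T \<Longrightarrow> T o\<^sub>L s = s o\<^sub>L T"
proof -
  define z where "z = id_blinfun - (y o\<^sub>L y)"
  have zap: "z x = x - y (y x)" for x by (simp add: z_def blinfun_lin)
  have yi: "inner (y u) v = inner u (y v)" for u v
    using inner_adj_left[OF y(1), of u v] y(2) by simp
  have ynorm: "norm (y x) \<le> norm x" for x
    using order_trans[OF norm_blinfun mult_right_mono[OF y(3) norm_ge_zero], of x] by simp
  have zpos: "inner x (z x) = (norm x)\<^sup>2 - (norm (y x))\<^sup>2" for x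
    by (simp add: zap inner_simps power2_norm_eq_inner flip: yi)
  have "norm (z x) \<le> 1 * norm x" for x
  proof -
    have "inner (z x) (z x) + inner (y x) (z (y x)) = inner x (z x)"
      by (simp add: zap inner_simps blinfun_lin yi)
    moreover have "0 \<le> inner (y x) (z (y x))"
      using ynorm[of "y x"] unfolding zpos by (simp add: power_mono)
    ultimately have "(norm (z x))\<^sup>2 \<le> (norm x)\<^sup>2"
      using zpos[of x] zero_le_power2[of "norm (y x)"] unfolding power2_norm_eq_inner[of "z x"] by linarith
    then show ?thesis by (auto intro: power2_le_imp_le)
  qed
  then have nz: "norm z \<le> 1" by (intro norm_blinfun_bound) auto
  have zb: "z \<in> bounded_ops" "z\<^sup>\<dagger> = z" using y by (auto simp: z_def)
  obtain s where s: "s \<in> bounded_ops" "s\<^sup>\<dagger> = s" "s o\<^sub>L s = id_blinfun - z" "\<And>x. 0 \<le> inner x (blinfun_apply s x)"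
    "\<And>T. T o\<^sub>L z = z o\<^sub>L T \<Longrightarrow> T o\<^sub>L s = s o\<^sub>L T"
    using exists_sqrt_one_minus[OF zb nz] by metis
  have comm: "T o\<^sub>L s = s o\<^sub>L T" if "T o\<^sub>L y = y o\<^sub>L T" for T
  proof (rule s(5))
    have "T (y x) = y (T x)" for x using that by (metis blinfun_apply_blinfun_compose)
    then show "T o\<^sub>L z = z o\<^sub>L T" by (auto intro!: blinfun_eqI simp: zap blinfun_lin)
  qed
  have "s o\<^sub>L s = y o\<^sub>L y" using s(3) by (simp add: z_def)
  then show ?thesis using that s(1,2,4) comm by blast
qed

section \<open>Spectral projections\<close>

lemma projection_apply:
  assumes "E o\<^sub>L E = E"
  shows "blinfun_apply E (blinfun_apply E x) = blinfun_apply E x"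
  using assms by (metis blinfun_apply_blinfun_compose)

text \<open>The clause on \<open>T\<close> holds because a subspace invariant under \<open>T\<close> and \<open>T\<^sup>*\<close> reduces \<open>T\<close>.\<close>

lemma exists_projection_onto:
  fixes S :: "'i ell2 set"
  assumes S: "csubspace S" "closed S"
  obtains E :: "'i op" where "E \<in> bounded_ops" "E\<^sup>\<dagger> = E" "E o\<^sub>L E = E" "\<And>x. E x \<in> S"
    "\<And>x. x \<in> S \<Longrightarrow> E x = x" "\<And>x t. t \<in> S \<Longrightarrow> cinner t (x - E x) = 0"
    "\<And>T. T \<in> bounded_ops \<Longrightarrow> T ` S \<subseteq> S \<Longrightarrow> T\<^sup>\<dagger> ` S \<subseteq> S \<Longrightarrow> T o\<^sub>L E = E o\<^sub>L T"
proof -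
  obtain E :: "'i op" where E: "E \<in> bounded_ops" "\<And>x. E x \<in> S" "\<And>x t. t \<in> S \<Longrightarrow> cinner t (x - E x) = 0"
    "\<And>x. x \<in> S \<Longrightarrow> E x = x"
    using exists_orthogonal_projection[OF S] by metis
  have adj: "E\<^sup>\<dagger> = E"
  proof (rule op_adj_eqI)
    fix x y
    have "cinner (E x) y = cinner (E x) (E y)"
      using E(3)[OF E(2), of x y] by (simp add: cinner_diff_right)
    also have "\<dots> = cinner x (E y)"
      using E(3)[OF E(2), of y x] cinner_commute[of "E y" "x - E x"] cinner_commute[of "x - E x" "E y"]
      by (simp add: cinner_diff_left)
    finally show "cinner (E x) y = cinner x (E y)" .
  qed
  have idem: "E o\<^sub>L E = E" by (rule blinfun_eqI) (simp add: E)
  have "T o\<^sub>L E = E o\<^sub>L T" if T: "T \<in> bounded_ops" "T ` S \<subseteq> S" "T\<^sup>\<dagger> ` S \<subseteq> S" for T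
  proof -
    have TE: "U o\<^sub>L E = E o\<^sub>L (U o\<^sub>L E)" if "U ` S \<subseteq> S" for U :: "'i op"
    proof (rule blinfun_eqI)
      fix x
      have "U (E x) \<in> S" using that E(2) by blast
      then show "(U o\<^sub>L E) x = (E o\<^sub>L (U o\<^sub>L E)) x" using E(4) by simp
    qed
    have "(T\<^sup>\<dagger> o\<^sub>L E)\<^sup>\<dagger> = (E o\<^sub>L (T\<^sup>\<dagger> o\<^sub>L E))\<^sup>\<dagger>" using TE[OF T(3)] by simp
    then have "E o\<^sub>L T = (E o\<^sub>L T) o\<^sub>L E" using T(1) E(1) adj idem by (simp add: op_compose_assoc)
    then show ?thesis using TE[OF T(2)] by (simp add: op_compose_assoc)
  qed
  then show ?thesis using that E adj idem by blast
qed

text \<open>The projection onto \<open>ker (\<bar>y\<bar> - y)\<close> cuts \<open>y\<close> into its positive and its negative part: a vector orthogonal to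
  this kernel is orthogonal to the range of \<open>\<bar>y\<bar> + y\<close>, hence killed by \<open>\<bar>y\<bar> + y\<close>.\<close>

lemma exists_positive_spectral_projection:
  fixes y :: "'i op"
  assumes y: "y \<in> bounded_ops" "y\<^sup>\<dagger> = y"
  obtains E where "E \<in> projections (commutant (commutant {y}))"
    "\<And>x. 0 \<le> inner (blinfun_apply E x) (y (E x))"
    "\<And>x. inner (x - E x) (y (x - E x)) \<le> 0"
proof -
  note result = that
  have contr: thesis if y1: "w \<in> bounded_ops" "w\<^sup>\<dagger> = w" "norm w \<le> 1"
    and w: "\<And>x. y x = k *\<^sub>R blinfun_apply w x" and k: "k > 0" for w :: "'i op" and k
  proof -
    obtain s where s: "s \<in> bounded_ops" "s\<^sup>\<dagger> = s" "s o\<^sub>L s = w o\<^sub>L w"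
      "\<And>x. 0 \<le> inner x (blinfun_apply s x)" "\<And>T. T o\<^sub>L w = w o\<^sub>L T \<Longrightarrow> T o\<^sub>L s = s o\<^sub>L T"
      using exists_modulus[OF y1] by metis
    have sw: "s (w x) = w (s x)" for x using s(5)[of w] by (metis blinfun_apply_blinfun_compose)
    have ss: "s (s x) = w (w x)" for x using s(3) by (metis blinfun_apply_blinfun_compose)
    define S where "S = {x. s x = w x}"
    have "csubspace S"
      by (rule csubspaceI) (auto simp: S_def blinfun_lin bounded_opsD s(1) y1(1))
    moreover have "closed S" unfolding S_def
      by (intro closed_Collect_eq continuous_intros)
    ultimately obtain E :: "'i op" where E: "E \<in> bounded_ops" "E\<^sup>\<dagger> = E" "E o\<^sub>L E = E" "\<And>x. E x \<in> S"
      "\<And>x. x \<in> S \<Longrightarrow> E x = x" "\<And>x t. t \<in> S \<Longrightarrow> cinner t (x - E x) = 0"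
      "\<And>T. T \<in> bounded_ops \<Longrightarrow> T ` S \<subseteq> S \<Longrightarrow> T\<^sup>\<dagger> ` S \<subseteq> S \<Longrightarrow> T o\<^sub>L E = E o\<^sub>L T"
      using exists_projection_onto by metis
    have inv: "T ` S \<subseteq> S" if T: "T \<in> commutant {y}" for T
    proof -
      have "k *\<^sub>R T (w x) = k *\<^sub>R w (T x)" for x
      proof -
        have "T (y x) = y (T x)" using commutantD[OF T, of y] by (metis blinfun_apply_blinfun_compose insertI1)
        then show ?thesis by (simp add: w blinfun_lin)
      qed
      then have Tw: "T (w x) = w (T x)" for x using k by simp
      then have "T (s x) = s (T x)" for x
        using s(5)[of T] by (metis blinfun_apply_blinfun_compose blinfun_eqI)
      then show ?thesis using Tw by (auto simp: S_def) metis
    qed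
    have "E \<in> commutant (commutant {y})"
    proof -
      have "T o\<^sub>L E = E o\<^sub>L T" if T: "T \<in> commutant {y}" for T
      proof (rule E(7))
        show "T \<in> bounded_ops" using T commutant_bounded by blast
        show "T ` S \<subseteq> S" by (rule inv[OF T])
        show "T\<^sup>\<dagger> ` S \<subseteq> S" by (rule inv, rule commutant_adj) (use T y in auto)
      qed
      then show ?thesis using E(1) unfolding commutant_def[of "commutant {y}"] by auto
    qed
    then have proj: "E \<in> projections (commutant (commutant {y}))" using E(2,3) by (simp add: projections_def)
    have pos: "0 \<le> inner (E x) (y (E x))" for x
    proof -
      have "w (E x) = s (E x)" using E(4)[of x] by (simp add: S_def)
      then show ?thesis using s(4)[of "E x"] k by (simp add: w)
    qed
    have neg: "inner (x - E x) (y (x - E x)) \<le> 0" for x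
    proof -
      let ?u = "x - E x"
      have range: "s v + w v \<in> S" for v
        by (simp add: S_def blinfun_lin sw ss)
      have "cinner (s ?u + w ?u) v = 0" for v
      proof -
        have "cinner (s ?u + w ?u) v = cinner ?u (s v + w v)"
          using cinner_adj_left[OF s(1), of ?u v] cinner_adj_left[OF y1(1), of ?u v] s(2) y1(2)
          by (simp add: cinner_add_left cinner_add_right)
        also have "\<dots> = cnj (cinner (s v + w v) ?u)" by (rule cinner_commute)
        finally show ?thesis using E(6)[OF range] by simp
      qed
      then have "s ?u + w ?u = 0" using cinner_self_eq_0 by blast
      then have "w ?u = - s ?u" by (simp add: add_eq_0_iff)
      then have "inner ?u (y ?u) = - (k * inner ?u (s ?u))"
        by (simp only: w) simp
      then show ?thesis using mult_nonneg_nonneg[OF less_imp_le[OF k] s(4)[of ?u]] by linarith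
    qed
    show thesis by (rule result[OF proj pos neg])
  qed
  \<comment> \<open>Rescaling makes \<open>y\<close> a contraction, for which the modulus is available.\<close>
  define k where "k = norm y + 1"
  have k: "k > 0" by (simp add: k_def add_nonneg_pos)
  show thesis
  proof (rule contr[of "(1/k) *\<^sub>R y" k])
    show "norm ((1/k) *\<^sub>R y) \<le> 1" using k by (simp add: k_def divide_le_eq)
  qed (use y k in \<open>simp_all add: blinfun_lin\<close>)
qed

text \<open>With \<open>u = (k - T) \<xi>\<close> and \<open>w = (k + T) \<xi>\<close>, the sum of the nonnegative numbers \<open>\<langle>(k + T) u, u\<rangle>\<close> and
  \<open>\<langle>(k - T) w, w\<rangle>\<close> is \<open>2 k (k\<^sup>2 \<parallel>\<xi>\<parallel>\<^sup>2 - \<parallel>T \<xi>\<parallel>\<^sup>2)\<close>.\<close>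

lemma norm_le_numerical_radius:
  fixes T :: "'i op"
  assumes T: "\<And>x y. inner (T x) y = inner x (T y)" and k: "0 < k"
    and bound: "\<And>x. \<bar>inner x (T x)\<bar> \<le> k * (norm x)\<^sup>2"
  shows "norm (T x) \<le> k * norm x"
proof -
  let ?u = "k *\<^sub>R x - T x" and ?w = "k *\<^sub>R x + T x"
  have "0 \<le> k * inner ?u ?u + inner ?u (T ?u)" "0 \<le> k * inner ?w ?w - inner ?w (T ?w)"
    using bound[of ?u] bound[of ?w] by (auto simp: power2_norm_eq_inner abs_le_iff)
  then have "0 \<le> (k * inner ?u ?u + inner ?u (T ?u)) + (k * inner ?w ?w - inner ?w (T ?w))" by simp
  also have "\<dots> = 2 * k * (k\<^sup>2 * inner x x - inner (T x) (T x))"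
  proof -
    have c: "inner x (T (T x)) = inner (T x) (T x)" "inner (T x) x = inner x (T x)"
      using T[of x "T x"] inner_commute by auto
    show ?thesis
      by (simp only: inner_simps blinfun_lin c) (simp add: algebra_simps power2_eq_square)
  qed
  finally have "0 \<le> k\<^sup>2 * inner x x - inner (T x) (T x)"
    using k by (simp add: zero_le_mult_iff)
  then have "(norm (T x))\<^sup>2 \<le> (k * norm x)\<^sup>2"
    by (simp add: power2_norm_eq_inner power_mult_distrib)
  then show ?thesis using k by (auto intro: power2_le_imp_le)
qed

lemma projections_bounded: "von_neumann_algebra M \<Longrightarrow> q \<in> projections M \<Longrightarrow> q \<in> bounded_ops"
  by (auto simp: projections_def vN_bounded)

lemma Pythagoras_projection:
  assumes "E \<in> bounded_ops" "E\<^sup>\<dagger> = E" "E o\<^sub>L E = E"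
  shows "(norm x)\<^sup>2 = (norm (blinfun_apply E x))\<^sup>2 + (norm (x - blinfun_apply E x))\<^sup>2"
proof -
  have "inner (E x) (E x) = inner x (E x)"
    using inner_adj_left[OF assms(1), of x "E x"] assms(2) projection_apply[OF assms(3), of x] by simp
  then show ?thesis
    unfolding power2_norm_eq_inner by (simp only: inner_simps) (simp add: inner_commute)
qed

lemma vN_bicommutant_of_hermitian:
  assumes "x \<in> bounded_ops" "x\<^sup>\<dagger> = x"
  shows "von_neumann_algebra (commutant (commutant {x}))" "x \<in> commutant (commutant {x})"
    "commutant (commutant {x}) \<subseteq> commutant {x}"
proof -
  show "von_neumann_algebra (commutant (commutant {x}))"
    by (rule commutant_von_neumann[OF commutant_bounded], rule commutant_adj) (use assms in auto)
  show "x \<in> commutant (commutant {x})" using assms by (auto simp: commutant_def)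
  show "commutant (commutant {x}) \<subseteq> commutant {x}"
    by (rule commutant_antimono) (use assms in \<open>auto simp: commutant_def\<close>)
qed

text \<open>Suppose that \<open>a \<le> x \<le> b\<close> on the range of a spectral projection \<open>q\<close>.  Then \<open>x\<close> is within \<open>(b - a)/2\<close> of a
  scalar there, so the commutator \<open>x T - T x\<close> has norm at most \<open>(b - a) \<parallel>T\<parallel>\<close> on that range.  Cutting
  \<open>q\<close> by the spectral projection at the midpoint splits the commutator into two orthogonal blocks, each of which
  satisfies the bound for an interval of half the length, so \<open>n\<close> cuts improve the bound by a factor \<open>2\<^sup>n\<close>.\<close>

lemma commutator_bound_on_spectral_projection:
  fixes x T :: "'i op"
  assumes x: "x \<in> bounded_ops" "x\<^sup>\<dagger> = x"
    and T: "\<And>q. q \<in> projections (commutant (commutant {x})) \<Longrightarrow> T o\<^sub>L q = q o\<^sub>L T"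
    and q: "q \<in> projections (commutant (commutant {x}))"
    and ab: "a < b" "\<And>\<xi>. a * (norm (q \<xi>))\<^sup>2 \<le> inner (q \<xi>) (x (q \<xi>))"
      "\<And>\<xi>. inner (q \<xi>) (x (q \<xi>)) \<le> b * (norm (q \<xi>))\<^sup>2"
  shows "norm (x (T (q \<xi>)) - T (x (q \<xi>))) \<le> (b - a) * norm T / 2 ^ n * norm (q \<xi>)"
  using q ab
proof (induction n arbitrary: q a b \<xi>)
  case (0 q a b \<xi>)
  note C = vN_bicommutant_of_hermitian[OF x]
  have qb: "q \<in> bounded_ops" "q\<^sup>\<dagger> = q" "q o\<^sub>L q = q"
    using 0(1) projections_bounded[OF C(1)] by (auto simp: projections_def)
  have qq: "q (q \<eta>) = q \<eta>" for \<eta> using qb(3) by (rule projection_apply)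
  have qx: "q (x \<eta>) = x (q \<eta>)" for \<eta>
  proof -
    have "q \<in> commutant {x}" using 0(1) C(3) by (auto simp: projections_def)
    then show ?thesis using commutantD[of q "{x}" x] by (metis blinfun_apply_blinfun_compose insertI1)
  qed
  have qT: "T (q \<eta>) = q (T \<eta>)" for \<eta>
    using T[OF 0(1)] by (metis blinfun_apply_blinfun_compose)
  have qi: "inner (q u) v = inner u (q v)" for u v using inner_adj_left[OF qb(1), of u v] qb(2) by simp
  have xi: "inner (x u) v = inner u (x v)" for u v using inner_adj_left[OF x(1), of u v] x(2) by simp
  define c r where "c = (a + b) / 2" and "r = (b - a) / 2"
  have r: "r > 0" using 0(2) by (simp add: r_def)
  define S where "S = (x o\<^sub>L q) - c *\<^sub>R q"
  have S: "S \<eta> = x (q \<eta>) - c *\<^sub>R q \<eta>" for \<eta>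
    unfolding S_def by (simp add: blinfun_lin)
  have "norm (S \<eta>) \<le> r * norm \<eta>" for \<eta>
  proof (rule norm_le_numerical_radius[OF _ r])
    show "inner (S u) v = inner u (S v)" for u v
      by (simp add: S inner_diff_left inner_diff_right xi qi qx)
    fix u
    have "inner u (S u) = inner (q u) (x (q u)) - c * (norm (q u))\<^sup>2"
      using qi[of u "x (q u)"] qi[of u "q u"] by (simp add: S inner_diff_right qx qq power2_norm_eq_inner)
    moreover have "r * (norm (q u))\<^sup>2 \<le> r * (norm u)\<^sup>2"
      using Pythagoras_projection[OF qb, of u] r by (intro mult_left_mono) auto
    ultimately show "\<bar>inner u (S u)\<bar> \<le> r * (norm u)\<^sup>2"
      using 0(3)[of u] 0(4)[of u] by (simp add: abs_le_iff c_def r_def field_simps)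
  qed
  note Sn = this
  have "x (T (q \<xi>)) - T (x (q \<xi>)) = S (T (q \<xi>)) - T (S (q \<xi>))"
    by (simp add: S qT qq blinfun_lin flip: qx)
  then have "norm (x (T (q \<xi>)) - T (x (q \<xi>))) \<le> norm (S (T (q \<xi>))) + norm (T (S (q \<xi>)))"
    by (simp add: norm_triangle_ineq4)
  also have "\<dots> \<le> r * (norm T * norm (q \<xi>)) + norm T * (r * norm (q \<xi>))"
    using r by (intro add_mono order_trans[OF Sn] order_trans[OF norm_blinfun[of T]] mult_left_mono norm_blinfun Sn) auto
  also have "\<dots> = (b - a) * norm T / 2 ^ 0 * norm (q \<xi>)" by (simp add: r_def field_simps)
  finally show ?case .
next
  case (Suc n q a b \<xi>)
  note C = vN_bicommutant_of_hermitian[OF x]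
  let ?C = "commutant (commutant {x})"
  have qb: "q \<in> bounded_ops" "q\<^sup>\<dagger> = q" "q o\<^sub>L q = q" and qC: "q \<in> ?C"
    using Suc.prems(1) projections_bounded[OF C(1)] by (auto simp: projections_def)
  define c where "c = (a + b) / 2"
  define y where "y = x - c *\<^sub>R id_blinfun"
  have yb: "y \<in> bounded_ops" "y\<^sup>\<dagger> = y" using x by (simp_all add: y_def)
  have yap: "y \<eta> = x \<eta> - c *\<^sub>R \<eta>" for \<eta> by (simp add: y_def blinfun_lin)
  obtain E where E: "E \<in> projections (commutant (commutant {y}))"
    "\<And>x. 0 \<le> inner (blinfun_apply E x) (y (E x))" "\<And>x. inner (x - E x) (y (x - E x)) \<le> 0"
    using exists_positive_spectral_projection[OF yb] by metis
  have "commutant {x} \<subseteq> commutant {y}"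
  proof
    fix U assume U: "U \<in> commutant {x}"
    then have "U (x \<eta>) = x (U \<eta>)" for \<eta>
      using commutantD[OF U, of x] by (metis blinfun_apply_blinfun_compose insertI1)
    then have "U o\<^sub>L y = y o\<^sub>L U" by (intro blinfun_eqI) (simp add: yap blinfun_lin)
    then show "U \<in> commutant {y}" using U by (simp add: commutant_def)
  qed
  then have EC: "E \<in> ?C"
    using E(1) commutant_antimono by (auto simp: projections_def)
  have Eb: "E \<in> bounded_ops" "E\<^sup>\<dagger> = E" "E o\<^sub>L E = E" and EP: "E \<in> projections ?C"
    using E(1) EC commutant_bounded by (auto simp: projections_def)
  have Eq: "E o\<^sub>L q = q o\<^sub>L E"
    using commutantD[of q "commutant {x}" E] qC EC C(3) by auto
  have Eqa: "E (q \<eta>) = q (E \<eta>)" for \<eta> using Eq by (metis blinfun_apply_blinfun_compose)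
  have Ex: "E (x \<eta>) = x (E \<eta>)" for \<eta>
    using commutantD[of E "{x}" x] EC C(3) by (metis blinfun_apply_blinfun_compose insertI1 subsetD)
  have ET: "T (E \<eta>) = E (T \<eta>)" for \<eta> using T[OF EP] by (metis blinfun_apply_blinfun_compose)
  have EE: "E (E \<eta>) = E \<eta>" and qq: "q (q \<eta>) = q \<eta>" for \<eta>
    using projection_apply[OF Eb(3)] projection_apply[OF qb(3)] by auto
  define q1 q2 where "q1 = q o\<^sub>L E" and "q2 = q - (q o\<^sub>L E)"
  have q1: "q1 \<eta> = E (q \<eta>)" and q2: "q2 \<eta> = q \<eta> - E (q \<eta>)" for \<eta>
    by (simp_all add: q1_def q2_def Eqa blinfun_lin)
  have q1C: "q1 \<in> projections ?C"
    using vN_compose[OF C(1) qC EC] qb Eb Eq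
    by (auto simp: projections_def q1_def intro!: blinfun_eqI) (simp add: Eqa EE qq)
  have q2C: "q2 \<in> projections ?C"
    using vN_diff[OF C(1) qC vN_compose[OF C(1) qC EC]] qb Eb Eq
    by (auto simp: projections_def q2_def intro!: blinfun_eqI) (simp add: Eqa EE qq blinfun_lin)
  define K where "K = (b - a) / 2 * norm T / 2 ^ n"
  have D1: "norm (x (T (q1 \<xi>)) - T (x (q1 \<xi>))) \<le> K * norm (q1 \<xi>)"
  proof -
    have "norm (x (T (q1 \<xi>)) - T (x (q1 \<xi>))) \<le> (b - c) * norm T / 2 ^ n * norm (q1 \<xi>)"
    proof (rule Suc.IH[OF q1C])
      show "c * (norm (q1 \<eta>))\<^sup>2 \<le> inner (q1 \<eta>) (x (q1 \<eta>))" for \<eta>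
        using E(2)[of "q \<eta>"] by (simp add: q1 yap inner_diff_right power2_norm_eq_inner)
      show "inner (q1 \<eta>) (x (q1 \<eta>)) \<le> b * (norm (q1 \<eta>))\<^sup>2" for \<eta>
        using Suc.prems(4)[of "E \<eta>"] by (simp add: q1 Eqa)
    qed (use Suc.prems(2) in \<open>simp add: c_def\<close>)
    then show ?thesis by (simp add: K_def c_def field_simps)
  qed
  have D2: "norm (x (T (q2 \<xi>)) - T (x (q2 \<xi>))) \<le> K * norm (q2 \<xi>)"
  proof -
    have "norm (x (T (q2 \<xi>)) - T (x (q2 \<xi>))) \<le> (c - a) * norm T / 2 ^ n * norm (q2 \<xi>)"
    proof (rule Suc.IH[OF q2C])
      show "inner (q2 \<eta>) (x (q2 \<eta>)) \<le> c * (norm (q2 \<eta>))\<^sup>2" for \<eta>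
        using E(3)[of "q \<eta>"] unfolding q2[symmetric] by (simp add: yap inner_diff_right power2_norm_eq_inner)
      show "a * (norm (q2 \<eta>))\<^sup>2 \<le> inner (q2 \<eta>) (x (q2 \<eta>))" for \<eta>
        using Suc.prems(3)[of "\<eta> - E \<eta>"] by (simp add: q2 Eqa blinfun_lin)
    qed (use Suc.prems(2) in \<open>simp add: c_def\<close>)
    then show ?thesis by (simp add: K_def c_def field_simps)
  qed
  let ?d = "x (T (q \<xi>)) - T (x (q \<xi>))"
  have d1: "x (T (q1 \<xi>)) - T (x (q1 \<xi>)) = E ?d" and d2: "x (T (q2 \<xi>)) - T (x (q2 \<xi>)) = ?d - E ?d"
    by (simp_all add: q1 q2 blinfun_lin ET Ex flip: Ex)
  have "(norm ?d)\<^sup>2 = (norm (E ?d))\<^sup>2 + (norm (?d - E ?d))\<^sup>2"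
    by (rule Pythagoras_projection[OF Eb])
  also have "\<dots> \<le> (K * norm (q1 \<xi>))\<^sup>2 + (K * norm (q2 \<xi>))\<^sup>2"
    using D1 D2 unfolding d1 d2 by (intro add_mono power_mono) auto
  also have "\<dots> = (K * norm (q \<xi>))\<^sup>2"
    using Pythagoras_projection[OF Eb, of "q \<xi>"] unfolding q1 q2
    by (simp add: power_mult_distrib flip: distrib_left)
  finally have "norm ?d \<le> K * norm (q \<xi>)"
    by (rule power2_le_imp_le) (use Suc.prems(2) in \<open>simp add: K_def\<close>)
  then show ?case by (simp add: K_def field_simps)
qed

lemma commute_if_commute_spectral_projections:
  fixes x T :: "'i op"
  assumes x: "x \<in> bounded_ops" "x\<^sup>\<dagger> = x"
    and T: "\<And>q. q \<in> projections (commutant (commutant {x})) \<Longrightarrow> T o\<^sub>L q = q o\<^sub>L T"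
  shows "T o\<^sub>L x = x o\<^sub>L T"
proof (rule blinfun_eqI)
  fix \<xi>
  define k where "k = norm x + 1"
  have id: "id_blinfun \<in> projections (commutant (commutant {x}))"
    using vN_id[OF vN_bicommutant_of_hermitian(1)[OF x]] by (auto simp: projections_def intro: blinfun_eqI)
  have numr: "\<bar>inner u (x u)\<bar> \<le> k * (norm u)\<^sup>2" for u
  proof -
    have "\<bar>inner u (x u)\<bar> \<le> norm u * norm (x u)" by (rule Cauchy_Schwarz_ineq2)
    also have "\<dots> \<le> norm u * (norm x * norm u)" by (intro mult_left_mono norm_blinfun) simp
    also have "\<dots> \<le> k * (norm u)\<^sup>2" by (simp add: k_def algebra_simps power2_eq_square)
    finally show ?thesis .
  qed
  have "norm (x (T \<xi>) - T (x \<xi>)) \<le> (k - (-k)) * norm T / 2 ^ n * norm \<xi>" for n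
  proof -
    have "- k < k" using norm_ge_zero[of x] unfolding k_def by linarith
    then show ?thesis
      using commutator_bound_on_spectral_projection[OF x T id, of "-k" k \<xi> n] numr
      by (simp add: abs_le_iff minus_le_iff)
  qed
  moreover have "(\<lambda>n. (k - (-k)) * norm T / 2 ^ n * norm \<xi>) \<longlonglongrightarrow> 0"
    by real_asymp
  ultimately have "norm (x (T \<xi>) - T (x \<xi>)) \<le> 0"
    by (intro LIMSEQ_le_const) auto
  then show "(T o\<^sub>L x) \<xi> = (x o\<^sub>L T) \<xi>" by simp
qed

text \<open>The real and imaginary parts of an element of \<open>M\<close> have their spectral projections in \<open>M\<close>,
  and commuting with those implies commuting with the hermitian operator itself.\<close>

lemma commutant_projections:
  fixes M :: "'i op set"
  assumes M: "von_neumann_algebra M" and T: "T \<in> bounded_ops"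
    and comm: "\<And>q. q \<in> projections M \<Longrightarrow> T o\<^sub>L q = q o\<^sub>L T"
  shows "T \<in> commutant M"
proof -
  have herm: "T (h \<xi>) = h (T \<xi>)" if h: "h \<in> M" "h\<^sup>\<dagger> = h" for h \<xi>
  proof -
    have "commutant (commutant {h}) \<subseteq> M"
      using commutant_antimono[OF commutant_antimono[of "{h}" M]] h vN_bicommutant[OF M] by simp
    then have "projections (commutant (commutant {h})) \<subseteq> projections M"
      by (auto simp: projections_def)
    then have "T o\<^sub>L h = h o\<^sub>L T"
      using commute_if_commute_spectral_projections[OF vN_bounded[OF M h(1)] h(2)] comm by blast
    then show ?thesis by (metis blinfun_apply_blinfun_compose)
  qed
  have "T o\<^sub>L z = z o\<^sub>L T" if z: "z \<in> M" for z
  proof (rule blinfun_eqI)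
    fix \<xi>
    have zb: "z \<in> bounded_ops" using vN_bounded[OF M z] .
    have "(\<i> *\<^sub>O (z - z\<^sup>\<dagger>))\<^sup>\<dagger> = \<i> *\<^sub>O (z - z\<^sup>\<dagger>)"
      using zb by (auto intro!: blinfun_eqI simp: blinfun_lin scaleC_diff_right)
    then have im: "T ((\<i> *\<^sub>O (z - z\<^sup>\<dagger>)) \<xi>) = (\<i> *\<^sub>O (z - z\<^sup>\<dagger>)) (T \<xi>)"
      by (intro herm vN_scale vN_diff vN_adj M z)
    have re: "T ((z + z\<^sup>\<dagger>) \<xi>) = (z + z\<^sup>\<dagger>) (T \<xi>)"
      by (intro herm vN_add vN_adj M z) (use zb in \<open>simp add: add.commute\<close>)
    have "\<i> *\<^sub>C (T (z \<xi> - z\<^sup>\<dagger> \<xi>)) = \<i> *\<^sub>C (z (T \<xi>) - z\<^sup>\<dagger> (T \<xi>))"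
      using im by (simp add: blinfun_lin bounded_opsD[OF T])
    then have "(-\<i>) *\<^sub>C \<i> *\<^sub>C (T (z \<xi> - z\<^sup>\<dagger> \<xi>)) = (-\<i>) *\<^sub>C \<i> *\<^sub>C (z (T \<xi>) - z\<^sup>\<dagger> (T \<xi>))" by simp
    then have "T (z \<xi>) - T (z\<^sup>\<dagger> \<xi>) = z (T \<xi>) - z\<^sup>\<dagger> (T \<xi>)"
      by (simp only: scaleC_scaleC) (simp add: blinfun_lin)
    moreover have "T (z \<xi>) + T (z\<^sup>\<dagger> \<xi>) = z (T \<xi>) + z\<^sup>\<dagger> (T \<xi>)"
      using re by (simp add: blinfun_lin)
    ultimately have "(T (z \<xi>) + T (z\<^sup>\<dagger> \<xi>)) + (T (z \<xi>) - T (z\<^sup>\<dagger> \<xi>))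
        = (z (T \<xi>) + z\<^sup>\<dagger> (T \<xi>)) + (z (T \<xi>) - z\<^sup>\<dagger> (T \<xi>))" by (simp only:)
    then have "2 *\<^sub>R T (z \<xi>) = 2 *\<^sub>R z (T \<xi>)" by (simp add: scaleR_2)
    then show "(T o\<^sub>L z) \<xi> = (z o\<^sub>L T) \<xi>" by simp
  qed
  then show ?thesis using T by (simp add: commutant_def)
qed

section \<open>Partial isometries normalising an abelian algebra\<close>

text \<open>The unitary \<open>u = w + w\<^sup>* + (1 - w\<^sup>* w - w w\<^sup>*)\<close> exchanges the orthogonal projections \<open>w\<^sup>* w\<close> and \<open>w w\<^sup>*\<close> and is
  the identity on the orthogonal complement of both.  For \<open>x \<in> P\<close> the mixed terms such as \<open>w x w\<close> vanish, so that
  \<open>u x u = w x w\<^sup>* + w\<^sup>* x w + (1 - w\<^sup>* w - w w\<^sup>*) x\<close> stays in \<open>P\<close>.\<close>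

lemma exists_normalising_unitary:
  fixes M P :: "'i op set"
  assumes M: "von_neumann_algebra M" and P: "von_neumann_algebra P" "P \<subseteq> M" "commutative_ops P"
    and w: "w \<in> M" "w o\<^sub>L w\<^sup>\<dagger> o\<^sub>L w = w"
    and inv: "\<And>x. x \<in> P \<Longrightarrow> w o\<^sub>L x o\<^sub>L w\<^sup>\<dagger> \<in> P" "\<And>x. x \<in> P \<Longrightarrow> w\<^sup>\<dagger> o\<^sub>L x o\<^sub>L w \<in> P"
    and orth: "(w\<^sup>\<dagger> o\<^sub>L w) o\<^sub>L (w o\<^sub>L w\<^sup>\<dagger>) = 0"
  obtains u where "u \<in> normaliser M P" "(w o\<^sub>L w\<^sup>\<dagger>) o\<^sub>L u o\<^sub>L (w\<^sup>\<dagger> o\<^sub>L w) = w"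
proof -
  have wb: "w \<in> bounded_ops" using vN_bounded[OF M w(1)] .
  have eP: "w\<^sup>\<dagger> o\<^sub>L w \<in> P" and fP: "w o\<^sub>L w\<^sup>\<dagger> \<in> P"
    using inv[OF vN_id[OF P(1)]] by (simp_all add: id_blinfun.rep_eq blinfun_eqI[of "w o\<^sub>L id_blinfun" w]
        blinfun_eqI[of "w\<^sup>\<dagger> o\<^sub>L id_blinfun" "w\<^sup>\<dagger>"])
  have 1: "w (w\<^sup>\<dagger> (w \<xi>)) = w \<xi>" for \<xi> using w(2) by (metis blinfun_apply_blinfun_compose)
  have "(w o\<^sub>L w\<^sup>\<dagger> o\<^sub>L w)\<^sup>\<dagger> = w\<^sup>\<dagger>" using w(2) by simp
  then have 2: "w\<^sup>\<dagger> (w (w\<^sup>\<dagger> \<xi>)) = w\<^sup>\<dagger> \<xi>" for \<xi>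
    using wb by simp (metis blinfun_apply_blinfun_compose)
  have ef: "w\<^sup>\<dagger> (w (w (w\<^sup>\<dagger> \<xi>))) = 0" for \<xi>
    using arg_cong[OF orth, of "\<lambda>z. blinfun_apply z \<xi>"] by simp
  have 3: "w (w \<xi>) = 0" for \<xi>
    using 1[of "w \<xi>"] ef[of "w \<xi>"] by (metis 1 blinfun.zero_right)
  have "w o\<^sub>L w = 0" by (rule blinfun_eqI) (simp add: 3)
  then have "(w o\<^sub>L w)\<^sup>\<dagger> = 0" by simp
  then have 4: "w\<^sup>\<dagger> (w\<^sup>\<dagger> \<xi>) = 0" for \<xi>
    using wb by simp (metis blinfun_apply_blinfun_compose blinfun.zero_left)
  define u where "u = w + w\<^sup>\<dagger> + (id_blinfun - (w\<^sup>\<dagger> o\<^sub>L w) - (w o\<^sub>L w\<^sup>\<dagger>))"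
  have u: "u \<xi> = w \<xi> + w\<^sup>\<dagger> \<xi> + (\<xi> - w\<^sup>\<dagger> (w \<xi>) - w (w\<^sup>\<dagger> \<xi>))" for \<xi>
    by (simp add: u_def blinfun_lin)
  have uadj: "u\<^sup>\<dagger> = u" using wb by (simp add: u_def add.commute)
  have uu: "u (u \<xi>) = \<xi>" for \<xi>
    by (simp add: u blinfun_lin 1 2 3 4)
  have uM: "u \<in> M"
    unfolding u_def using M P eP fP w by (intro vN_add vN_diff vN_adj vN_id) auto
  have uxu: "u o\<^sub>L x o\<^sub>L u \<in> P" if x: "x \<in> P" for x
  proof -
    have "x o\<^sub>L (w\<^sup>\<dagger> o\<^sub>L w) = (w\<^sup>\<dagger> o\<^sub>L w) o\<^sub>L x" "x o\<^sub>L (w o\<^sub>L w\<^sup>\<dagger>) = (w o\<^sub>L w\<^sup>\<dagger>) o\<^sub>L x"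
      using P(3) x eP fP unfolding commutative_ops_def by blast+
    then have xe: "x (w\<^sup>\<dagger> (w \<xi>)) = w\<^sup>\<dagger> (w (x \<xi>))" and xf: "x (w (w\<^sup>\<dagger> \<xi>)) = w (w\<^sup>\<dagger> (x \<xi>))" for \<xi>
      by (metis blinfun_apply_blinfun_compose)+
    have fx: "w (w\<^sup>\<dagger> (x (w \<xi>))) = x (w \<xi>)" for \<xi> by (simp only: xf[symmetric] 1)
    have ex: "w\<^sup>\<dagger> (w (x (w\<^sup>\<dagger> \<xi>))) = x (w\<^sup>\<dagger> \<xi>)" for \<xi> by (simp only: xe[symmetric] 2)
    have wxw: "w (x (w \<xi>)) = 0" and wxw': "w\<^sup>\<dagger> (x (w\<^sup>\<dagger> \<xi>)) = 0" for \<xi>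
      using 3[of "w\<^sup>\<dagger> (x (w \<xi>))"] 4[of "w (x (w\<^sup>\<dagger> \<xi>))"] by (simp_all add: fx ex)
    have "u o\<^sub>L x o\<^sub>L u = (w o\<^sub>L x o\<^sub>L w\<^sup>\<dagger>) + (w\<^sup>\<dagger> o\<^sub>L x o\<^sub>L w)
        + (x - ((w\<^sup>\<dagger> o\<^sub>L w) o\<^sub>L x) - ((w o\<^sub>L w\<^sup>\<dagger>) o\<^sub>L x))"
      by (rule blinfun_eqI) (simp add: u blinfun_lin 1 2 3 4 xe xf fx ex wxw wxw')
    then show ?thesis
      using vN_add[OF P(1) vN_add[OF P(1) inv[OF x]]
        vN_diff[OF P(1) vN_diff[OF P(1) x vN_compose[OF P(1) eP x]] vN_compose[OF P(1) fP x]]]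
      by (simp only:)
  qed
  have "(\<lambda>x. u o\<^sub>L x o\<^sub>L u) ` P = P"
  proof
    show "P \<subseteq> (\<lambda>x. u o\<^sub>L x o\<^sub>L u) ` P"
    proof
      fix x assume x: "x \<in> P"
      have "x = u o\<^sub>L (u o\<^sub>L x o\<^sub>L u) o\<^sub>L u" by (rule blinfun_eqI) (simp add: uu)
      then show "x \<in> (\<lambda>x. u o\<^sub>L x o\<^sub>L u) ` P" using uxu[OF x] by (rule image_eqI)
    qed
  qed (use uxu in auto)
  moreover have "unitary u" by (auto simp: unitary_def uadj uu intro: blinfun_eqI)
  ultimately have "u \<in> normaliser M P" using uM by (simp add: normaliser_def uadj)
  moreover have "(w o\<^sub>L w\<^sup>\<dagger>) o\<^sub>L u o\<^sub>L (w\<^sup>\<dagger> o\<^sub>L w) = w"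
    by (rule blinfun_eqI) (simp add: u blinfun_lin 1 2 3 4)
  ultimately show ?thesis by (rule that)
qed

section \<open>Singular maximal abelian subalgebras\<close>

text \<open>Otherwise the unitary that exchanges \<open>e\<close> with the orthogonal projection \<open>v e v\<^sup>*\<close> normalises \<open>P\<close>.  By singularity
  it lies in \<open>P\<close> and commutes with \<open>e\<close>, which is absurd unless \<open>e = 0\<close>.\<close>

lemma singular_masa_no_displaced_projection:
  fixes M P :: "'i op set"
  assumes M: "von_neumann_algebra M" and P: "singular_masa M P"
    and v: "v \<in> M"
    and inv: "\<And>x. x \<in> P \<Longrightarrow> v o\<^sub>L x o\<^sub>L v\<^sup>\<dagger> \<in> P" "\<And>x. x \<in> P \<Longrightarrow> v\<^sup>\<dagger> o\<^sub>L x o\<^sub>L v \<in> P"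
    and e: "e \<in> projections P" "\<And>\<xi>. v\<^sup>\<dagger> (v (e \<xi>)) = blinfun_apply e \<xi>"
    and orth: "\<And>\<xi>. e (v (e (v\<^sup>\<dagger> \<xi>))) = 0"
  shows "e = 0"
proof -
  have mP: "masa M P" and nP: "normaliser_algebra M P = P" using P by (auto simp: singular_masa_def)
  then have vP: "von_neumann_algebra P" and PM: "P \<subseteq> M" and cP: "commutative_ops P" by (auto simp: masa_def)
  have eP: "e \<in> P" "e\<^sup>\<dagger> = e" "e o\<^sub>L e = e" using e by (auto simp: projections_def)
  have vb: "v \<in> bounded_ops" using vN_bounded[OF M v] .
  have eb: "e \<in> bounded_ops" using vN_bounded[OF vP eP(1)] .
  have ee: "e (e \<xi>) = e \<xi>" for \<xi> by (rule projection_apply[OF eP(3)])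
  define w where "w = v o\<^sub>L e"
  have wadj: "w\<^sup>\<dagger> = e o\<^sub>L v\<^sup>\<dagger>" using vb eb eP by (simp add: w_def)
  have wMem: "w \<in> M" unfolding w_def using M v PM eP by (intro vN_compose) auto
  have ww: "w\<^sup>\<dagger> o\<^sub>L w = e" by (rule blinfun_eqI) (simp add: wadj, simp add: w_def e(2) ee)
  have www: "w o\<^sub>L w\<^sup>\<dagger> o\<^sub>L w = w"
    unfolding op_compose_assoc ww by (rule blinfun_eqI) (simp add: w_def ee)
  have inv1: "w o\<^sub>L x o\<^sub>L w\<^sup>\<dagger> \<in> P" if "x \<in> P" for x
    using inv(1)[OF vN_compose[OF vP vN_compose[OF vP eP(1) that] eP(1)]]
    by (simp add: w_def wadj[unfolded w_def] op_compose_assoc)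
  have inv2: "w\<^sup>\<dagger> o\<^sub>L x o\<^sub>L w \<in> P" if "x \<in> P" for x
    using vN_compose[OF vP vN_compose[OF vP eP(1) inv(2)[OF that]] eP(1)]
    by (simp add: w_def wadj[unfolded w_def] op_compose_assoc)
  have ef: "(w\<^sup>\<dagger> o\<^sub>L w) o\<^sub>L (w o\<^sub>L w\<^sup>\<dagger>) = 0"
    unfolding ww by (rule blinfun_eqI) (simp add: wadj, simp add: w_def ee orth)
  obtain u where u: "u \<in> normaliser M P" "(w o\<^sub>L w\<^sup>\<dagger>) o\<^sub>L u o\<^sub>L (w\<^sup>\<dagger> o\<^sub>L w) = w"
    using exists_normalising_unitary[OF M vP PM cP wMem www inv1 inv2 ef] by blast
  have "u \<in> P" using u(1) nP vN_generated_subset unfolding normaliser_algebra_def by blast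
  then have ue: "u o\<^sub>L e = e o\<^sub>L u" using cP eP(1) unfolding commutative_ops_def by blast
  have "w o\<^sub>L id_blinfun = w" by (rule blinfun_eqI) simp
  then have "w o\<^sub>L w\<^sup>\<dagger> \<in> P" using inv1[OF vN_id[OF vP]] by simp
  then have "(w o\<^sub>L w\<^sup>\<dagger>) o\<^sub>L e = e o\<^sub>L (w o\<^sub>L w\<^sup>\<dagger>)"
    using cP eP(1) unfolding commutative_ops_def by blast
  then have "(w o\<^sub>L w\<^sup>\<dagger>) o\<^sub>L e = 0" using ef by (simp add: ww)
  then have "w = 0"
    using u(2) unfolding ww op_compose_assoc ue by (simp flip: op_compose_assoc)
  then show "e = 0" using ww by simp
qed

text \<open>Put \<open>t = v q v\<^sup>*\<close>.  The part \<open>e = q (1 - t)\<close> of \<open>q\<close> outside \<open>t\<close> has its image \<open>v e v\<^sup>*\<close> below \<open>t\<close>, hence orthogonal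
  to \<open>e\<close>; so \<open>e\<close> is displaced and must vanish.\<close>

lemma singular_masa_projection_below_image:
  fixes M P :: "'i op set"
  assumes M: "von_neumann_algebra M" and P: "singular_masa M P"
    and v: "v \<in> M"
    and inv: "\<And>x. x \<in> P \<Longrightarrow> v o\<^sub>L x o\<^sub>L v\<^sup>\<dagger> \<in> P" "\<And>x. x \<in> P \<Longrightarrow> v\<^sup>\<dagger> o\<^sub>L x o\<^sub>L v \<in> P"
    and q: "q \<in> projections P" "\<And>\<xi>. v\<^sup>\<dagger> (v (q \<xi>)) = blinfun_apply q \<xi>"
  shows "q (v (q (v\<^sup>\<dagger> \<xi>))) = q \<xi>"
proof -
  have "masa M P" using P by (auto simp: singular_masa_def)
  then have vP: "von_neumann_algebra P" and cP: "commutative_ops P" by (auto simp: masa_def)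
  have vb: "v \<in> bounded_ops" using vN_bounded[OF M v] .
  have qP: "q \<in> P" "q\<^sup>\<dagger> = q" "q o\<^sub>L q = q" using q by (auto simp: projections_def)
  have qb: "q \<in> bounded_ops" using vN_bounded[OF vP qP(1)] .
  have qq: "q (q \<xi>) = q \<xi>" for \<xi> by (rule projection_apply[OF qP(3)])
  define t where "t = v o\<^sub>L q o\<^sub>L v\<^sup>\<dagger>"
  have tP: "t \<in> P" unfolding t_def by (rule inv(1)[OF qP(1)])
  have tb: "t \<in> bounded_ops" using vN_bounded[OF vP tP] .
  have tadj: "t\<^sup>\<dagger> = t" using vb qb qP by (simp add: t_def op_compose_assoc)
  have tv: "t (v (q \<xi>)) = v (q \<xi>)" for \<xi> by (simp add: t_def q(2) qq)
  have tt: "t (t \<xi>) = t \<xi>" for \<xi> using tv[of "v\<^sup>\<dagger> \<xi>"] by (simp add: t_def)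
  have qt: "q o\<^sub>L t = t o\<^sub>L q" using cP qP(1) tP unfolding commutative_ops_def by blast
  then have qta: "t (q \<xi>) = q (t \<xi>)" for \<xi> by (metis blinfun_apply_blinfun_compose)
  define e where "e = q - (q o\<^sub>L t)"
  have ea: "e \<xi> = q \<xi> - q (t \<xi>)" for \<xi> by (simp add: e_def blinfun_lin)
  have "e = 0"
  proof (rule singular_masa_no_displaced_projection[OF M P v inv])
    show "e \<in> projections P"
      using vN_diff[OF vP qP(1) vN_compose[OF vP qP(1) tP]] qb tb qP(2) tadj qt
      by (auto simp: projections_def e_def intro!: blinfun_eqI) (simp add: blinfun_lin qta qq tt)
    show "v\<^sup>\<dagger> (v (e \<xi>)) = e \<xi>" for \<xi>
      using q(2) by (simp add: ea blinfun_lin)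
    show "e (v (e (v\<^sup>\<dagger> \<xi>))) = 0" for \<xi>
      by (simp add: ea blinfun_lin tv)
  qed
  then have "q \<xi> = q (t \<xi>)" using ea[of \<xi>] by simp
  then show ?thesis by (simp add: t_def)
qed

text \<open>Comparing projections with their images under \<open>v\<close> and under \<open>v\<^sup>*\<close> shows first that \<open>v\<^sup>* v = v v\<^sup>*\<close>, and then that
  \<open>v q v\<^sup>* = q\<close> for every projection \<open>q \<in> P\<close> below \<open>v\<^sup>* v\<close>.  Therefore \<open>v\<close> commutes with all projections of \<open>P\<close>,
  hence with \<open>P\<close>, and maximality of \<open>P\<close> applies.\<close>

lemma singular_masa_contains_partial_normaliser:
  fixes M P :: "'i op set"
  assumes M: "von_neumann_algebra M" and P: "singular_masa M P"
    and v: "v \<in> M" "v o\<^sub>L v\<^sup>\<dagger> o\<^sub>L v = v"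
    and inv: "\<And>x. x \<in> P \<Longrightarrow> v o\<^sub>L x o\<^sub>L v\<^sup>\<dagger> \<in> P" "\<And>x. x \<in> P \<Longrightarrow> v\<^sup>\<dagger> o\<^sub>L x o\<^sub>L v \<in> P"
  shows "v \<in> P"
proof -
  have mP: "masa M P" using P by (auto simp: singular_masa_def)
  then have vP: "von_neumann_algebra P" and cP: "commutative_ops P" by (auto simp: masa_def)
  have vb: "v \<in> bounded_ops" using vN_bounded[OF M v(1)] .
  have idP: "v o\<^sub>L id_blinfun = v" "v\<^sup>\<dagger> o\<^sub>L id_blinfun = v\<^sup>\<dagger>" by (auto intro: blinfun_eqI)
  have eP: "v\<^sup>\<dagger> o\<^sub>L v \<in> P" and fP: "v o\<^sub>L v\<^sup>\<dagger> \<in> P"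
    using inv[OF vN_id[OF vP]] by (simp_all add: idP)
  have 1: "v (v\<^sup>\<dagger> (v \<xi>)) = v \<xi>" for \<xi> using v(2) by (metis blinfun_apply_blinfun_compose)
  have "(v o\<^sub>L v\<^sup>\<dagger> o\<^sub>L v)\<^sup>\<dagger> = v\<^sup>\<dagger>" using v(2) by simp
  then have v2: "v\<^sup>\<dagger> o\<^sub>L v o\<^sub>L v\<^sup>\<dagger> = v\<^sup>\<dagger>" using vb by (simp add: op_compose_assoc)
  then have 2: "v\<^sup>\<dagger> (v (v\<^sup>\<dagger> \<xi>)) = v\<^sup>\<dagger> \<xi>" for \<xi> by (metis blinfun_apply_blinfun_compose)
  have projP: "v\<^sup>\<dagger> o\<^sub>L v \<in> projections P" "v o\<^sub>L v\<^sup>\<dagger> \<in> projections P"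
    using eP fP vb by (auto simp: projections_def 1 2 intro: blinfun_eqI)
  have adjM: "v\<^sup>\<dagger> \<in> M" by (rule vN_adj[OF M v(1)])
  have below: "q (v (q (v\<^sup>\<dagger> \<xi>))) = q \<xi>"
    if "q \<in> projections P" "\<And>\<xi>. v\<^sup>\<dagger> (v (q \<xi>)) = blinfun_apply q \<xi>" for q \<xi>
    by (rule singular_masa_projection_below_image[OF M P v(1) inv that])
  have below': "q (v\<^sup>\<dagger> (q (v \<xi>))) = q \<xi>"
    if "q \<in> projections P" "\<And>\<xi>. v (v\<^sup>\<dagger> (q \<xi>)) = blinfun_apply q \<xi>" for q \<xi>
    using singular_masa_projection_below_image[OF M P adjM, of q \<xi>] inv that vb by simp
  have comm: "x o\<^sub>L y = y o\<^sub>L x" if "x \<in> P" "y \<in> P" for x y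
    using cP that unfolding commutative_ops_def by blast
  have ef: "v\<^sup>\<dagger> (v \<xi>) = v (v\<^sup>\<dagger> \<xi>)" for \<xi>
  proof -
    have "v\<^sup>\<dagger> (v (v (v\<^sup>\<dagger> \<xi>))) = v\<^sup>\<dagger> (v \<xi>)"
      using below[OF projP(1), of \<xi>] by (simp add: 1 2)
    moreover have "v (v\<^sup>\<dagger> (v\<^sup>\<dagger> (v \<xi>))) = v (v\<^sup>\<dagger> \<xi>)"
      using below'[OF projP(2), of \<xi>] by (simp add: 1 2)
    moreover have "v\<^sup>\<dagger> (v (v (v\<^sup>\<dagger> \<xi>))) = v (v\<^sup>\<dagger> (v\<^sup>\<dagger> (v \<xi>)))"
      using comm[OF eP fP] by (metis blinfun_apply_blinfun_compose)
    ultimately show ?thesis by simp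
  qed
  have "v o\<^sub>L p = p o\<^sub>L v" if p: "p \<in> projections P" for p
  proof (rule blinfun_eqI)
    fix \<xi>
    have pP: "p \<in> P" "p\<^sup>\<dagger> = p" "p o\<^sub>L p = p" using p by (auto simp: projections_def)
    have pp: "p (p \<eta>) = p \<eta>" for \<eta> by (rule projection_apply[OF pP(3)])
    have pb: "p \<in> bounded_ops" using vN_bounded[OF vP pP(1)] .
    \<comment> \<open>Only the part of \<open>p\<close> below \<open>v\<^sup>* v\<close> matters: \<open>v q = v p\<close> and \<open>q v = p v\<close>.\<close>
    define q where "q = v\<^sup>\<dagger> o\<^sub>L v o\<^sub>L p"
    have pe: "p (v\<^sup>\<dagger> (v \<eta>)) = v\<^sup>\<dagger> (v (p \<eta>))" for \<eta>
      using comm[OF pP(1) eP] by (metis blinfun_apply_blinfun_compose)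
    have qP: "q \<in> P" unfolding q_def by (rule vN_compose[OF vP eP pP(1)])
    have qa: "q \<eta> = v\<^sup>\<dagger> (v (p \<eta>))" for \<eta> by (simp add: q_def)
    have "q\<^sup>\<dagger> = q"
      using vb pb pP(2) comm[OF pP(1) eP] by (simp add: q_def op_compose_assoc)
    moreover have "q o\<^sub>L q = q" by (rule blinfun_eqI) (simp add: qa pe pp 2)
    ultimately have qproj: "q \<in> projections P" using qP by (simp add: projections_def)
    define t where "t = v o\<^sub>L q o\<^sub>L v\<^sup>\<dagger>"
    have ta: "t \<eta> = v (q (v\<^sup>\<dagger> \<eta>))" for \<eta> by (simp add: t_def)
    have tP: "t \<in> P" unfolding t_def by (rule inv(1)[OF qP])
    have vqv: "v\<^sup>\<dagger> (v (q \<eta>)) = q \<eta>" for \<eta> by (simp add: qa 2)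
    have qq: "q (q \<eta>) = q \<eta>" for \<eta> by (simp add: qa pe pp 2)
    have tproj: "t \<in> projections P"
      using tP vb vN_bounded[OF vP qP] \<open>q\<^sup>\<dagger> = q\<close>
      by (auto simp: projections_def t_def op_compose_assoc vqv qq intro: blinfun_eqI)
    have qt: "q (t \<eta>) = q \<eta>" for \<eta>
      using below[OF qproj vqv, of \<eta>] by (simp add: ta)
    have qe: "q (v\<^sup>\<dagger> (v \<eta>)) = q \<eta>" for \<eta> by (simp add: qa pe 2 1)
    have tq: "t (q \<eta>) = t \<eta>" for \<eta>
    proof -
      have "t (v\<^sup>\<dagger> (t (v \<eta>))) = t \<eta>"
        by (rule below'[OF tproj]) (simp add: ta 1)
      then show ?thesis by (simp add: ta qe vqv)
    qed
    have "q \<eta> = t \<eta>" for \<eta>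
      using qt[of \<eta>] tq[of \<eta>] comm[OF qP tP] by (metis blinfun_apply_blinfun_compose)
    then have "v (q \<eta>) = q (v \<eta>)" for \<eta> by (metis ta qe)
    then have "v (q \<xi>) = q (v \<xi>)" .
    moreover have "v (q \<xi>) = v (p \<xi>)" by (simp add: qa 1)
    moreover have "q (v \<xi>) = p (v \<xi>)" by (metis qa pe ef 1)
    ultimately show "(v o\<^sub>L p) \<xi> = (p o\<^sub>L v) \<xi>" by simp
  qed
  then have "v \<in> commutant P" by (rule commutant_projections[OF vP vb])
  then show ?thesis
    by (intro masa_contains_commuting[OF M mP v(1)]) (simp add: commutant_def)
qed

section \<open>Matrix algebras\<close>

lemma op_scale_Re_Im: "c *\<^sub>O T = Re c *\<^sub>R T + Im c *\<^sub>R (\<i> *\<^sub>O T)"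
  by (rule blinfun_eqI)
    (simp add: blinfun_lin scaleR_scaleC scaleC_scaleC complex_eq[symmetric] mult.commute flip: scaleC_left_distrib)

lemma matrix_algebra_von_neumann: "matrix_algebra N \<Longrightarrow> von_neumann_algebra N"
  by (simp add: matrix_algebra_def)

lemma matrix_algebra_finite_dimensional:
  fixes N :: "'i op set"
  assumes "matrix_algebra N"
  obtains B where "finite B" "N \<subseteq> span B"
proof -
  obtain n and e :: "nat \<Rightarrow> nat \<Rightarrow> 'i op" where e: "\<forall>x\<in>N. \<exists>c. x = (\<Sum>i<n. \<Sum>j<n. c i j *\<^sub>O e i j)"
    using assms unfolding matrix_algebra_def by blast
  define B where "B = (\<lambda>(i, j). e i j) ` ({..<n} \<times> {..<n}) \<union> (\<lambda>(i, j). \<i> *\<^sub>O e i j) ` ({..<n} \<times> {..<n})"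
  have "e i j \<in> B" "\<i> *\<^sub>O e i j \<in> B" if "i < n" "j < n" for i j
    using that by (force simp: B_def)+
  then have "c *\<^sub>O e i j \<in> span B" if "i < n" "j < n" for c i j
    unfolding op_scale_Re_Im[of c] using that by (intro span_add span_scale span_base)
  then have "N \<subseteq> span B"
    using e by (fastforce intro!: span_sum)
  moreover have "finite B" by (simp add: B_def)
  ultimately show ?thesis using that by blast
qed

text \<open>Some matrix coefficient \<open>c a b\<close> of \<open>f\<close> is nonzero, and \<open>e k a f e b k = c a b e k k\<close> for the matrix units \<open>e\<close>.  If
  \<open>f T g\<close> were zero for all \<open>T\<close>, then \<open>e k k g\<close> would be zero for all \<open>k\<close>; but the \<open>e k k\<close> sum to \<open>1\<close>.\<close>

lemma matrix_algebra_prime: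
  assumes N: "matrix_algebra N" and fg: "f \<in> N" "f \<noteq> 0" "g \<noteq> 0"
  obtains T where "T \<in> N" "f o\<^sub>L T o\<^sub>L g \<noteq> 0"
proof -
  obtain n and e :: "nat \<Rightarrow> nat \<Rightarrow> 'a op" where eN: "\<And>i j. i < n \<Longrightarrow> j < n \<Longrightarrow> e i j \<in> N"
    and mult: "\<And>i j k l. i < n \<Longrightarrow> j < n \<Longrightarrow> k < n \<Longrightarrow> l < n \<Longrightarrow> e i j o\<^sub>L e k l = (if j = k then e i l else 0)"
    and one: "(\<Sum>i<n. e i i) = id_blinfun"
    and span: "\<And>x. x \<in> N \<Longrightarrow> \<exists>c. x = (\<Sum>i<n. \<Sum>j<n. c i j *\<^sub>O e i j)"
  proof -
    from N obtain n and e :: "nat \<Rightarrow> nat \<Rightarrow> 'a op" where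
      "(\<forall>i<n. \<forall>j<n. e i j \<in> N \<and> (e i j)\<^sup>\<dagger> = e j i) \<and>
        (\<forall>i<n. \<forall>j<n. \<forall>k<n. \<forall>l<n. e i j o\<^sub>L e k l = (if j = k then e i l else 0)) \<and>
        (\<Sum>i<n. e i i) = id_blinfun \<and>
        (\<forall>x\<in>N. \<exists>c. x = (\<Sum>i<n. \<Sum>j<n. c i j *\<^sub>O e i j))"
      unfolding matrix_algebra_def by (elim conjE exE) (rule that, intro conjI)
    then show thesis by (intro that[of n e]) simp_all
  qed
  have vN: "von_neumann_algebra N" using N by (rule matrix_algebra_von_neumann)
  obtain c where c: "f = (\<Sum>i<n. \<Sum>j<n. c i j *\<^sub>O e i j)" using span[OF fg(1)] by blast
  have "\<exists>a<n. \<exists>b<n. c a b \<noteq> 0"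
  proof (rule ccontr)
    assume "\<not> ?thesis"
    then have "f = (\<Sum>i<n. \<Sum>j<n. 0)"
      unfolding c by (intro sum.cong) (auto intro!: blinfun_eqI)
    then show False using fg(2) by simp
  qed
  then obtain a b where ab: "a < n" "b < n" "c a b \<noteq> 0" by blast
  have mult': "e i j (e k l \<xi>) = (if j = k then e i l \<xi> else 0)" if "i < n" "j < n" "k < n" "l < n" for i j k l \<xi>
    using mult[OF that] by (metis blinfun_apply_blinfun_compose blinfun.zero_left)
  have eb: "e i j \<in> bounded_ops" if "i < n" "j < n" for i j
    using eN[OF that] vN_bounded[OF vN] by blast
  have corner: "e k a (f (e b k \<xi>)) = c a b *\<^sub>C e k k \<xi>" if k: "k < n" for k \<xi>
  proof -
    have "e k a (f (e b k \<xi>)) = (\<Sum>i<n. \<Sum>j<n. c i j *\<^sub>C e k a (e i j (e b k \<xi>)))"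
      unfolding c using ab k by (simp add: blinfun.sum_left blinfun.sum_right bounded_opsD[OF eb])
    also have "\<dots> = (\<Sum>i<n. if i = a then c a b *\<^sub>C e k k \<xi> else 0)"
    proof (intro sum.cong refl)
      fix i assume i: "i \<in> {..<n}"
      have "(\<Sum>j<n. c i j *\<^sub>C e k a (e i j (e b k \<xi>)))
          = (\<Sum>j<n. if j = b then (if i = a then c a b *\<^sub>C e k k \<xi> else 0) else 0)"
        using ab k i by (intro sum.cong refl) (auto simp: mult')
      then show "(\<Sum>j<n. c i j *\<^sub>C e k a (e i j (e b k \<xi>))) = (if i = a then c a b *\<^sub>C e k k \<xi> else 0)"
        using ab by simp
    qed
    also have "\<dots> = c a b *\<^sub>C e k k \<xi>"
      using ab by simp
    finally show ?thesis .
  qed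
  note result = that
  show ?thesis
  proof (rule ccontr)
    assume *: "\<not> thesis"
    have "e k k (g \<xi>) = 0" if k: "k < n" for k \<xi>
    proof -
      have "f o\<^sub>L e b k o\<^sub>L g = 0" using * result eN[OF ab(2) k] by blast
      then have "f (e b k (g \<xi>)) = 0" by (metis blinfun_apply_blinfun_compose blinfun.zero_left)
      then have "c a b *\<^sub>C e k k (g \<xi>) = 0" using corner[OF k, of "g \<xi>"] by simp
      then have "(1 / c a b) *\<^sub>C c a b *\<^sub>C e k k (g \<xi>) = 0" by simp
      then show ?thesis using ab(3) by (simp add: scaleC_scaleC)
    qed
    then have "(\<Sum>i<n. e i i) (g \<xi>) = 0" for \<xi>
      by (simp add: blinfun.sum_left)
    then have "g = 0" unfolding one by (intro blinfun_eqI) simp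
    then show False using fg(3) by simp
  qed
qed

section \<open>Minimal projections of a maximal abelian subalgebra\<close>

definition orthogonal_family :: "'i op set \<Rightarrow> 'i op set \<Rightarrow> bool" where
  "orthogonal_family Q F \<longleftrightarrow> finite F \<and> F \<subseteq> projections Q \<and> 0 \<notin> F \<and> (\<forall>f\<in>F. \<forall>g\<in>F. f \<noteq> g \<longrightarrow> f o\<^sub>L g = 0)"

lemma orthogonal_family_sum:
  assumes F: "orthogonal_family Q F" and f: "f \<in> F"
  shows "(\<Sum>g\<in>F. u g *\<^sub>R g) o\<^sub>L f = u f *\<^sub>R f"
proof -
  have "(\<Sum>g\<in>F. u g *\<^sub>R g) o\<^sub>L f = (\<Sum>g\<in>F. u g *\<^sub>R (g o\<^sub>L f))"
    by (simp add: op_compose_sum_left bounded_bilinear.scaleR_left[OF bounded_bilinear_blinfun_compose])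
  also have "\<dots> = (\<Sum>g\<in>F. if g = f then u f *\<^sub>R f else 0)"
    using F f by (intro sum.cong) (auto simp: orthogonal_family_def projections_def)
  also have "\<dots> = u f *\<^sub>R f" using F f by (simp add: orthogonal_family_def)
  finally show ?thesis .
qed

lemma orthogonal_family_independent:
  assumes F: "orthogonal_family Q F"
  shows "independent F"
proof -
  have "u f = 0" if 0: "(\<Sum>g\<in>F. u g *\<^sub>R g) = 0" and f: "f \<in> F" for u f
  proof -
    have "u f *\<^sub>R f = 0" using orthogonal_family_sum[OF F f, of u] 0 by simp
    then show ?thesis using F f by (auto simp: orthogonal_family_def)
  qed
  then show ?thesis
    using F dependent_finite[of F] by (auto simp: orthogonal_family_def)
qed

text \<open>Orthogonal families are linearly independent, so there is one of maximal cardinality.  Its sum is \<open>1\<close>,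
  because otherwise the complement of the sum could be added, and its members are minimal, because otherwise some \<open>f\<close> could
  be replaced by the two projections \<open>g f\<close> and \<open>f - g f\<close>.\<close>

lemma exists_minimal_projections:
  assumes fin: "finite B" "Q \<subseteq> span B" and Q: "von_neumann_algebra Q" "commutative_ops Q"
  obtains F where "orthogonal_family Q F" "\<Sum>F = id_blinfun"
    "\<And>f g. f \<in> F \<Longrightarrow> g \<in> projections Q \<Longrightarrow> g o\<^sub>L f = 0 \<or> g o\<^sub>L f = f"
proof -
  have card: "card F \<le> card B" if "orthogonal_family Q F" for F
    using independent_span_bound[OF fin(1) orthogonal_family_independent[OF that]] that fin(2)
    by (auto simp: orthogonal_family_def projections_def)
  have "orthogonal_family Q {}" by (simp add: orthogonal_family_def)
  then have "\<exists>F. orthogonal_family Q F \<and> (\<forall>G. orthogonal_family Q G \<longrightarrow> card G \<le> card F)"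
    by (rule ex_has_greatest_nat[where b="Suc (card B)"]) (use card in \<open>auto simp: less_Suc_eq_le\<close>)
  then obtain F where F: "orthogonal_family Q F" and max: "\<And>G. orthogonal_family Q G \<Longrightarrow> card G \<le> card F"
    by auto
  have finF: "finite F" and FQ: "\<And>f. f \<in> F \<Longrightarrow> f \<in> Q \<and> f\<^sup>\<dagger> = f \<and> f o\<^sub>L f = f \<and> f \<noteq> 0"
    and orth: "\<And>f g. f \<in> F \<Longrightarrow> g \<in> F \<Longrightarrow> f \<noteq> g \<Longrightarrow> f o\<^sub>L g = 0"
    using F by (auto simp: orthogonal_family_def projections_def)
  have comm: "x o\<^sub>L y = y o\<^sub>L x" if "x \<in> Q" "y \<in> Q" for x y
    using Q(2) that unfolding commutative_ops_def by blast
  have b: "x \<in> bounded_ops" if "x \<in> Q" for x using vN_bounded[OF Q(1) that] .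
  define p where "p = \<Sum>F"
  have pf: "p o\<^sub>L f = f" if "f \<in> F" for f
    using orthogonal_family_sum[OF F that, of "\<lambda>_. 1"] by (simp add: p_def)
  have pQ: "p \<in> Q" unfolding p_def using FQ by (intro vN_sum[OF Q(1)]) auto
  have padj: "p\<^sup>\<dagger> = p"
  proof -
    have "(\<Sum>G)\<^sup>\<dagger> = \<Sum>G" if "G \<subseteq> F" for G
      using finite_subset[OF that finF] that
    proof (induction G)
      case (insert f G)
      then show ?case using FQ b by (subst sum.insert; simp) (subst adj_add; auto intro!: sum_bounded_ops)
    qed simp
    then show ?thesis by (simp add: p_def)
  qed
  have pp: "p o\<^sub>L p = p"
  proof -
    have "p o\<^sub>L p = (\<Sum>f\<in>F. p o\<^sub>L f)" by (subst (2) p_def) (simp add: op_compose_sum_right)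
    then show ?thesis using pf by (simp add: p_def)
  qed
  define r where "r = id_blinfun - p"
  have rQ: "r \<in> Q" "r\<^sup>\<dagger> = r"
    using vN_diff[OF Q(1) vN_id[OF Q(1)] pQ] b[OF pQ] padj by (simp_all add: r_def)
  have rf: "r o\<^sub>L f = 0" if "f \<in> F" for f
    unfolding r_def op_compose_diff_left pf[OF that] by (auto intro: blinfun_eqI)
  have rr: "r o\<^sub>L r = r"
    by (rule blinfun_eqI) (simp add: r_def blinfun_lin projection_apply[OF pp])
  have "r = 0"
  proof (rule ccontr)
    assume r0: "r \<noteq> 0"
    have "r \<notin> F" using rf rr r0 by fastforce
    moreover have "orthogonal_family Q (insert r F)"
      unfolding orthogonal_family_def
    proof (intro conjI)
      show "insert r F \<subseteq> projections Q"
        using F rQ rr by (simp add: orthogonal_family_def projections_def)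
      have "f o\<^sub>L r = 0" if "f \<in> F" for f
        using rf[OF that] comm[OF rQ(1), of f] FQ[OF that] by simp
      then show "\<forall>f\<in>insert r F. \<forall>g\<in>insert r F. f \<noteq> g \<longrightarrow> f o\<^sub>L g = 0"
        using rf orth by blast
    qed (use finF r0 FQ in auto)
    ultimately show False using max[of "insert r F"] finF by simp
  qed
  then have one: "\<Sum>F = id_blinfun" by (simp add: r_def p_def)
  have minimal: "g o\<^sub>L f = 0 \<or> g o\<^sub>L f = f" if f: "f \<in> F" and g: "g \<in> projections Q" for f g
  proof (rule ccontr)
    assume neg: "\<not> ?thesis"
    have gQ: "g \<in> Q" "g\<^sup>\<dagger> = g" "g o\<^sub>L g = g" using g by (auto simp: projections_def)
    have fa: "f (f \<xi>) = f \<xi>" and ga: "g (g \<xi>) = g \<xi>" and gf: "f (g \<xi>) = g (f \<xi>)" for \<xi>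
      using FQ[OF f] gQ(3) comm[of f g] gQ(1) by (metis blinfun_apply_blinfun_compose)+
    define h k where "h = g o\<^sub>L f" and "k = f - (g o\<^sub>L f)"
    have h: "h \<in> projections Q"
      using vN_compose[OF Q(1) gQ(1)] FQ[OF f] gQ b comm[of f g]
      by (auto simp: projections_def h_def fa ga gf intro!: blinfun_eqI)
    have k: "k \<in> projections Q"
      using vN_diff[OF Q(1) _ vN_compose[OF Q(1) gQ(1)], of f f] FQ[OF f] gQ b comm[of f g]
      by (auto simp: projections_def k_def fa ga gf blinfun_lin intro!: blinfun_eqI)
    have hk0: "h o\<^sub>L k = 0" "k o\<^sub>L h = 0"
      by (auto simp: h_def k_def fa ga gf blinfun_lin intro!: blinfun_eqI)
    have h0: "h \<noteq> 0" and k0: "k \<noteq> 0" using neg by (auto simp: h_def k_def)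
    have hk: "h \<noteq> k" using hk0 h h0 by (auto simp: projections_def)
    have other: "h o\<^sub>L d = 0" "d o\<^sub>L h = 0" "k o\<^sub>L d = 0" "d o\<^sub>L k = 0" if d: "d \<in> F" "d \<noteq> f" for d
    proof -
      have fd: "f (d \<xi>) = 0" and df: "d (f \<xi>) = 0" for \<xi>
        using orth[OF f d(1)] orth[OF d(1) f] d(2) by (metis blinfun_apply_blinfun_compose blinfun.zero_left)+
      have "d (g \<xi>) = g (d \<xi>)" for \<xi>
        using comm[of d g] FQ[OF d(1)] gQ(1) by (metis blinfun_apply_blinfun_compose)
      then show "h o\<^sub>L d = 0" "d o\<^sub>L h = 0" "k o\<^sub>L d = 0" "d o\<^sub>L k = 0"
        by (auto simp: h_def k_def fd df blinfun_lin intro!: blinfun_eqI)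
    qed
    let ?G = "insert h (insert k (F - {f}))"
    have "h o\<^sub>L h = h" "k o\<^sub>L k = k" using h k by (auto simp: projections_def)
    then have hF: "h \<notin> F - {f}" and kF: "k \<notin> F - {f}"
      using other(1)[of h] other(3)[of k] h0 k0 by auto
    have "orthogonal_family Q ?G"
      unfolding orthogonal_family_def
    proof (intro conjI)
      show "?G \<subseteq> projections Q" using h k F by (auto simp: orthogonal_family_def)
      show "\<forall>d\<in>?G. \<forall>d'\<in>?G. d \<noteq> d' \<longrightarrow> d o\<^sub>L d' = 0"
        using hk0 other orth by auto
    qed (use finF h0 k0 FQ in auto)
    moreover have "card ?G = Suc (card F)"
      using hF kF hk finF f card_Suc_Diff1[OF finF f] by simp
    ultimately show False using max[of ?G] by simp
  qed
  show ?thesis using that F one minimal by blast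
qed

lemma exists_rank_one_operator:
  fixes \<xi> \<zeta> :: "'i ell2"
  obtains S where "S \<in> bounded_ops" "\<And>\<eta>. blinfun_apply S \<eta> = cinner \<xi> \<eta> *\<^sub>C \<zeta>"
proof
  let ?f = "\<lambda>\<eta>. cinner \<xi> \<eta> *\<^sub>C \<zeta>"
  have add: "?f (x + y) = ?f x + ?f y" and scale: "?f (c *\<^sub>C x) = c *\<^sub>C ?f x" for x y c
    by (simp_all add: cinner_simps scaleC_left_distrib scaleC_scaleC)
  have bound: "norm (?f x) \<le> norm \<xi> * norm \<zeta> * norm x" for x
  proof -
    have "norm (?f x) \<le> (norm \<xi> * norm x) * norm \<zeta>"
      unfolding norm_scaleC by (intro mult_right_mono cinner_Cauchy_Schwarz) simp
    then show ?thesis by (simp add: mult_ac)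
  qed
  note bl = bounded_opsI[of ?f, OF add scale bound]
  show "Blinfun (\<lambda>\<eta>. cinner \<xi> \<eta> *\<^sub>C \<zeta>) \<in> bounded_ops" by (rule bl)
  show "blinfun_apply (Blinfun (\<lambda>\<eta>. cinner \<xi> \<eta> *\<^sub>C \<zeta>)) \<eta> = cinner \<xi> \<eta> *\<^sub>C \<zeta>" for \<eta>
    using bl(1) by (simp add: bounded_linear_Blinfun_apply)
qed

lemma projection_unit_vector:
  assumes "f \<in> bounded_ops" "f o\<^sub>L f = f" "f \<noteq> 0"
  obtains \<eta> where "blinfun_apply f \<eta> = \<eta>" "norm \<eta> = 1"
proof -
  obtain \<xi> where x: "f \<xi> \<noteq> 0" using assms(3) by (metis blinfun_eqI zero_blinfun.rep_eq)
  show ?thesis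
    by (rule that[of "(1 / norm (f \<xi>)) *\<^sub>R f \<xi>"])
      (use x in \<open>simp_all add: blinfun_lin projection_apply[OF assms(2)]\<close>)
qed

text \<open>Each projection of \<open>Q\<close> is \<open>0\<close> or \<open>1\<close> on the range of \<open>f\<close>, so every operator of the form \<open>f S f\<close> commutes with
  \<open>Q\<close>.  By maximality \<open>f T f\<close> then belongs to \<open>Q\<close> and therefore commutes with every \<open>f S f\<close>; rank one operators \<open>S\<close> show
  that it is scalar on the range of \<open>f\<close>.\<close>

lemma masa_minimal_projection_corner:
  assumes N: "von_neumann_algebra N" and Q: "masa N Q" and f: "f \<in> projections Q" "f \<noteq> 0"
    and minimal: "\<And>g. g \<in> projections Q \<Longrightarrow> g o\<^sub>L f = 0 \<or> g o\<^sub>L f = f"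
    and T: "T \<in> N"
  shows "\<exists>c. f o\<^sub>L T o\<^sub>L f = c *\<^sub>O f"
proof -
  have vQ: "von_neumann_algebra Q" and QN: "Q \<subseteq> N" and cQ: "commutative_ops Q" using Q by (auto simp: masa_def)
  have fQ: "f \<in> Q" "f o\<^sub>L f = f" using f by (auto simp: projections_def)
  have fb: "f \<in> bounded_ops" using vN_bounded[OF vQ fQ(1)] .
  have comm: "f o\<^sub>L S o\<^sub>L f \<in> commutant Q" if S: "S \<in> bounded_ops" for S
  proof (rule commutant_projections[OF vQ])
    show "f o\<^sub>L S o\<^sub>L f \<in> bounded_ops" using fb S by simp
    fix g assume g: "g \<in> projections Q"
    have "g o\<^sub>L f = f o\<^sub>L g" using cQ fQ(1) g unfolding commutative_ops_def projections_def by blast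
    then show "(f o\<^sub>L S o\<^sub>L f) o\<^sub>L g = g o\<^sub>L (f o\<^sub>L S o\<^sub>L f)"
      using minimal[OF g] fQ(2) by (metis (no_types, lifting) op_compose_assoc blinfun_compose_zero(1) blinfun_compose_zero(2))
  qed
  define y where "y = f o\<^sub>L T o\<^sub>L f"
  have "y \<in> Q"
  proof (rule masa_contains_commuting[OF N Q])
    show "y \<in> N" unfolding y_def using fQ QN T by (intro vN_compose[OF N]) auto
    show "y o\<^sub>L x = x o\<^sub>L y" if "x \<in> Q" for x
      using comm[OF vN_bounded[OF N T]] that unfolding y_def by (rule commutantD)
  qed
  obtain \<xi> where x: "f \<xi> = \<xi>" "norm \<xi> = 1" using projection_unit_vector[OF fb fQ(2) f(2)] .
  have ff: "f (f \<eta>) = f \<eta>" for \<eta> by (rule projection_apply[OF fQ(2)])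
  have fy: "f (y \<eta>) = y \<eta>" "y (f \<eta>) = y \<eta>" for \<eta> by (simp_all add: y_def ff)
  have "y \<zeta> = cinner \<xi> (y \<xi>) *\<^sub>C f \<zeta>" for \<zeta>
  proof -
    obtain S where S: "S \<in> bounded_ops" "\<And>\<eta>. blinfun_apply S \<eta> = cinner \<xi> \<eta> *\<^sub>C \<zeta>"
      using exists_rank_one_operator[of \<xi> \<zeta>] by blast
    have "(f o\<^sub>L S o\<^sub>L f) o\<^sub>L y = y o\<^sub>L (f o\<^sub>L S o\<^sub>L f)"
      by (rule commutantD[OF comm[OF S(1)] \<open>y \<in> Q\<close>])
    then have "((f o\<^sub>L S o\<^sub>L f) o\<^sub>L y) \<xi> = (y o\<^sub>L (f o\<^sub>L S o\<^sub>L f)) \<xi>" by (simp only:)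
    then show ?thesis
      by (simp add: S(2) fy x cinner_norm bounded_opsD[OF fb] bounded_opsD[OF vN_bounded[OF vQ \<open>y \<in> Q\<close>]])
  qed
  note ya = this
  have "y = cinner \<xi> (y \<xi>) *\<^sub>O f" by (rule blinfun_eqI) (unfold op_scale_apply, rule ya)
  then show ?thesis unfolding y_def by blast
qed

lemma normaliser_bounded: "normaliser M P \<subseteq> bounded_ops" if "von_neumann_algebra M"
  using vN_bounded[OF that] by (auto simp: normaliser_def)

lemma normaliser_algebra_von_neumann:
  "von_neumann_algebra M \<Longrightarrow> von_neumann_algebra (normaliser_algebra M P)"
  unfolding normaliser_algebra_def by (intro vN_generated_von_neumann normaliser_bounded)

lemma normaliser_algebra_subset: "von_neumann_algebra M \<Longrightarrow> normaliser_algebra M P \<subseteq> M"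
  unfolding normaliser_algebra_def by (intro vN_generated_least) (auto simp: normaliser_def)

text \<open>The unitary \<open>1 - 2 f\<close> fixes \<open>P\<close> pointwise under conjugation.\<close>

lemma projection_in_normaliser_algebra:
  assumes M: "von_neumann_algebra M" and P: "P \<subseteq> M" "commutative_ops P" and f: "f \<in> projections P"
  shows "f \<in> normaliser_algebra M P"
proof -
  have fP: "f \<in> P" "f\<^sup>\<dagger> = f" "f o\<^sub>L f = f" using f by (auto simp: projections_def)
  have fM: "f \<in> M" using fP P by blast
  have fb: "f \<in> bounded_ops" using vN_bounded[OF M fM] .
  define s where "s = id_blinfun - 2 *\<^sub>R f"
  have sa: "s \<xi> = \<xi> - 2 *\<^sub>R f \<xi>" for \<xi> by (simp add: s_def blinfun_lin)
  have ss: "s (s \<xi>) = \<xi>" for \<xi> by (simp add: sa blinfun_lin projection_apply[OF fP(3)] scaleR_2)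
  have sadj: "s\<^sup>\<dagger> = s" using fb fP by (simp add: s_def)
  have "s o\<^sub>L x o\<^sub>L s = x" if x: "x \<in> P" for x
  proof (rule blinfun_eqI)
    fix \<xi>
    have "x o\<^sub>L f = f o\<^sub>L x" using P(2) x fP(1) unfolding commutative_ops_def by blast
    then have "x (f \<xi>) = f (x \<xi>)" for \<xi> by (metis blinfun_apply_blinfun_compose)
    then have "x (s \<xi>) = s (x \<xi>)" by (simp add: sa blinfun_lin)
    then show "(s o\<^sub>L x o\<^sub>L s) \<xi> = x \<xi>" by (simp add: ss)
  qed
  then have "(\<lambda>x. s o\<^sub>L x o\<^sub>L s\<^sup>\<dagger>) ` P = P" by (simp add: sadj)
  moreover have "unitary s" by (auto simp: unitary_def sadj ss intro: blinfun_eqI)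
  moreover have "s \<in> M" unfolding s_def by (intro vN_diff vN_scaleR vN_id M fM)
  ultimately have "s \<in> normaliser_algebra M P"
    using vN_generated_subset[of "normaliser M P"] by (auto simp: normaliser_def normaliser_algebra_def)
  then have "(1/2) *\<^sub>R (id_blinfun - s) \<in> normaliser_algebra M P"
    by (intro vN_scaleR vN_diff vN_id normaliser_algebra_von_neumann M)
  moreover have "(1/2) *\<^sub>R (id_blinfun - s) = f" by (simp add: s_def)
  ultimately show ?thesis by simp
qed

text \<open>A nonzero \<open>f T g\<close> is a multiple of a partial isometry \<open>w\<close>, because its absolute square is a positive multiple of
  \<open>g\<close>.  If \<open>f = g\<close>, then \<open>w\<close> is a multiple of \<open>f\<close>.  If \<open>f\<close> and \<open>g\<close> are orthogonal, then \<open>w\<close> is a corner of the unitary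
  exchanging them, which normalises \<open>Q\<close> because \<open>w x w\<^sup>*\<close> and \<open>w\<^sup>* x w\<close> are multiples of \<open>f\<close> and \<open>g\<close>.\<close>

lemma exists_matrix_unit:
  assumes N: "matrix_algebra N" and Q: "masa N Q"
    and f: "f \<in> projections Q" "f \<noteq> 0" and g: "g \<in> projections Q" "g \<noteq> 0"
    and fg: "f = g \<or> f o\<^sub>L g = 0"
    and cf: "\<And>T. T \<in> N \<Longrightarrow> \<exists>c. f o\<^sub>L T o\<^sub>L f = c *\<^sub>O f"
    and cg: "\<And>T. T \<in> N \<Longrightarrow> \<exists>c. g o\<^sub>L T o\<^sub>L g = c *\<^sub>O g"
  obtains w where "w \<in> normaliser_algebra N Q" "w\<^sup>\<dagger> o\<^sub>L w = g" "w o\<^sub>L w\<^sup>\<dagger> = f"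
proof -
  have vN: "von_neumann_algebra N" using N by (rule matrix_algebra_von_neumann)
  have vQ: "von_neumann_algebra Q" and QN: "Q \<subseteq> N" and cQ: "commutative_ops Q" using Q by (auto simp: masa_def)
  have fQ: "f \<in> Q" "f\<^sup>\<dagger> = f" "f o\<^sub>L f = f" and gQ: "g \<in> Q" "g\<^sup>\<dagger> = g" "g o\<^sub>L g = g"
    using f g by (auto simp: projections_def)
  have fN: "f \<in> N" and gN: "g \<in> N" using fQ gQ QN by auto
  have fb: "f \<in> bounded_ops" and gb: "g \<in> bounded_ops" using vN_bounded[OF vN] fN gN by auto
  have f1: "f \<in> normaliser_algebra N Q" and g1: "g \<in> normaliser_algebra N Q"
    using projection_in_normaliser_algebra[OF vN QN cQ] f g by auto
  have ff: "f (f \<xi>) = f \<xi>" and gg: "g (g \<xi>) = g \<xi>" for \<xi>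
    using projection_apply[OF fQ(3)] projection_apply[OF gQ(3)] by auto
  obtain T where T: "T \<in> N" "f o\<^sub>L T o\<^sub>L g \<noteq> 0" using matrix_algebra_prime[OF N fN f(2) g(2)] .
  define v where "v = f o\<^sub>L T o\<^sub>L g"
  have vMem: "v \<in> N" unfolding v_def by (intro vN_compose vN fN gN T)
  have vb: "v \<in> bounded_ops" using vN_bounded[OF vN vMem] .
  have Tb: "T \<in> bounded_ops" using vN_bounded[OF vN T(1)] .
  have va: "v (g \<xi>) = v \<xi>" "f (v \<xi>) = v \<xi>" for \<xi> by (simp_all add: v_def ff gg)
  have vadj: "v\<^sup>\<dagger> = g o\<^sub>L T\<^sup>\<dagger> o\<^sub>L f" using fb gb Tb fQ gQ by (simp add: v_def op_compose_assoc)
  have vadja: "v\<^sup>\<dagger> (f \<xi>) = v\<^sup>\<dagger> \<xi>" "g (v\<^sup>\<dagger> \<xi>) = v\<^sup>\<dagger> \<xi>" for \<xi> by (simp_all add: vadj ff gg)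
  obtain c where "g o\<^sub>L (v\<^sup>\<dagger> o\<^sub>L v) o\<^sub>L g = c *\<^sub>O g"
    using cg[of "v\<^sup>\<dagger> o\<^sub>L v"] vN_compose[OF vN vN_adj[OF vN vMem] vMem] by blast
  moreover have "g o\<^sub>L (v\<^sup>\<dagger> o\<^sub>L v) o\<^sub>L g = v\<^sup>\<dagger> o\<^sub>L v" by (rule blinfun_eqI) (simp add: va vadja)
  ultimately have c: "v\<^sup>\<dagger> o\<^sub>L v = c *\<^sub>O g" by simp
  have c0: "v\<^sup>\<dagger> o\<^sub>L v \<noteq> 0" using adj_compose_self_eq_0[OF vb] T(2) by (auto simp: v_def)
  obtain \<eta> where eta: "g \<eta> = \<eta>" "norm \<eta> = 1" using projection_unit_vector[OF gb gQ(3) g(2)] .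
  define r where "r = (norm (v \<eta>))\<^sup>2"
  have "cinner \<eta> (v\<^sup>\<dagger> (v \<eta>)) = complex_of_real r"
    by (simp add: cinner_adj_right vb cinner_norm r_def)
  moreover have "v\<^sup>\<dagger> (v \<eta>) = c *\<^sub>C \<eta>" using c eta by (metis blinfun_apply_blinfun_compose op_scale_apply)
  ultimately have cr: "c = complex_of_real r" by (simp add: cinner_simps cinner_norm eta)
  then have "v\<^sup>\<dagger> o\<^sub>L v = r *\<^sub>R g" using c by (simp add: scaleR_op_scale)
  then have vv: "v\<^sup>\<dagger> (v \<xi>) = r *\<^sub>R g \<xi>" for \<xi> by (metis blinfun_apply_blinfun_compose scaleR_blinfun.rep_eq)
  have "r \<noteq> 0" using c0 \<open>v\<^sup>\<dagger> o\<^sub>L v = r *\<^sub>R g\<close> by auto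
  then have r: "r > 0" by (simp add: r_def)
  define w where "w = (1 / sqrt r) *\<^sub>R v"
  have wN: "w \<in> N" unfolding w_def by (intro vN_scaleR vN vMem)
  have wadj: "w\<^sup>\<dagger> = (1 / sqrt r) *\<^sub>R v\<^sup>\<dagger>" using vb by (simp add: w_def)
  have ww: "w\<^sup>\<dagger> o\<^sub>L w = g"
    by (rule blinfun_eqI, simp only: blinfun_apply_blinfun_compose wadj)
      (use r in \<open>simp add: w_def blinfun_lin vv\<close>)
  have wg: "w o\<^sub>L g = w" "f o\<^sub>L w = w"
    by (rule blinfun_eqI; simp add: w_def blinfun_lin va)+
  have www: "w o\<^sub>L w\<^sup>\<dagger> o\<^sub>L w = w" by (simp add: op_compose_assoc ww wg)
  have corner_f: "\<exists>c. x = c *\<^sub>O f" if "x \<in> N" "f o\<^sub>L x o\<^sub>L f = x" for x using cf[OF that(1)] that(2) by simp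
  have corner_g: "\<exists>c. x = c *\<^sub>O g" if "x \<in> N" "g o\<^sub>L x o\<^sub>L g = x" for x using cg[OF that(1)] that(2) by simp
  have wa: "w (g \<xi>) = w \<xi>" "f (w \<xi>) = w \<xi>" "w\<^sup>\<dagger> (f \<xi>) = w\<^sup>\<dagger> \<xi>" "g (w\<^sup>\<dagger> \<xi>) = w\<^sup>\<dagger> \<xi>" for \<xi>
    unfolding wadj by (simp_all add: w_def blinfun_lin va vadja)
  have wwf: "w o\<^sub>L w\<^sup>\<dagger> = f"
  proof -
    obtain d where d: "w o\<^sub>L w\<^sup>\<dagger> = d *\<^sub>O f"
    proof -
      have "f o\<^sub>L (w o\<^sub>L w\<^sup>\<dagger>) o\<^sub>L f = w o\<^sub>L w\<^sup>\<dagger>" by (rule blinfun_eqI) (simp add: wa)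
      then show thesis using corner_f[OF vN_compose[OF vN wN vN_adj[OF vN wN]]] that by blast
    qed
    obtain \<xi> where xi: "f \<xi> = \<xi>" "norm \<xi> = 1" using projection_unit_vector[OF fb fQ(3) f(2)] .
    have dx: "w (w\<^sup>\<dagger> \<zeta>) = d *\<^sub>C f \<zeta>" for \<zeta> using d by (metis blinfun_apply_blinfun_compose op_scale_apply)
    have "w (w\<^sup>\<dagger> (w (w\<^sup>\<dagger> \<xi>))) = w (w\<^sup>\<dagger> \<xi>)" using www by (metis blinfun_apply_blinfun_compose)
    then have "cinner \<xi> (d *\<^sub>C d *\<^sub>C \<xi>) = cinner \<xi> (d *\<^sub>C \<xi>)"
      by (simp add: dx bounded_opsD[OF fb] xi)
    then have "d * d = d" by (simp add: cinner_simps cinner_norm xi)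
    moreover have "d \<noteq> 0"
    proof
      assume "d = 0"
      then have "w (w\<^sup>\<dagger> (w \<zeta>)) = 0" for \<zeta> by (simp add: dx)
      then have "w \<zeta> = 0" for \<zeta> using www by (metis blinfun_apply_blinfun_compose)
      then have "w = 0" by (intro blinfun_eqI) simp
      then show False using ww g(2) by simp
    qed
    ultimately show ?thesis using d by (simp add: blinfun_eqI)
  qed
  have "w \<in> normaliser_algebra N Q"
    using fg
  proof
    assume "f = g"
    then obtain d where "w = d *\<^sub>O f"
      using corner_f[OF wN] by (auto intro!: blinfun_eqI simp: wa) (metis blinfun_eqI wa blinfun_apply_blinfun_compose)
    then show ?thesis using vN_scale[OF normaliser_algebra_von_neumann[OF vN] f1] by simp
  next
    assume fg0: "f o\<^sub>L g = 0"
    have inv1: "w o\<^sub>L x o\<^sub>L w\<^sup>\<dagger> \<in> Q" if "x \<in> Q" for x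
    proof -
      have "w o\<^sub>L x o\<^sub>L w\<^sup>\<dagger> \<in> N" using that QN by (intro vN_compose vN vN_adj wN) auto
      then obtain d where "w o\<^sub>L x o\<^sub>L w\<^sup>\<dagger> = d *\<^sub>O f"
        using corner_f by (metis (no_types, lifting) blinfun_apply_blinfun_compose blinfun_eqI wa(2) wa(3))
      then show ?thesis using vN_scale[OF vQ fQ(1)] by simp
    qed
    have inv2: "w\<^sup>\<dagger> o\<^sub>L x o\<^sub>L w \<in> Q" if "x \<in> Q" for x
    proof -
      have "w\<^sup>\<dagger> o\<^sub>L x o\<^sub>L w \<in> N" using that QN by (intro vN_compose vN vN_adj wN) auto
      then obtain d where "w\<^sup>\<dagger> o\<^sub>L x o\<^sub>L w = d *\<^sub>O g"
        using corner_g by (metis (no_types, lifting) blinfun_apply_blinfun_compose blinfun_eqI wa(1) wa(4))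
      then show ?thesis using vN_scale[OF vQ gQ(1)] by simp
    qed
    have "g o\<^sub>L f = 0" using cQ fQ(1) gQ(1) fg0 unfolding commutative_ops_def by metis
    then obtain u where u: "u \<in> normaliser N Q" "(w o\<^sub>L w\<^sup>\<dagger>) o\<^sub>L u o\<^sub>L (w\<^sup>\<dagger> o\<^sub>L w) = w"
      using exists_normalising_unitary[OF vN vQ QN cQ wN www inv1 inv2] unfolding ww wwf by blast
    have "u \<in> normaliser_algebra N Q"
      using u(1) vN_generated_subset unfolding normaliser_algebra_def by blast
    then have "f o\<^sub>L u o\<^sub>L g \<in> normaliser_algebra N Q"
      by (intro vN_compose normaliser_algebra_von_neumann vN f1 g1)
    then show ?thesis using u(2) by (simp add: ww wwf)
  qed
  then show ?thesis using ww wwf by (rule that)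
qed

section \<open>Matrix entries of an operator in the tensor product\<close>

lemma op_tensor_cancel:
  assumes "a \<in> bounded_ops" "b \<in> bounded_ops" "w \<in> bounded_ops" "w \<noteq> 0" "a \<otimes>\<^sub>o w = b \<otimes>\<^sub>o w"
  shows "a = b"
proof (rule blinfun_eqI, rule cinner_ext)
  fix u z
  obtain \<xi> where xi: "w \<xi> \<noteq> 0" using assms(4) by (metis blinfun_eqI zero_blinfun.rep_eq)
  have "(a \<otimes>\<^sub>o w) (u \<otimes>\<^sub>v \<xi>) = (b \<otimes>\<^sub>o w) (u \<otimes>\<^sub>v \<xi>)" using assms(5) by simp
  then have "cinner (z \<otimes>\<^sub>v w \<xi>) (a u \<otimes>\<^sub>v w \<xi>) = cinner (z \<otimes>\<^sub>v w \<xi>) (b u \<otimes>\<^sub>v w \<xi>)"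
    by (simp only: op_tensor_apply[OF assms(1,3)] op_tensor_apply[OF assms(2,3)])
  then show "cinner z (a u) = cinner z (b u)" using xi by (simp add: cinner_tensor)
qed

text \<open>For fixed \<open>u\<close> and \<open>v\<close> the slice \<open>b \<in> N\<close> of \<open>X\<close> satisfies \<open>f b f = c f\<close>, and evaluation at \<open>\<eta>\<close> identifies \<open>c\<close> with
  \<open>\<langle>u, a v\<rangle>\<close>.\<close>

lemma minimal_corner_eq_slice:
  fixes R :: "'i op set" and N :: "'j op set"
  assumes vN: "von_neumann_algebra R" "von_neumann_algebra N" and X: "X \<in> R \<otimes>\<^sub>A N"
    and f: "f \<in> N" "f\<^sup>\<dagger> = f" and corner: "\<And>T. T \<in> N \<Longrightarrow> \<exists>c. f o\<^sub>L T o\<^sub>L f = c *\<^sub>O f"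
    and \<eta>: "f \<eta> = \<eta>" "norm \<eta> = 1"
    and a: "a \<in> bounded_ops" "\<And>u v. cinner u (blinfun_apply a v) = cinner (u \<otimes>\<^sub>v \<eta>) (X (v \<otimes>\<^sub>v \<eta>))"
  shows "(id_blinfun \<otimes>\<^sub>o f) o\<^sub>L X o\<^sub>L (id_blinfun \<otimes>\<^sub>o f) = a \<otimes>\<^sub>o f"
proof -
  have fb: "f \<in> bounded_ops" using vN_bounded[OF vN(2) f(1)] .
  have Xb: "X \<in> bounded_ops" using vN_bounded[OF vN_tensor_von_neumann[OF vN] X] .
  let ?F = "id_blinfun \<otimes>\<^sub>o f :: ('i \<times> 'j) op"
  have Fadj: "?F\<^sup>\<dagger> = ?F" using fb f by (simp add: op_tensor_adj)
  have Fb: "?F \<in> bounded_ops" using fb by simp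
  have fi: "cinner (f x) y = cinner x (f y)" for x y using cinner_adj_left[OF fb, of x y] f(2) by simp
  show ?thesis
  proof (rule op_tensor_ext)
    fix u \<zeta> v \<xi>
    obtain b where b: "b \<in> N" "\<And>\<zeta> \<xi>. cinner \<zeta> (blinfun_apply b \<xi>) = cinner (u \<otimes>\<^sub>v \<zeta>) (X (v \<otimes>\<^sub>v \<xi>))"
      using vN_tensor_slice_right_factor[OF vN X] by blast
    obtain c where "f o\<^sub>L b o\<^sub>L f = c *\<^sub>O f" using corner[OF b(1)] by blast
    then have c: "f (b (f \<xi>)) = c *\<^sub>C f \<xi>" for \<xi> by (metis blinfun_apply_blinfun_compose op_scale_apply)
    have "c = cinner \<eta> (f (b (f \<eta>)))" using c[of \<eta>] by (simp add: \<eta> cinner_simps cinner_norm)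
    also have "\<dots> = cinner \<eta> (b \<eta>)" by (simp add: fi[symmetric] \<eta>)
    finally have ca: "c = cinner u (a v)" by (simp add: a b)
    have "cinner (u \<otimes>\<^sub>v \<zeta>) ((?F o\<^sub>L X o\<^sub>L ?F) (v \<otimes>\<^sub>v \<xi>)) = cinner (?F (u \<otimes>\<^sub>v \<zeta>)) (X (?F (v \<otimes>\<^sub>v \<xi>)))"
      using cinner_adj_left[OF Fb, of "u \<otimes>\<^sub>v \<zeta>" "X (?F (v \<otimes>\<^sub>v \<xi>))"] by (simp add: Fadj)
    also have "\<dots> = cinner (f \<zeta>) (b (f \<xi>))" by (simp add: op_tensor_apply fb b)
    also have "\<dots> = cinner u (a v) * cinner \<zeta> (f \<xi>)" by (simp add: fi c ca cinner_simps)
    finally show "cinner (u \<otimes>\<^sub>v \<zeta>) ((?F o\<^sub>L X o\<^sub>L ?F) (v \<otimes>\<^sub>v \<xi>)) = cinner (u \<otimes>\<^sub>v \<zeta>) ((a \<otimes>\<^sub>o f) (v \<otimes>\<^sub>v \<xi>))"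
      by (simp add: op_tensor_apply a(1) fb cinner_tensor)
  qed (use Fb Xb a(1) fb in simp_all)
qed

text \<open>If \<open>a \<otimes> w\<close> is the \<open>(f, g)\<close> entry of \<open>A\<close>, then \<open>a x a\<^sup>* \<otimes> f\<close> is the \<open>(f, f)\<close> entry of \<open>A (x \<otimes> g) A\<close>.
  The latter lies in \<open>P \<otimes> Q\<close>, so its slices lie in \<open>P\<close>.\<close>

lemma matrix_entry_normalises:
  fixes R P :: "'i op set" and N Q :: "'j op set"
  assumes R: "von_neumann_algebra R" "von_neumann_algebra N"
    and P: "von_neumann_algebra P" "P \<subseteq> R" and Q: "von_neumann_algebra Q" "Q \<subseteq> N"
    and A: "A \<in> bounded_ops" "A\<^sup>\<dagger> = A" "\<And>x. x \<in> P \<otimes>\<^sub>A Q \<Longrightarrow> A o\<^sub>L x o\<^sub>L A \<in> P \<otimes>\<^sub>A Q"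
    and f: "f \<in> projections Q" "f \<noteq> 0" and g: "g \<in> projections Q"
    and corner: "\<And>T. T \<in> N \<Longrightarrow> \<exists>c. f o\<^sub>L T o\<^sub>L f = c *\<^sub>O f"
    and w: "w \<in> bounded_ops" "w o\<^sub>L w\<^sup>\<dagger> = f"
    and a: "a \<in> bounded_ops" "(id_blinfun \<otimes>\<^sub>o f) o\<^sub>L A o\<^sub>L (id_blinfun \<otimes>\<^sub>o g) = a \<otimes>\<^sub>o w"
    and x: "x \<in> P"
  shows "a o\<^sub>L x o\<^sub>L a\<^sup>\<dagger> \<in> P"
proof -
  let ?F = "id_blinfun \<otimes>\<^sub>o f :: ('i \<times> 'j) op" and ?G = "id_blinfun \<otimes>\<^sub>o g :: ('i \<times> 'j) op"
  have fQ: "f \<in> Q" "f\<^sup>\<dagger> = f" "f o\<^sub>L f = f" and gQ: "g \<in> Q" "g\<^sup>\<dagger> = g" "g o\<^sub>L g = g"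
    using f g by (auto simp: projections_def)
  have fb: "f \<in> bounded_ops" and gb: "g \<in> bounded_ops" and xb: "x \<in> bounded_ops"
    using vN_bounded Q(1) P(1) fQ gQ x by blast+
  define B where "B = A o\<^sub>L (x \<otimes>\<^sub>o g) o\<^sub>L A"
  have BPQ: "B \<in> P \<otimes>\<^sub>A Q" unfolding B_def by (intro A(3) op_tensor_in_vN_tensor x gQ)
  then have BRN: "B \<in> R \<otimes>\<^sub>A N" using vN_tensor_mono[OF P(2) Q(2) R] by blast
  obtain \<eta> where eta: "f \<eta> = \<eta>" "norm \<eta> = 1" using projection_unit_vector[OF fb fQ(3) f(2)] .
  obtain b where b: "b \<in> P" "\<And>u v. cinner u (blinfun_apply b v) = cinner (u \<otimes>\<^sub>v \<eta>) (B (v \<otimes>\<^sub>v \<eta>))"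
    using vN_tensor_slice_left_factor[OF P(1) Q(1) BPQ] by blast
  have bb: "b \<in> bounded_ops" using vN_bounded[OF P(1) b(1)] .
  have "f \<in> N" using fQ Q by blast
  then have FBF: "?F o\<^sub>L B o\<^sub>L ?F = b \<otimes>\<^sub>o f"
    by (intro minimal_corner_eq_slice[OF R BRN _ fQ(2) corner eta bb b(2)])
  have "(?F o\<^sub>L A o\<^sub>L ?G)\<^sup>\<dagger> = (a \<otimes>\<^sub>o w)\<^sup>\<dagger>" using a(2) by simp
  then have adj: "?G o\<^sub>L A o\<^sub>L ?F = a\<^sup>\<dagger> \<otimes>\<^sub>o w\<^sup>\<dagger>"
    using A fb gb fQ gQ a(1) w(1) by (simp add: op_tensor_adj op_compose_assoc)
  have GxG: "x \<otimes>\<^sub>o g = ?G o\<^sub>L (x \<otimes>\<^sub>o id_blinfun) o\<^sub>L ?G"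
    using gQ(3) gb xb by (simp add: op_tensor_compose op_compose_id)
  have "?F o\<^sub>L B o\<^sub>L ?F = (?F o\<^sub>L A o\<^sub>L ?G) o\<^sub>L (x \<otimes>\<^sub>o id_blinfun) o\<^sub>L (?G o\<^sub>L A o\<^sub>L ?F)"
    unfolding B_def GxG by (simp only: op_compose_assoc)
  also have "\<dots> = (a o\<^sub>L x o\<^sub>L a\<^sup>\<dagger>) \<otimes>\<^sub>o f"
    unfolding a(2) adj using a(1) w xb by (simp add: op_tensor_compose op_compose_id)
  finally have "b \<otimes>\<^sub>o f = (a o\<^sub>L x o\<^sub>L a\<^sup>\<dagger>) \<otimes>\<^sub>o f" using FBF by simp
  then have "b = a o\<^sub>L x o\<^sub>L a\<^sup>\<dagger>"
    by (intro op_tensor_cancel[OF bb _ fb f(2)]) (use a(1) xb in auto)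
  then show ?thesis using b(1) by simp
qed

lemma op_tensor_id_commutes:
  assumes "von_neumann_algebra P" "von_neumann_algebra Q" "commutative_ops Q" "f \<in> Q" "X \<in> P \<otimes>\<^sub>A Q"
  shows "(id_blinfun \<otimes>\<^sub>o f) o\<^sub>L X = X o\<^sub>L (id_blinfun \<otimes>\<^sub>o f)"
proof (rule vN_tensor_commute[OF assms(1,2) id_commutant _ assms(5)])
  show "f \<in> commutant Q"
    using assms(3,4) vN_bounded[OF assms(2,4)] unfolding commutative_ops_def commutant_def by blast
qed

text \<open>Multiplication by \<open>1 \<otimes> w\<^sup>*\<close> turns the \<open>(f, g)\<close> entry of \<open>A\<close> into a diagonal corner, which is \<open>a \<otimes> f\<close> for a slice
  \<open>a \<in> R\<close>.  As \<open>A (1 \<otimes> g) A\<close> and \<open>A\<^sup>2\<close> lie in \<open>P \<otimes> Q\<close>, they commute with \<open>1 \<otimes> f\<close> and \<open>1 \<otimes> g\<close>, and with this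
  \<open>A\<^sup>3 = A\<close> yields \<open>a a\<^sup>* a = a\<close>.  So \<open>a\<close> is a partial isometry normalising \<open>P\<close>.\<close>

lemma matrix_entry_in_singular_masa:
  fixes R P :: "'i op set" and N Q :: "'j op set"
  assumes R: "von_neumann_algebra R" and P: "singular_masa R P"
    and N: "von_neumann_algebra N" and Q: "masa N Q"
    and A: "A \<in> R \<otimes>\<^sub>A N" "A\<^sup>\<dagger> = A" "A o\<^sub>L A o\<^sub>L A = A"
      "\<And>x. x \<in> P \<otimes>\<^sub>A Q \<Longrightarrow> A o\<^sub>L x o\<^sub>L A \<in> P \<otimes>\<^sub>A Q"
    and f: "f \<in> projections Q" "f \<noteq> 0" and g: "g \<in> projections Q" "g \<noteq> 0"
    and cf: "\<And>T. T \<in> N \<Longrightarrow> \<exists>c. f o\<^sub>L T o\<^sub>L f = c *\<^sub>O f"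
    and cg: "\<And>T. T \<in> N \<Longrightarrow> \<exists>c. g o\<^sub>L T o\<^sub>L g = c *\<^sub>O g"
    and w: "w \<in> N" "w\<^sup>\<dagger> o\<^sub>L w = g" "w o\<^sub>L w\<^sup>\<dagger> = f"
  obtains a where "a \<in> P" "(id_blinfun \<otimes>\<^sub>o f) o\<^sub>L A o\<^sub>L (id_blinfun \<otimes>\<^sub>o g) = a \<otimes>\<^sub>o w"
proof -
  have mP: "masa R P" using P by (auto simp: singular_masa_def)
  have vP: "von_neumann_algebra P" and PR: "P \<subseteq> R" using mP by (auto simp: masa_def)
  have vQ: "von_neumann_algebra Q" and QN: "Q \<subseteq> N" and cQ: "commutative_ops Q" using Q by (auto simp: masa_def)
  let ?F = "id_blinfun \<otimes>\<^sub>o f :: ('i \<times> 'j) op" and ?G = "id_blinfun \<otimes>\<^sub>o g :: ('i \<times> 'j) op"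
  have fQ: "f \<in> Q" "f\<^sup>\<dagger> = f" "f o\<^sub>L f = f" and gQ: "g \<in> Q" "g\<^sup>\<dagger> = g" "g o\<^sub>L g = g"
    using f g by (auto simp: projections_def)
  have fN: "f \<in> N" using fQ QN by blast
  have fb: "f \<in> bounded_ops" and gb: "g \<in> bounded_ops" using vN_bounded[OF vQ] fQ gQ by auto
  have wb: "w \<in> bounded_ops" using vN_bounded[OF N w(1)] .
  have vRN: "von_neumann_algebra (R \<otimes>\<^sub>A N)" by (rule vN_tensor_von_neumann[OF R N])
  have Ab: "A \<in> bounded_ops" using vN_bounded[OF vRN A(1)] .
  have FF: "?F o\<^sub>L ?F = ?F" and GG: "?G o\<^sub>L ?G = ?G"
    using fb gb fQ gQ by (simp_all add: op_tensor_compose op_compose_id)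
  have wfg: "f o\<^sub>L w = w" "w o\<^sub>L g = w" "w\<^sup>\<dagger> o\<^sub>L f = w\<^sup>\<dagger>"
  proof -
    \<comment> \<open>\<open>w - w w\<^sup>* w\<close> has vanishing absolute square because \<open>w\<^sup>* w = g\<close> is a projection.\<close>
    define d where "d = w - (w o\<^sub>L g)"
    have db: "d \<in> bounded_ops" using wb gb by (simp add: d_def)
    have wwa: "w\<^sup>\<dagger> (w \<xi>) = g \<xi>" for \<xi> using w(2) by (metis blinfun_apply_blinfun_compose)
    have "d\<^sup>\<dagger> = w\<^sup>\<dagger> - (g o\<^sub>L w\<^sup>\<dagger>)" using wb gb gQ by (simp add: d_def)
    then have "d\<^sup>\<dagger> o\<^sub>L d = 0"
      by (intro blinfun_eqI) (simp add: d_def blinfun_lin wwa projection_apply[OF gQ(3)])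
    then have "d = 0" by (rule adj_compose_self_eq_0[OF db])
    then show wg: "w o\<^sub>L g = w" by (simp add: d_def)
    then show fw: "f o\<^sub>L w = w" using w by (simp add: op_compose_assoc flip: w(3))
    have "(f o\<^sub>L w)\<^sup>\<dagger> = w\<^sup>\<dagger>" using fw by simp
    then show "w\<^sup>\<dagger> o\<^sub>L f = w\<^sup>\<dagger>" using fb wb fQ by simp
  qed
  have w0: "w \<noteq> 0" using w(2) g(2) by auto
  define W :: "('i \<times> 'j) op" where "W = id_blinfun \<otimes>\<^sub>o w\<^sup>\<dagger>"
  have "W \<in> R \<otimes>\<^sub>A N" unfolding W_def by (intro op_tensor_in_vN_tensor vN_id[OF R] vN_adj[OF N w(1)])
  then have X: "A o\<^sub>L W \<in> R \<otimes>\<^sub>A N" by (intro vN_compose[OF vRN] A(1))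
  obtain \<eta> where eta: "f \<eta> = \<eta>" "norm \<eta> = 1" using projection_unit_vector[OF fb fQ(3) f(2)] .
  obtain a where a: "a \<in> R"
    "\<And>u v. cinner u (blinfun_apply a v) = cinner (u \<otimes>\<^sub>v \<eta>) ((A o\<^sub>L W) (v \<otimes>\<^sub>v \<eta>))"
    using vN_tensor_slice_left_factor[OF R N X] by blast
  have ab: "a \<in> bounded_ops" using vN_bounded[OF R a(1)] .
  have "?F o\<^sub>L (A o\<^sub>L W) o\<^sub>L ?F = a \<otimes>\<^sub>o f"
    by (rule minimal_corner_eq_slice[OF R N X fN fQ(2) cf eta ab a(2)])
  moreover have "W o\<^sub>L ?F = W" using wb fb wfg by (simp add: W_def op_tensor_compose op_compose_id)
  ultimately have "?F o\<^sub>L A o\<^sub>L W = a \<otimes>\<^sub>o f" by (simp add: op_compose_assoc)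
  then have "?F o\<^sub>L A o\<^sub>L (W o\<^sub>L (id_blinfun \<otimes>\<^sub>o w)) = (a \<otimes>\<^sub>o f) o\<^sub>L (id_blinfun \<otimes>\<^sub>o w)"
    by (metis op_compose_assoc)
  then have entry: "?F o\<^sub>L A o\<^sub>L ?G = a \<otimes>\<^sub>o w"
    using wb fb ab w(2) wfg by (simp add: W_def op_tensor_compose op_compose_id)
  have "(?F o\<^sub>L A o\<^sub>L ?G)\<^sup>\<dagger> = (a \<otimes>\<^sub>o w)\<^sup>\<dagger>" using entry by simp
  then have entry': "?G o\<^sub>L A o\<^sub>L ?F = a\<^sup>\<dagger> \<otimes>\<^sub>o w\<^sup>\<dagger>"
    using A Ab fb gb fQ gQ ab wb by (simp add: op_tensor_adj op_compose_assoc)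
  have inv1: "a o\<^sub>L x o\<^sub>L a\<^sup>\<dagger> \<in> P" if "x \<in> P" for x
    using matrix_entry_normalises[OF R N vP PR vQ QN Ab A(2,4) f g(1) cf wb w(3) ab entry that] .
  have inv2: "a\<^sup>\<dagger> o\<^sub>L x o\<^sub>L a \<in> P" if "x \<in> P" for x
    using matrix_entry_normalises[OF R N vP PR vQ QN Ab A(2,4) g f(1) cg _ _ _ entry' that] wb w(2) ab by simp
  have AgA: "A o\<^sub>L ?G o\<^sub>L A \<in> P \<otimes>\<^sub>A Q"
    by (intro A(4) op_tensor_in_vN_tensor vN_id[OF vP] gQ(1))
  have AA: "A o\<^sub>L A \<in> P \<otimes>\<^sub>A Q"
    using A(4)[OF vN_id[OF vN_tensor_von_neumann[OF vP vQ]]] by (simp add: op_compose_id)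
  have c1: "?F o\<^sub>L (A o\<^sub>L ?G o\<^sub>L A) = (A o\<^sub>L ?G o\<^sub>L A) o\<^sub>L ?F"
    by (rule op_tensor_id_commutes[OF vP vQ cQ fQ(1) AgA])
  have c2: "?G o\<^sub>L (A o\<^sub>L A) = (A o\<^sub>L A) o\<^sub>L ?G"
    by (rule op_tensor_id_commutes[OF vP vQ cQ gQ(1) AA])
  have "(?F o\<^sub>L A o\<^sub>L ?G) o\<^sub>L (?G o\<^sub>L A o\<^sub>L ?F) o\<^sub>L (?F o\<^sub>L A o\<^sub>L ?G) = ?F o\<^sub>L A o\<^sub>L ?G"
  proof -
    have "(?F o\<^sub>L A o\<^sub>L ?G) o\<^sub>L (?G o\<^sub>L A o\<^sub>L ?F) o\<^sub>L (?F o\<^sub>L A o\<^sub>L ?G)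
        = ?F o\<^sub>L A o\<^sub>L (?G o\<^sub>L ?G) o\<^sub>L A o\<^sub>L (?F o\<^sub>L ?F) o\<^sub>L A o\<^sub>L ?G" by (simp only: op_compose_assoc)
    also have "\<dots> = ?F o\<^sub>L ((A o\<^sub>L ?G o\<^sub>L A) o\<^sub>L ?F) o\<^sub>L A o\<^sub>L ?G" unfolding FF GG by (simp only: op_compose_assoc)
    also have "\<dots> = (?F o\<^sub>L ?F) o\<^sub>L A o\<^sub>L (?G o\<^sub>L (A o\<^sub>L A)) o\<^sub>L ?G" unfolding c1[symmetric] by (simp only: op_compose_assoc)
    also have "\<dots> = ?F o\<^sub>L (A o\<^sub>L A o\<^sub>L A) o\<^sub>L (?G o\<^sub>L ?G)" unfolding FF c2 by (simp only: op_compose_assoc)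
    finally show ?thesis unfolding A(3) GG .
  qed
  then have "(a o\<^sub>L a\<^sup>\<dagger> o\<^sub>L a) \<otimes>\<^sub>o (w o\<^sub>L w\<^sup>\<dagger> o\<^sub>L w) = a \<otimes>\<^sub>o w"
    unfolding entry entry' using ab wb by (simp add: op_tensor_compose)
  moreover have "w o\<^sub>L w\<^sup>\<dagger> o\<^sub>L w = w" unfolding w(3) by (rule wfg(1))
  ultimately have "(a o\<^sub>L a\<^sup>\<dagger> o\<^sub>L a) \<otimes>\<^sub>o w = a \<otimes>\<^sub>o w" by (simp only:)
  then have "a o\<^sub>L a\<^sup>\<dagger> o\<^sub>L a = a"
    by (rule op_tensor_cancel[OF _ ab wb w0, rotated]) (simp add: ab)
  then have "a \<in> P"
    by (rule singular_masa_contains_partial_normaliser[OF R P a(1) _ inv1 inv2])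
  then show ?thesis using entry that by blast
qed

text \<open>Matrix units adapted to \<open>Q\<close> lie in the algebra generated by the normaliser, and the coefficients of \<open>A\<close> with
  respect to them lie in \<open>P\<close>.\<close>

lemma partial_symmetry_in_masa_tensor_normaliser:
  fixes R P :: "'i op set" and N Q :: "'j op set"
  assumes R: "von_neumann_algebra R" and P: "singular_masa R P"
    and N: "matrix_algebra N" and Q: "masa N Q"
    and A: "A \<in> R \<otimes>\<^sub>A N" "A\<^sup>\<dagger> = A" "A o\<^sub>L A o\<^sub>L A = A"
      "\<And>x. x \<in> P \<otimes>\<^sub>A Q \<Longrightarrow> A o\<^sub>L x o\<^sub>L A \<in> P \<otimes>\<^sub>A Q"
  shows "A \<in> P \<otimes>\<^sub>A normaliser_algebra N Q"
proof -
  have vN: "von_neumann_algebra N" using N by (rule matrix_algebra_von_neumann)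
  have vP: "von_neumann_algebra P" using P by (auto simp: singular_masa_def masa_def)
  have vQ: "von_neumann_algebra Q" and QN: "Q \<subseteq> N" and cQ: "commutative_ops Q" using Q by (auto simp: masa_def)
  have vNQ: "von_neumann_algebra (normaliser_algebra N Q)" by (rule normaliser_algebra_von_neumann[OF vN])
  have vPN: "von_neumann_algebra (P \<otimes>\<^sub>A normaliser_algebra N Q)" by (rule vN_tensor_von_neumann[OF vP vNQ])
  obtain B where B: "finite B" "N \<subseteq> span B" using matrix_algebra_finite_dimensional[OF N] .
  obtain F where F: "orthogonal_family Q F" "\<Sum>F = id_blinfun"
    and minimal: "\<And>f g. f \<in> F \<Longrightarrow> g \<in> projections Q \<Longrightarrow> g o\<^sub>L f = 0 \<or> g o\<^sub>L f = f"
    using exists_minimal_projections[OF B(1) subset_trans[OF QN B(2)] vQ cQ] by metis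
  have fQ: "f \<in> projections Q" "f \<noteq> 0" if "f \<in> F" for f using F(1) that by (auto simp: orthogonal_family_def)
  have fb: "f \<in> bounded_ops" if "f \<in> F" for f using projections_bounded[OF vQ fQ(1)[OF that]] .
  have corner: "\<exists>c. f o\<^sub>L T o\<^sub>L f = c *\<^sub>O f" if "f \<in> F" "T \<in> N" for f T
    by (rule masa_minimal_projection_corner[OF vN Q fQ[OF that(1)] minimal[OF that(1)] that(2)])
  have entry: "(id_blinfun \<otimes>\<^sub>o f) o\<^sub>L A o\<^sub>L (id_blinfun \<otimes>\<^sub>o g) \<in> P \<otimes>\<^sub>A normaliser_algebra N Q"
    if f: "f \<in> F" and g: "g \<in> F" for f g
  proof -
    have fg: "f = g \<or> f o\<^sub>L g = 0" using F(1) f g by (auto simp: orthogonal_family_def)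
    obtain w where w: "w \<in> normaliser_algebra N Q" "w\<^sup>\<dagger> o\<^sub>L w = g" "w o\<^sub>L w\<^sup>\<dagger> = f"
      using exists_matrix_unit[OF N Q fQ[OF f] fQ[OF g] fg corner[OF f] corner[OF g]] .
    have "w \<in> N" using w(1) normaliser_algebra_subset[OF vN] by blast
    then obtain a where "a \<in> P" "(id_blinfun \<otimes>\<^sub>o f) o\<^sub>L A o\<^sub>L (id_blinfun \<otimes>\<^sub>o g) = a \<otimes>\<^sub>o w"
      using matrix_entry_in_singular_masa[OF R P vN Q A fQ[OF f] fQ[OF g] corner[OF f] corner[OF g] _ w(2,3)]
      by blast
    then show ?thesis using w(1) by (simp add: op_tensor_in_vN_tensor)
  qed
  have one: "(\<Sum>f\<in>F. id_blinfun \<otimes>\<^sub>o f) = (id_blinfun :: ('i \<times> 'j) op)"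
    using F(2) fb by (simp add: op_tensor_id flip: op_tensor_sum_right)
  have "A = (\<Sum>f\<in>F. id_blinfun \<otimes>\<^sub>o f) o\<^sub>L A o\<^sub>L (\<Sum>g\<in>F. id_blinfun \<otimes>\<^sub>o g)"
    unfolding one by (simp add: op_compose_id)
  also have "\<dots> = (\<Sum>g\<in>F. \<Sum>f\<in>F. (id_blinfun \<otimes>\<^sub>o f) o\<^sub>L A o\<^sub>L (id_blinfun \<otimes>\<^sub>o g))"
    by (simp add: op_compose_sum_left op_compose_sum_right)
  also have "\<dots> \<in> P \<otimes>\<^sub>A normaliser_algebra N Q"
    by (intro vN_sum[OF vPN] entry)
  finally show ?thesis .
qed

section \<open>Positive operators of trace zero\<close>

text \<open>Polarisation with the vectors \<open>x + y\<close> and \<open>x + \<i> y\<close>.\<close>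

lemma op_eq_0_if_quadratic_form_0:
  fixes D :: "'i op"
  assumes D: "D \<in> bounded_ops" and 0: "\<And>\<xi>. cinner \<xi> (D \<xi>) = 0"
  shows "D = 0"
proof (rule blinfun_eqI, rule cinner_ext)
  fix y x
  have "cinner x (D y) + cinner y (D x) = 0"
    using 0[of "x + y"] by (simp add: cinner_simps blinfun_lin 0 add.commute)
  moreover have "\<i> * cinner x (D y) - \<i> * cinner y (D x) = 0"
    using 0[of "x + \<i> *\<^sub>C y"] by (simp add: cinner_simps blinfun_lin 0 bounded_opsD[OF D])
  then have "cinner x (D y) = cinner y (D x)" by simp
  ultimately show "cinner x (D y) = cinner x (blinfun_apply 0 y)" by simp
qed

lemma projection_in_pos_cone:
  assumes M: "von_neumann_algebra M" and p: "p \<in> projections M"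
  shows "p \<in> pos_cone M"
proof -
  have pM: "p \<in> M" "p\<^sup>\<dagger> = p" "p o\<^sub>L p = p" using p by (auto simp: projections_def)
  have pb: "p \<in> bounded_ops" using vN_bounded[OF M pM(1)] .
  have "cinner x (p x) = cinner (p x) (p x)" for x
    using cinner_adj_left[OF pb, of x "p x"] pM(2) projection_apply[OF pM(3)] by simp
  then show ?thesis using pb pM(1) by (simp add: pos_cone_def positive_op_def cinner_norm)
qed

text \<open>The quadratic form of \<open>x\<close> is real, so the imaginary part of the decomposition of \<open>x\<close> into four positive
  operators vanishes.\<close>

lemma has_trace_hermitian_zero:
  fixes \<tau> :: "'i op \<Rightarrow> ennreal"
  assumes M: "von_neumann_algebra M" and x: "x \<in> M" "\<And>\<xi>. cinner \<xi> (x \<xi>) \<in> \<real>"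
    and tr: "has_trace M \<tau> x 0"
  obtains y z where "y \<in> pos_cone M" "z \<in> pos_cone M" "\<tau> y = \<tau> z" "\<tau> z < \<infinity>" "x = y - z"
proof -
  obtain y z y' z' where pos: "y \<in> pos_cone M" "z \<in> pos_cone M" "y' \<in> pos_cone M" "z' \<in> pos_cone M"
    and fin: "\<tau> y < \<infinity>" "\<tau> z < \<infinity>"
    and eq: "x = (y - z) + \<i> *\<^sub>O (y' - z')"
    and zero: "0 = complex_of_real (enn2real (\<tau> y) - enn2real (\<tau> z)) +
            \<i> * complex_of_real (enn2real (\<tau> y') - enn2real (\<tau> z'))"
    using tr unfolding has_trace_def by blast
  have b: "y \<in> bounded_ops" "z \<in> bounded_ops" "y' \<in> bounded_ops" "z' \<in> bounded_ops"
    using pos vN_bounded[OF M] by (auto simp: pos_cone_def)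
  have real: "Im (cinner \<xi> (t \<xi>)) = 0" if "t \<in> pos_cone M" for t \<xi>
    using that by (auto simp: pos_cone_def positive_op_def complex_nonneg_Reals_iff)
  have "cinner \<xi> ((y' - z') \<xi>) = 0" for \<xi>
  proof -
    have "Im (cinner \<xi> (x \<xi>)) = 0" using x(2)[of \<xi>] by (auto elim!: Reals_cases)
    then have "Re (cinner \<xi> ((y' - z') \<xi>)) = 0"
      by (simp add: eq blinfun_lin cinner_simps real pos)
    then show ?thesis by (simp add: complex_eq_iff blinfun_lin cinner_simps real pos)
  qed
  then have "y' - z' = 0" by (intro op_eq_0_if_quadratic_form_0) (use b in simp_all)
  then have x_eq: "x = y - z" unfolding eq by (intro blinfun_eqI) (simp add: blinfun_lin)
  have "Re 0 = enn2real (\<tau> y) - enn2real (\<tau> z)" by (subst zero) simp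
  then have "\<tau> y = \<tau> z" using fin by (metis eq_iff_diff_eq_0 ennreal_enn2real infinity_ennreal_def zero_complex.sel(1))
  then show ?thesis using that pos fin x_eq by blast
qed

lemma faithful_trace_zero_if_absorbed:
  assumes tr: "trace_on M \<tau>" "faithful_trace M \<tau>" and p: "p \<in> pos_cone M" and z: "z \<in> pos_cone M"
    and fin: "\<tau> z < \<infinity>" and eq: "\<tau> (p + z) = \<tau> z"
  shows "p = 0"
proof -
  have "\<tau> p + \<tau> z = 0 + \<tau> z" using tr(1) p z eq by (simp add: trace_on_def)
  then have "\<tau> p = 0" using fin by (auto simp: add.commute ennreal_add_left_cancel)
  then show ?thesis using tr(2) p by (simp add: faithful_trace_def)
qed

lemma projection_zero_if_signed_trace_zero:
  assumes M: "von_neumann_algebra M" and tr: "trace_on M \<tau>" "faithful_trace M \<tau>"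
    and p: "p \<in> projections M" and x: "has_trace M \<tau> x 0" "x = p \<or> x = - p"
  shows "p = 0"
proof -
  have pM: "p \<in> M" using p by (auto simp: projections_def)
  have pp: "p \<in> pos_cone M" by (rule projection_in_pos_cone[OF M p])
  have "- p \<in> M" using vN_scaleR[OF M pM, of "-1"] by simp
  then have xM: "x \<in> M" using x(2) pM by auto
  have "cinner \<xi> (x \<xi>) \<in> \<real>" for \<xi>
    using pp x(2) nonneg_Reals_subset_Reals by (auto simp: pos_cone_def positive_op_def blinfun_lin)
  then obtain y z where yz: "y \<in> pos_cone M" "z \<in> pos_cone M" "\<tau> y = \<tau> z" "\<tau> z < \<infinity>" "x = y - z"
    using has_trace_hermitian_zero[OF M xM _ x(1)] by metis
  from x(2) show ?thesis
  proof
    assume "x = p"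
    then have "p + z = y" using yz(5) by (simp add: algebra_simps)
    then show ?thesis using faithful_trace_zero_if_absorbed[OF tr pp yz(2,4)] yz(3) by simp
  next
    assume "x = - p"
    then have "p + y = z" using yz(5) by (simp add: algebra_simps)
    then show ?thesis using faithful_trace_zero_if_absorbed[OF tr pp yz(1)] yz(3,4) by simp
  qed
qed

section \<open>Promising projects over a singular outlook\<close>

theorem theorem5p4:
  fixes R P :: "'i op set" and tr :: "'i op \<Rightarrow> ennreal" and a :: "('i, 'j) project"
  assumes "hyperfinite_II_infinity R"
    and "fns_trace R tr"
    and "singular_masa R P"
    and "is_project R a"
    and "promising R tr P a"
  shows "oper a = 0"
proof -
  let ?A = "oper a" and ?N = "dialect a"
  have R: "von_neumann_algebra R" using assms(1) by (simp add: hyperfinite_II_infinity_def)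
  have N: "matrix_algebra ?N" using assms(5) by (simp add: promising_def)
  have vN: "von_neumann_algebra ?N" using N by (rule matrix_algebra_von_neumann)
  obtain Q \<tau> where Q: "masa ?N Q" and sym: "partial_symmetry ?A"
    and grp: "?A \<in> normalising_groupoid (R \<otimes>\<^sub>A ?N) (P \<otimes>\<^sub>A Q)"
    and \<tau>: "tensor_trace R tr ?N (form a) \<tau>"
    and zero: "\<And>\<pi>. \<pi> \<in> projections (P \<otimes>\<^sub>A normaliser_algebra ?N Q) \<Longrightarrow> has_trace (R \<otimes>\<^sub>A ?N) \<tau> (\<pi> o\<^sub>L ?A) 0"
    using assms(5) unfolding promising_def by blast
  have adj: "?A\<^sup>\<dagger> = ?A" using sym by (simp add: partial_symmetry_def hermitian_def)
  then have AAA: "?A o\<^sub>L ?A o\<^sub>L ?A = ?A"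
    using sym by (simp add: partial_symmetry_def partial_isometry_def)
  have ARN: "?A \<in> R \<otimes>\<^sub>A ?N" using grp by (simp add: normalising_groupoid_def)
  have inv: "?A o\<^sub>L x o\<^sub>L ?A \<in> P \<otimes>\<^sub>A Q" if "x \<in> P \<otimes>\<^sub>A Q" for x
    using grp that by (auto simp: normalising_groupoid_def adj)
  let ?PN = "P \<otimes>\<^sub>A normaliser_algebra ?N Q"
  have APN: "?A \<in> ?PN"
    by (rule partial_symmetry_in_masa_tensor_normaliser[OF R assms(3) N Q ARN adj AAA inv])
  have P: "von_neumann_algebra P" "P \<subseteq> R" using assms(3) by (auto simp: singular_masa_def masa_def)
  have vPN: "von_neumann_algebra ?PN"
    by (intro vN_tensor_von_neumann P normaliser_algebra_von_neumann vN)
  have vRN: "von_neumann_algebra (R \<otimes>\<^sub>A ?N)" by (rule vN_tensor_von_neumann[OF R vN])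
  have sub: "?PN \<subseteq> R \<otimes>\<^sub>A ?N"
    by (intro vN_tensor_mono P R vN normaliser_algebra_subset)
  have tr: "trace_on (R \<otimes>\<^sub>A ?N) \<tau>" "faithful_trace (R \<otimes>\<^sub>A ?N) \<tau>"
    using \<tau> by (simp_all add: tensor_trace_def fns_trace_def)
  have Ab: "?A \<in> bounded_ops" using vN_bounded[OF vRN ARN] .
  have A3: "?A (?A (?A \<xi>)) = ?A \<xi>" for \<xi> using AAA by (metis blinfun_apply_blinfun_compose)
  \<comment> \<open>\<open>p 1\<close> and \<open>p (-1)\<close> are the projections onto the eigenspaces of the partial symmetry for \<open>1\<close> and \<open>-1\<close>.\<close>
  define p where "p s = (1/2) *\<^sub>R ((?A o\<^sub>L ?A) + s *\<^sub>R ?A)" for s :: real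
  have p0: "p s = 0" if s: "s = 1 \<or> s = -1" for s
  proof -
    have "p s \<in> ?PN" unfolding p_def by (intro vN_scaleR vN_add vN_compose vPN APN)
    moreover have "(p s)\<^sup>\<dagger> = p s" using Ab adj by (simp add: p_def)
    moreover have "p s o\<^sub>L p s = p s"
      by (rule blinfun_eqI) (use s in \<open>auto simp: p_def blinfun_lin A3 algebra_simps simp flip: scaleR_add_left\<close>)
    ultimately have proj: "p s \<in> projections ?PN" by (simp add: projections_def)
    then have "p s \<in> projections (R \<otimes>\<^sub>A ?N)" using sub by (auto simp: projections_def)
    moreover have "p s o\<^sub>L ?A = s *\<^sub>R p s"
      by (rule blinfun_eqI) (use s in \<open>auto simp: p_def blinfun_lin A3 algebra_simps\<close>)
    ultimately show ?thesis
      using projection_zero_if_signed_trace_zero[OF vRN tr _ zero[OF proj]] s by auto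
  qed
  have "?A = p 1 - p (-1)"
    by (rule blinfun_eqI) (simp add: p_def blinfun_lin algebra_simps flip: scaleR_add_left)
  then show ?thesis using p0 by simp
qed

end
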